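(* There is a dynamic programming algorithm (\textsc{algorithm Trunks}) on the uniform-cost RAM which, given any instance of the optimum-BST-on-the-HMM problem with $n$ keys and a memory hierarchy with $h\ge 2$ levels of sizes $m_1,\dots,m_h$, constructs an optimum solution $\langle T^*,\phi^*\rangle$ in time $$O\!\left(\frac{2^{\,n-m_h}\,(n-m_h+h)^{\,n-m_h}\, n^3}{(h-2)!}\right).$$
   Context: Binary search trees. Given $n\ge 1$ keys $x_1\prec x_2\prec\cdots\prec x_n$ from a totally ordered universe, a binary search tree (BST) $T$ over the keys is an ordered rooted binary tree with $n$ internal nodes, identified with the keys so that an inorder traversal visits $x_1,\dots,x_n$ in order, and $n+1$ external nodes (leaves) $z_0,\dots,z_n$ from left to right, where $z_j$ represents the search arguments $y$ with $x_j\prec y\prec x_{j+1}$ (with the convention that $z_0$ means $y\prec x_1$ and $z_n$ means $y\succ x_n$). Also given are $p_i\ge 0$ ($1\le i\le n$), the probability that $y=x_i$, and $q_j\ge 0$ ($0\le j\le n$), the probability that $y$ falls in the interval of $z_j$; $\sum_i p_i+\sum_j q_j=1$. For a node $v$ of $T$, let $T_v$ be the subtree rooted at $v$ and let $w(T_v)$ be the sum of all $p_i$ and $q_j$ over the internal nodes $x_i$ and external nodes $z_j$ in $T_v$; in particular $w(T_{z_j})=q_j$. Hierarchical memory (HMM). There are $n$ memory locations with addresses $1,\dots,n$ partitioned into $h$ levels, level $l$ having $m_l$ locations, $\sum_{l=1}^h m_l=n$. A single access to a location in level $l$ costs $c_l\in\mathbb N$, where $c_1<c_2<\cdots<c_h$.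 The addresses are ordered from fastest to slowest, so $\mu(a)=c_l$ when $m_1+\cdots+m_{l-1}<a\le m_1+\cdots+m_l$. The problem. A solution is a pair $\langle T,\phi\rangle$ of a BST $T$ over the keys and a one-to-one memory assignment $\phi$ of the internal nodes of $T$ to the addresses $\{1,\dots,n\}$. External nodes are not stored; for an external node $z_j$, $\phi(z_j)$ denotes the address at which the parent of $z_j$ is stored. The cost of a solution (called the expected cost of a search) is $$\mathrm{cost}(\langle T,\phi\rangle)=\sum_{i=1}^n w(T_{x_i})\,\mu(\phi(x_i))+\sum_{j=0}^n w(T_{z_j})\,\mu(\phi(z_j)).$$ A solution is optimum if its cost is minimum over all pairs $\langle T,\phi\rangle$. The algorithm is given the $p_i$, $q_j$, $m_l$ and $c_l$. Uniform-cost RAM: each memory access, arithmetic operation and comparison on numbers takes unit time. *)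

theory Defs
  imports Complex_Main
begin

section \<open>Binary search trees with labelled external nodes\<close>

text \<open>
  The key \<open>x\<^sub>i\<close> is represented by its rank \<open>i\<close>; only the order of the keys matters.
  \<open>Key i\<close> is the internal node \<open>x\<^sub>i\<close> and \<open>Gap j\<close> is the external node \<open>z\<^sub>j\<close>.
\<close>

datatype node = Key nat | Gap nat

datatype bintree = External nat | Internal bintree nat bintree

fun root_node :: "bintree \<Rightarrow> node" where
  "root_node (External j) = Gap j"
| "root_node (Internal l i r) = Key i"

fun inorder :: "bintree \<Rightarrow> node list" where
  "inorder (External j) = [Gap j]"
| "inorder (Internal l i r) = inorder l @ Key i # inorder r"

fun subtrees :: "bintree \<Rightarrow> bintree set" where
  "subtrees (External j) = {External j}"
| "subtrees (Internal l i r) = insert (Internal l i r) (subtrees l \<union> subtrees r)"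

definition is_bst :: "nat \<Rightarrow> bintree \<Rightarrow> bool" where
  "is_bst n T \<longleftrightarrow> inorder T = Gap 0 # concat (map (\<lambda>i. [Key i, Gap i]) [1..<Suc n])"

definition subtree_at :: "bintree \<Rightarrow> node \<Rightarrow> bintree" where
  "subtree_at T v = (THE S. S \<in> subtrees T \<and> root_node S = v)"

definition gap_parent :: "bintree \<Rightarrow> nat \<Rightarrow> nat" where
  "gap_parent T j =
     (THE i. \<exists>l r. Internal l i r \<in> subtrees T \<and> (l = External j \<or> r = External j))"

fun weight :: "(nat \<Rightarrow> real) \<Rightarrow> (nat \<Rightarrow> real) \<Rightarrow> bintree \<Rightarrow> real" where
  "weight p q (External j) = q j"
| "weight p q (Internal l i r) = weight p q l + p i + weight p q r"


section \<open>The optimum BST problem on the hierarchical memory model\<close>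

text \<open>
  The values \<open>m l\<close>, \<open>c l\<close> are relevant for \<open>1 \<le> l \<le> h\<close>, \<open>p i\<close> for \<open>1 \<le> i \<le> n\<close> and
  \<open>q j\<close> for \<open>0 \<le> j \<le> n\<close>. The levels partition the locations, so each level is nonempty.
\<close>

definition hmm_bst_instance ::
  "nat \<Rightarrow> nat \<Rightarrow> (nat \<Rightarrow> nat) \<Rightarrow> (nat \<Rightarrow> nat) \<Rightarrow> (nat \<Rightarrow> real) \<Rightarrow> (nat \<Rightarrow> real) \<Rightarrow> bool" where
  "hmm_bst_instance n h m c p q \<longleftrightarrow>
     n \<ge> 1 \<and>
     (\<forall>l\<in>{1..h}. m l \<ge> 1) \<and> (\<Sum>l=1..h. m l) = n \<and>
     strict_mono_on {1..h} c \<and>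
     (\<forall>i\<in>{1..n}. p i \<ge> 0) \<and> (\<forall>j\<in>{0..n}. q j \<ge> 0) \<and>
     (\<Sum>i=1..n. p i) + (\<Sum>j=0..n. q j) = 1"

definition mem_level :: "nat \<Rightarrow> (nat \<Rightarrow> nat) \<Rightarrow> nat \<Rightarrow> nat" where
  "mem_level h m a =
     (THE l. l \<in> {1..h} \<and> (\<Sum>k=1..<l. m k) < a \<and> a \<le> (\<Sum>k=1..l. m k))"

definition mem_cost :: "nat \<Rightarrow> (nat \<Rightarrow> nat) \<Rightarrow> (nat \<Rightarrow> nat) \<Rightarrow> nat \<Rightarrow> nat" where
  "mem_cost h m c a = c (mem_level h m a)"

definition is_solution :: "nat \<Rightarrow> bintree \<Rightarrow> (nat \<Rightarrow> nat) \<Rightarrow> bool" where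
  "is_solution n T \<phi> \<longleftrightarrow> is_bst n T \<and> inj_on \<phi> {1..n} \<and> \<phi> ` {1..n} \<subseteq> {1..n}"

definition solution_cost ::
  "nat \<Rightarrow> nat \<Rightarrow> (nat \<Rightarrow> nat) \<Rightarrow> (nat \<Rightarrow> nat) \<Rightarrow> (nat \<Rightarrow> real) \<Rightarrow> (nat \<Rightarrow> real)
     \<Rightarrow> bintree \<Rightarrow> (nat \<Rightarrow> nat) \<Rightarrow> real" where
  "solution_cost n h m c p q T \<phi> =
     (\<Sum>i=1..n. weight p q (subtree_at T (Key i)) * real (mem_cost h m c (\<phi> i))) +
     (\<Sum>j=0..n. weight p q (subtree_at T (Gap j)) * real (mem_cost h m c (\<phi> (gap_parent T j))))"

definition is_optimum ::
  "nat \<Rightarrow> nat \<Rightarrow> (nat \<Rightarrow> nat) \<Rightarrow> (nat \<Rightarrow> nat) \<Rightarrow> (nat \<Rightarrow> real) \<Rightarrow> (nat \<Rightarrow> real)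
     \<Rightarrow> bintree \<Rightarrow> (nat \<Rightarrow> nat) \<Rightarrow> bool" where
  "is_optimum n h m c p q T \<phi> \<longleftrightarrow>
     is_solution n T \<phi> \<and>
     (\<forall>T' \<phi>'. is_solution n T' \<phi>' \<longrightarrow>
        solution_cost n h m c p q T \<phi> \<le> solution_cost n h m c p q T' \<phi>')"


section \<open>The uniform-cost RAM\<close>

text \<open>
  The machine has registers, addressed only by constants in the program text (so a program uses
  finitely many of them), and a random access memory. Both hold numbers. Probabilities are
  arbitrary reals, hence so are the numbers; there is no rounding operation, and program constants
  are integers, so that no real number can be hidden in a program. Every instruction takes unit
  time. A memory access at an address that is not a natural number and a division by zero are
  faults: the machine has no successor configuration and is not halted either.
\<close>

datatype instr =
    Const nat int
  | Move nat nat
  | Add nat nat nat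
  | Sub nat nat nat
  | Mul nat nat nat
  | Div nat nat nat
  | Load nat nat
  | Store nat nat
  | Jump nat
  | JumpLess nat nat nat
  | JumpEq nat nat nat
  | Halt

type_synonym program = "instr list"

text \<open>Program counter, registers, memory.\<close>
type_synonym config = "nat \<times> (nat \<Rightarrow> real) \<times> (nat \<Rightarrow> real)"

fun exec :: "instr \<Rightarrow> config \<Rightarrow> config option" where
  "exec (Const r k) (pc, R, M) = Some (pc + 1, R(r := of_int k), M)"
| "exec (Move r a) (pc, R, M) = Some (pc + 1, R(r := R a), M)"
| "exec (Add r a b) (pc, R, M) = Some (pc + 1, R(r := R a + R b), M)"
| "exec (Sub r a b) (pc, R, M) = Some (pc + 1, R(r := R a - R b), M)"
| "exec (Mul r a b) (pc, R, M) = Some (pc + 1, R(r := R a * R b), M)"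
| "exec (Div r a b) (pc, R, M) =
     (if R b \<noteq> 0 then Some (pc + 1, R(r := R a / R b), M) else None)"
| "exec (Load r a) (pc, R, M) =
     (if R a \<in> \<nat> then Some (pc + 1, R(r := M (nat \<lfloor>R a\<rfloor>)), M) else None)"
| "exec (Store a r) (pc, R, M) =
     (if R a \<in> \<nat> then Some (pc + 1, R, M(nat \<lfloor>R a\<rfloor> := R r)) else None)"
| "exec (Jump l) (pc, R, M) = Some (l, R, M)"
| "exec (JumpLess a b l) (pc, R, M) = Some (if R a < R b then l else pc + 1, R, M)"
| "exec (JumpEq a b l) (pc, R, M) = Some (if R a = R b then l else pc + 1, R, M)"
| "exec Halt (pc, R, M) = None"

definition step :: "program \<Rightarrow> (config \<times> config) set" where
  "step P = {(s, s'). fst s < length P \<and> exec (P ! fst s) s = Some s'}"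

definition halted :: "program \<Rightarrow> config \<Rightarrow> bool" where
  "halted P s \<longleftrightarrow> fst s < length P \<and> P ! fst s = Halt"

definition initial_config :: "real list \<Rightarrow> config" where
  "initial_config xs = (0, \<lambda>_. 0, \<lambda>a. if a < length xs then xs ! a else 0)"

definition halts_in :: "program \<Rightarrow> real list \<Rightarrow> nat \<Rightarrow> (nat \<Rightarrow> real) \<Rightarrow> (nat \<Rightarrow> real) \<Rightarrow> bool" where
  "halts_in P xs t R M \<longleftrightarrow>
     (\<exists>pc. (initial_config xs, (pc, R, M)) \<in> step P ^^ t \<and> halted P (pc, R, M))"


section \<open>Input and output conventions\<close>

definition encode_instance ::
  "nat \<Rightarrow> nat \<Rightarrow> (nat \<Rightarrow> nat) \<Rightarrow> (nat \<Rightarrow> nat) \<Rightarrow> (nat \<Rightarrow> real) \<Rightarrow> (nat \<Rightarrow> real) \<Rightarrow> real list" where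
  "encode_instance n h m c p q =
     [real n, real h]
     @ map (\<lambda>l. real (m l)) [1..<Suc h]
     @ map (\<lambda>l. real (c l)) [1..<Suc h]
     @ map p [1..<Suc n]
     @ map q [0..<Suc n]"

text \<open>A pointer to a key is its rank; every external node is a null pointer.\<close>

fun pointer :: "bintree \<Rightarrow> real" where
  "pointer (External j) = 0"
| "pointer (Internal l i r) = real i"

text \<open>
  Output block at address \<open>b\<close>: the root, then the left children, the right children and the
  assigned addresses of \<open>x\<^sub>1, \<dots>, x\<^sub>n\<close>.
\<close>

definition encodes_solution ::
  "nat \<Rightarrow> (nat \<Rightarrow> real) \<Rightarrow> nat \<Rightarrow> bintree \<Rightarrow> (nat \<Rightarrow> nat) \<Rightarrow> bool" where
  "encodes_solution n M b T \<phi> \<longleftrightarrow>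
     M b = pointer T \<and>
     (\<forall>l i r. Internal l i r \<in> subtrees T \<longrightarrow>
        M (b + i) = pointer l \<and> M (b + n + i) = pointer r) \<and>
     (\<forall>i\<in>{1..n}. M (b + 2 * n + i) = real (\<phi> i))"

text \<open>The output block is located by register 0.\<close>

definition outputs_solution ::
  "program \<Rightarrow> real list \<Rightarrow> nat \<Rightarrow> nat \<Rightarrow> bintree \<Rightarrow> (nat \<Rightarrow> nat) \<Rightarrow> bool" where
  "outputs_solution P xs t n T \<phi> \<longleftrightarrow>
     (\<exists>R M b. halts_in P xs t R M \<and> R 0 = real b \<and> encodes_solution n M b T \<phi>)"

end

(*
  Sets S of fast addresses {1..k}, k = n - m_h, are coded as bit masks. For every interval of keys
  and every S the programme computes the cheapest tree on that interval whose nodes use exactly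
  the fast addresses S, all other nodes lying in the slowest level: choose the root, its address,
  and a partition of the remaining addresses of S between the two subtrees. Nothing has to be
  known about where the fast nodes of an optimum tree lie. The choices of (S, L, R, root address)
  are listed once; there are at most 4^k of them, so the tables take O(n^3 4^k) steps. This is
  within the claimed bound because h - 1 <= k gives
  2^k (h - 2)! <= (2 (h - 1))^k <= (k + h)^k.
*)

theory Submission
  imports Defs "HOL-Library.Nat_Bijection"
begin

section \<open>A while language with natural and real variables, compiled to the RAM\<close>

text \<open>The tables start out as zero memory, so 0 has to mean that no tree is known yet. A
  genuine cost may be 0 too, since probabilities and the cheapest access cost may vanish. Every
  stored value therefore carries one extra unit per external node. This surcharge is the same for
  all trees on an interval and adds up over the two subtrees, so it disturbs neither the recursion
  nor the comparison of candidates. The count of choices comes from the four possible fates of a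
  fast address: absent from S, in L, in R, or at the root. All slow addresses cost the same, so the
  tables never tell them apart; they are handed out only at output. Output needs no stack: every key
  is searched from the root along the recorded choices, which is quadratic in total. On bare machine
  code, jump targets and faulting addresses would obscure all this. Hence a small typed language is
  compiled, whose natural-valued expressions supply the memory addresses, and whose constructs carry
  time bounds through the compilation.\<close>

record store =
  nv :: "nat \<Rightarrow> nat"
  rv :: "nat \<Rightarrow> real"
  na :: "nat \<Rightarrow> nat \<Rightarrow> nat"
  ra :: "nat \<Rightarrow> nat \<Rightarrow> real"
  low :: "nat \<Rightarrow> real"

datatype nexp =
    NV nat | NC nat | NAdd nexp nexp | NSub nexp nexp | NMul nexp nexp | NArr nat nexp | NLow nexp

datatype rexp =
    RV nat | RN nexp | RAdd rexp rexp | RMul rexp rexp | RArr nat nexp | RLow nexp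

datatype com =
    Skip
  | NAsg nat nexp
  | RAsg nat rexp
  | NSto nat nexp nexp
  | RSto nat nexp rexp
  | Out nexp nexp
  | Seq com com  (infixr \<open>;;\<close> 60)
  | IfN nexp nexp com com
  | IfR rexp rexp com com
  | WhileNe nexp nexp com

fun nval :: "store \<Rightarrow> nexp \<Rightarrow> nat" where
  "nval s (NV v) = nv s v"
| "nval s (NC k) = k"
| "nval s (NAdd a b) = nval s a + nval s b"
| "nval s (NSub a b) = nval s a - nval s b"
| "nval s (NMul a b) = nval s a * nval s b"
| "nval s (NArr f a) = na s f (nval s a)"
| "nval s (NLow a) = nat \<lfloor>low s (nval s a)\<rfloor>"

fun rval :: "store \<Rightarrow> rexp \<Rightarrow> real" where
  "rval s (RV v) = rv s v"
| "rval s (RN a) = real (nval s a)"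
| "rval s (RAdd a b) = rval s a + rval s b"
| "rval s (RMul a b) = rval s a * rval s b"
| "rval s (RArr f a) = ra s f (nval s a)"
| "rval s (RLow a) = low s (nval s a)"

text \<open>Conditions under which register arithmetic over the reals agrees with
  \<open>nval\<close>: a difference must not truncate, a value read from low memory must really be a
  natural number, and the interleaving provides only eight natural arrays.\<close>

fun nsafe :: "nat \<Rightarrow> store \<Rightarrow> nexp \<Rightarrow> bool" where
  "nsafe Z s (NV v) = True"
| "nsafe Z s (NC k) = True"
| "nsafe Z s (NAdd a b) = (nsafe Z s a \<and> nsafe Z s b)"
| "nsafe Z s (NSub a b) = (nsafe Z s a \<and> nsafe Z s b \<and> nval s b \<le> nval s a)"
| "nsafe Z s (NMul a b) = (nsafe Z s a \<and> nsafe Z s b)"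
| "nsafe Z s (NArr f a) = (f < 8 \<and> nsafe Z s a)"
| "nsafe Z s (NLow a) = (nsafe Z s a \<and> nval s a < Z \<and> low s (nval s a) \<in> \<nat>)"

fun rsafe :: "nat \<Rightarrow> store \<Rightarrow> rexp \<Rightarrow> bool" where
  "rsafe Z s (RV v) = True"
| "rsafe Z s (RN a) = nsafe Z s a"
| "rsafe Z s (RAdd a b) = (rsafe Z s a \<and> rsafe Z s b)"
| "rsafe Z s (RMul a b) = (rsafe Z s a \<and> rsafe Z s b)"
| "rsafe Z s (RArr f a) = (f < 8 \<and> nsafe Z s a)"
| "rsafe Z s (RLow a) = (nsafe Z s a \<and> nval s a < Z)"

text \<open>
  Register 0 stays zero, register 1 holds the base \<open>Z\<close> of the array area, and the other registers
  are split modulo 3 into temporaries, natural variables and real variables. Memory below \<open>Z\<close> is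
  addressed directly; above it the sixteen arrays are interleaved, so that none of them needs a
  size bound.
\<close>

definition tmp :: "nat \<Rightarrow> nat" where "tmp d = 3 * d + 2"
definition nreg :: "nat \<Rightarrow> nat" where "nreg v = 3 * v + 3"
definition rreg :: "nat \<Rightarrow> nat" where "rreg v = 3 * v + 4"

lemma tmp_simps [simp]:
  "tmp d = tmp e \<longleftrightarrow> d = e" "tmp d \<noteq> 0" "tmp d \<noteq> Suc 0" "0 \<noteq> tmp d" "Suc 0 \<noteq> tmp d"
  "tmp d \<noteq> nreg v" "tmp d \<noteq> rreg v" "nreg v \<noteq> tmp d" "rreg v \<noteq> tmp d"
  unfolding tmp_def nreg_def rreg_def by presburger+

lemma nreg_rreg_simps [simp]:
  "nreg v = nreg w \<longleftrightarrow> v = w" "rreg v = rreg w \<longleftrightarrow> v = w"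
  "nreg v \<noteq> rreg w" "rreg v \<noteq> nreg w" "nreg v \<noteq> 0" "0 \<noteq> nreg v" "rreg v \<noteq> 0" "0 \<noteq> rreg v"
  "nreg v \<noteq> Suc 0" "Suc 0 \<noteq> nreg v" "rreg v \<noteq> Suc 0" "Suc 0 \<noteq> rreg v"
  unfolding nreg_def rreg_def by presburger+

definition store_rel :: "nat \<Rightarrow> store \<Rightarrow> (nat \<Rightarrow> real) \<times> (nat \<Rightarrow> real) \<Rightarrow> bool" where
  "store_rel Z s \<mu> \<longleftrightarrow> (case \<mu> of (R, M) \<Rightarrow>
     R 0 = 0 \<and> R 1 = real Z \<and>
     (\<forall>v. R (nreg v) = real (nv s v)) \<and> (\<forall>v. R (rreg v) = rv s v) \<and>
     (\<forall>f<8. \<forall>x. M (Z + 16 * x + 2 * f) = real (na s f x)) \<and>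
     (\<forall>f<8. \<forall>x. M (Z + 16 * x + (2 * f + 1)) = ra s f x) \<and>
     (\<forall>x<Z. M x = low s x))"

text \<open>Turns an index \<open>x\<close> in \<open>tmp d\<close> into
  \<open>Z + 16 * x + g\<close>. The base \<open>Z\<close> depends on the instance and cannot be a
  program constant, so it is taken from register 1.\<close>

definition array_address :: "nat \<Rightarrow> nat \<Rightarrow> instr list" where
  "array_address d g =
     [Const (tmp (d + 1)) 16, Mul (tmp d) (tmp d) (tmp (d + 1)),
      Const (tmp (d + 1)) (int g), Add (tmp d) (tmp d) (tmp (d + 1)), Add (tmp d) (tmp d) 1]"

text \<open>\<open>d\<close> is the evaluation depth: the result is left in \<open>tmp d\<close> and
  only temporaries from \<open>d\<close> on are touched, so a left operand survives the evaluation
  of the right one.\<close>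

fun ncode :: "nat \<Rightarrow> nexp \<Rightarrow> instr list" where
  "ncode d (NV v) = [Move (tmp d) (nreg v)]"
| "ncode d (NC k) = [Const (tmp d) (int k)]"
| "ncode d (NAdd a b) = ncode d a @ ncode (d + 1) b @ [Add (tmp d) (tmp d) (tmp (d + 1))]"
| "ncode d (NSub a b) = ncode d a @ ncode (d + 1) b @ [Sub (tmp d) (tmp d) (tmp (d + 1))]"
| "ncode d (NMul a b) = ncode d a @ ncode (d + 1) b @ [Mul (tmp d) (tmp d) (tmp (d + 1))]"
| "ncode d (NArr f a) = ncode d a @ array_address d (2 * f) @ [Load (tmp d) (tmp d)]"
| "ncode d (NLow a) = ncode d a @ [Load (tmp d) (tmp d)]"

fun rcode :: "nat \<Rightarrow> rexp \<Rightarrow> instr list" where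
  "rcode d (RV v) = [Move (tmp d) (rreg v)]"
| "rcode d (RN a) = ncode d a"
| "rcode d (RAdd a b) = rcode d a @ rcode (d + 1) b @ [Add (tmp d) (tmp d) (tmp (d + 1))]"
| "rcode d (RMul a b) = rcode d a @ rcode (d + 1) b @ [Mul (tmp d) (tmp d) (tmp (d + 1))]"
| "rcode d (RArr f a) = ncode d a @ array_address d (2 * f + 1) @ [Load (tmp d) (tmp d)]"
| "rcode d (RLow a) = ncode d a @ [Load (tmp d) (tmp d)]"

text \<open>Jump targets are absolute, hence the start address \<open>l\<close> as a parameter. In a
  conditional the code for a failed test comes first, and a successful test jumps over it.\<close>

fun comp :: "nat \<Rightarrow> com \<Rightarrow> instr list" where
  "comp l Skip = []"
| "comp l (NAsg v e) = ncode 0 e @ [Move (nreg v) (tmp 0)]"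
| "comp l (RAsg v e) = rcode 0 e @ [Move (rreg v) (tmp 0)]"
| "comp l (NSto f a e) =
     ncode 0 a @ array_address 0 (2 * f) @ ncode 1 e @ [Store (tmp 0) (tmp 1)]"
| "comp l (RSto f a e) =
     ncode 0 a @ array_address 0 (2 * f + 1) @ rcode 1 e @ [Store (tmp 0) (tmp 1)]"
| "comp l (Out a e) = ncode 0 a @ ncode 1 e @ [Store (tmp 0) (tmp 1)]"
| "comp l (c1 ;; c2) = comp l c1 @ comp (l + length (comp l c1)) c2"
| "comp l (IfN a b c1 c2) =
     (let B = ncode 0 a @ ncode 1 b; C2 = comp (l + length B + 1) c2;
          l1 = l + length B + length C2 + 2; C1 = comp l1 c1
      in B @ JumpLess (tmp 0) (tmp 1) l1 # C2 @ Jump (l1 + length C1) # C1)"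
| "comp l (IfR a b c1 c2) =
     (let B = rcode 0 a @ rcode 1 b; C2 = comp (l + length B + 1) c2;
          l1 = l + length B + length C2 + 2; C1 = comp l1 c1
      in B @ JumpLess (tmp 0) (tmp 1) l1 # C2 @ Jump (l1 + length C1) # C1)"
| "comp l (WhileNe a b c) =
     (let B = ncode 0 a @ ncode 1 b; C = comp (l + length B + 1) c
      in B @ JumpEq (tmp 0) (tmp 1) (l + length B + length C + 2) # C @ [Jump l])"


subsection \<open>Straight-line code\<close>

text \<open>The program counter is fixed at 0 because it has no influence on what a
  \<open>straight\<close> instruction does to registers and memory.\<close>

fun run :: "instr list \<Rightarrow> (nat \<Rightarrow> real) \<times> (nat \<Rightarrow> real) \<Rightarrow> ((nat \<Rightarrow> real) \<times> (nat \<Rightarrow> real)) option" where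
  "run [] \<mu> = Some \<mu>"
| "run (i # is) \<mu> = (case exec i (0, \<mu>) of None \<Rightarrow> None | Some s \<Rightarrow> run is (snd s))"

lemma run_append: "run (xs @ ys) \<mu> = (case run xs \<mu> of None \<Rightarrow> None | Some \<mu>' \<Rightarrow> run ys \<mu>')"
  by (induction xs arbitrary: \<mu>) (auto split: option.splits)

definition code_at :: "program \<Rightarrow> nat \<Rightarrow> instr list \<Rightarrow> bool" where
  "code_at P l C \<longleftrightarrow> (\<exists>A B. P = A @ C @ B \<and> length A = l)"

lemma code_at_iff: "code_at P l C \<longleftrightarrow> l + length C \<le> length P \<and> take (length C) (drop l P) = C"
proof
  assume *: "l + length C \<le> length P \<and> take (length C) (drop l P) = C"
  have "P = take l P @ take (length C) (drop l P) @ drop (length C) (drop l P)"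
    by (simp only: append_take_drop_id)
  moreover have "length (take l P) = l"
    using * by simp
  ultimately show "code_at P l C"
    using * unfolding code_at_def by metis
qed (auto simp: code_at_def)

lemma code_at_append:
  "code_at P l (C @ D) \<longleftrightarrow> code_at P l C \<and> code_at P (l + length C) D"
proof (cases "l + length C + length D \<le> length P")
  case True
  then have "length (take (length C) (drop l P)) = length C" by simp
  then have "take (length C) (drop l P) @ take (length D) (drop (l + length C) P) = C @ D \<longleftrightarrow>
    take (length C) (drop l P) = C \<and> take (length D) (drop (l + length C) P) = D"
    by (rule append_eq_append_conv[OF disjI1])
  then show ?thesis
    using True unfolding code_at_iff by (simp add: take_add add_ac)
qed (auto simp: code_at_iff)

lemma code_at_Cons:
  "code_at P l (i # C) \<longleftrightarrow> l < length P \<and> P ! l = i \<and> code_at P (l + 1) C"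
proof -
  have "code_at P l [i] \<longleftrightarrow> l < length P \<and> P ! l = i"
    unfolding code_at_iff by (cases "drop l P") (auto simp: nth_via_drop drop_eq_Nil2)
  then show ?thesis
    using code_at_append[of P l "[i]" C] by simp
qed

fun straight :: "instr \<Rightarrow> bool" where
  "straight (Jump l) = False"
| "straight (JumpLess a b l) = False"
| "straight (JumpEq a b l) = False"
| "straight Halt = False"
| "straight _ = True"

lemma exec_straight:
  assumes "straight i" "exec i (0, \<mu>) = Some s"
  shows "exec i (pc, \<mu>) = Some (pc + 1, snd s)"
proof (cases \<mu>)
  case (Pair R M)
  then show ?thesis
    using assms by (cases i) (auto split: if_splits)
qed

lemma step_comp:
  assumes "(a, b) \<in> step P ^^ t" "(b, c) \<in> step P ^^ u"
  shows "(a, c) \<in> step P ^^ (t + u)"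
  using assms by (auto simp: relpow_add)

lemma step_one: "pc < length P \<Longrightarrow> exec (P ! pc) (pc, \<mu>) = Some s \<Longrightarrow> ((pc, \<mu>), s) \<in> step P ^^ 1"
  by (simp add: step_def)

lemma run_steps:
  assumes "run C \<mu> = Some \<mu>'" "code_at P l C" "list_all straight C"
  shows "((l, \<mu>), (l + length C, \<mu>')) \<in> step P ^^ length C"
  using assms
proof (induction C arbitrary: l \<mu>)
  case (Cons i C)
  then obtain s where s: "exec i (0, \<mu>) = Some s" "run C (snd s) = Some \<mu>'"
    by (auto split: option.splits)
  have "((l, \<mu>), (l + 1, snd s)) \<in> step P ^^ 1"
    using Cons.prems exec_straight[OF _ s(1), of l] by (intro step_one) (auto simp: code_at_Cons)
  moreover have "((l + 1, snd s), (l + 1 + length C, \<mu>')) \<in> step P ^^ length C"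
    using Cons.prems s by (intro Cons.IH) (auto simp: code_at_Cons)
  ultimately show ?case
    using step_comp by fastforce
qed auto

lemma straight_ncode: "list_all straight (ncode d e)"
  by (induction e arbitrary: d) (auto simp: array_address_def)

lemma straight_rcode: "list_all straight (rcode d e)"
  by (induction e arbitrary: d) (auto simp: array_address_def straight_ncode)

fun nsize :: "nexp \<Rightarrow> nat" where
  "nsize (NV v) = 1"
| "nsize (NC k) = 1"
| "nsize (NAdd a b) = nsize a + nsize b + 1"
| "nsize (NSub a b) = nsize a + nsize b + 1"
| "nsize (NMul a b) = nsize a + nsize b + 1"
| "nsize (NArr f a) = nsize a + 6"
| "nsize (NLow a) = nsize a + 1"

fun rsize :: "rexp \<Rightarrow> nat" where
  "rsize (RV v) = 1"
| "rsize (RN a) = nsize a"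
| "rsize (RAdd a b) = rsize a + rsize b + 1"
| "rsize (RMul a b) = rsize a + rsize b + 1"
| "rsize (RArr f a) = nsize a + 6"
| "rsize (RLow a) = nsize a + 1"

lemma length_array_address [simp]: "length (array_address d g) = 5"
  by (simp add: array_address_def)

lemma length_ncode [simp]: "length (ncode d e) = nsize e"
  by (induction e arbitrary: d) auto

lemma length_rcode [simp]: "length (rcode d e) = rsize e"
  by (induction e arbitrary: d) auto

text \<open>What an evaluation at depth \<open>d\<close> must leave alone: the two fixed registers,
  all variables, and the temporaries of smaller depth.\<close>

definition same_below :: "nat \<Rightarrow> (nat \<Rightarrow> real) \<Rightarrow> (nat \<Rightarrow> real) \<Rightarrow> bool" where
  "same_below d R R' \<longleftrightarrow> (\<forall>r. (\<forall>e\<ge>d. r \<noteq> tmp e) \<longrightarrow> R' r = R r)"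

lemma same_below_refl: "same_below d R R"
  by (simp add: same_below_def)

lemma same_below_trans:
  "same_below d R R' \<Longrightarrow> same_below e R' R'' \<Longrightarrow> d \<le> e \<Longrightarrow> same_below d R R''"
  by (auto simp: same_below_def)

lemma same_below_upd: "same_below d R R' \<Longrightarrow> d \<le> e \<Longrightarrow> same_below d R (R'(tmp e := x))"
  by (auto simp: same_below_def)

lemma same_below_tmp: "same_below d R R' \<Longrightarrow> e < d \<Longrightarrow> R' (tmp e) = R (tmp e)"
  by (auto simp: same_below_def)

lemma same_below_rel: "same_below d R R' \<Longrightarrow> store_rel Z s (R, M) \<Longrightarrow> store_rel Z s (R', M)"
proof -
  assume "same_below d R R'"
  then have "R' 0 = R 0" "R' 1 = R 1" "R' (nreg v) = R (nreg v)" "R' (rreg v) = R (rreg v)" for v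
    by (auto simp: same_below_def)
  then show "store_rel Z s (R, M) \<Longrightarrow> store_rel Z s (R', M)"
    by (simp add: store_rel_def)
qed

lemma run_array_address:
  assumes "store_rel Z s (R, M)" "R (tmp d) = real x"
  shows "\<exists>R'. run (array_address d g) (R, M) = Some (R', M) \<and>
    R' (tmp d) = real (Z + 16 * x + g) \<and> same_below d R R'"
proof -
  have "R 1 = real Z"
    using assms by (simp add: store_rel_def)
  then show ?thesis
    using assms(2) unfolding array_address_def
    by (simp add: same_below_def)
qed

text \<open>The second operand is evaluated one level deeper, so the first value is still in
  \<open>tmp d\<close> when the operation is performed.\<close>

lemma run_binary:
  assumes "run C (R, M) = Some (R1, M)" "R1 (tmp d) = x" "same_below d R R1"
    and "run C' (R1, M) = Some (R2, M)" "R2 (tmp (d + 1)) = y" "same_below (d + 1) R1 R2"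
    and op: "exec i (0, R2, M) = Some (1, R2(tmp d := f (R2 (tmp d)) (R2 (tmp (d + 1)))), M)"
  shows "\<exists>R'. run (C @ C' @ [i]) (R, M) = Some (R', M) \<and> R' (tmp d) = f x y \<and> same_below d R R'"
proof -
  have "R2 (tmp d) = x" using same_below_tmp[OF assms(6)] assms(2) by simp
  moreover have "same_below d R R2" using same_below_trans[OF assms(3,6)] by simp
  ultimately show ?thesis
    using assms(1,4,5) op by (auto simp: run_append intro!: same_below_upd)
qed

lemma ncode_correct:
  assumes "nsafe Z s e" "store_rel Z s (R, M)"
  shows "\<exists>R'. run (ncode d e) (R, M) = Some (R', M) \<and>
    R' (tmp d) = real (nval s e) \<and> same_below d R R'"
  using assms
proof (induction e arbitrary: d R)
  case (NV v)
  then show ?case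
    by (auto simp: store_rel_def intro: same_below_upd[OF same_below_refl])
next
  case (NC k)
  then show ?case
    by (auto intro: same_below_upd[OF same_below_refl])
next
  case (NAdd a b)
  from NAdd obtain R1 where 1: "run (ncode d a) (R, M) = Some (R1, M)"
    "R1 (tmp d) = real (nval s a)" "same_below d R R1" by fastforce
  obtain R2 where 2: "run (ncode (d+1) b) (R1, M) = Some (R2, M)"
    "R2 (tmp (d+1)) = real (nval s b)" "same_below (d+1) R1 R2"
    using NAdd.IH(2)[of R1 "d+1"] NAdd.prems same_below_rel[OF 1(3)] by auto
  show ?case
    using run_binary[OF 1 2, of "Add (tmp d) (tmp d) (tmp (d + 1))" plus] by simp
next
  case (NSub a b)
  from NSub obtain R1 where 1: "run (ncode d a) (R, M) = Some (R1, M)"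
    "R1 (tmp d) = real (nval s a)" "same_below d R R1" by fastforce
  obtain R2 where 2: "run (ncode (d+1) b) (R1, M) = Some (R2, M)"
    "R2 (tmp (d+1)) = real (nval s b)" "same_below (d+1) R1 R2"
    using NSub.IH(2)[of R1 "d+1"] NSub.prems same_below_rel[OF 1(3)] by auto
  \<comment> \<open>Safety excludes truncation, so the real difference is the image of the natural
    one.\<close>
  show ?case
    using run_binary[OF 1 2, of "Sub (tmp d) (tmp d) (tmp (d + 1))" minus] NSub.prems(1)
    by (simp add: of_nat_diff)
next
  case (NMul a b)
  from NMul obtain R1 where 1: "run (ncode d a) (R, M) = Some (R1, M)"
    "R1 (tmp d) = real (nval s a)" "same_below d R R1" by fastforce
  obtain R2 where 2: "run (ncode (d+1) b) (R1, M) = Some (R2, M)"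
    "R2 (tmp (d+1)) = real (nval s b)" "same_below (d+1) R1 R2"
    using NMul.IH(2)[of R1 "d+1"] NMul.prems same_below_rel[OF 1(3)] by auto
  show ?case
    using run_binary[OF 1 2, of "Mul (tmp d) (tmp d) (tmp (d + 1))" times] by simp
next
  case (NArr f a)
  from NArr obtain R1 where 1: "run (ncode d a) (R, M) = Some (R1, M)"
    "R1 (tmp d) = real (nval s a)" "same_below d R R1" by fastforce
  moreover obtain R2 where 2: "run (array_address d (2 * f)) (R1, M) = Some (R2, M)"
    "R2 (tmp d) = real (Z + 16 * nval s a + 2 * f)" "same_below d R1 R2"
    using run_array_address[OF same_below_rel[OF 1(3) NArr.prems(2)] 1(2)] by blast
  moreover have "M (Z + 16 * nval s a + 2 * f) = real (na s f (nval s a))"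
    using NArr.prems by (auto simp: store_rel_def)
  moreover have "same_below d R R2"
    using same_below_trans[OF 1(3) 2(3)] by simp
  ultimately show ?case
    by (auto simp: run_append simp del: of_nat_add of_nat_mult intro!: same_below_upd)
next
  case (NLow a)
  from NLow obtain R1 where 1: "run (ncode d a) (R, M) = Some (R1, M)"
    "R1 (tmp d) = real (nval s a)" "same_below d R R1" by fastforce
  moreover have "M (nval s a) = real (nat \<lfloor>low s (nval s a)\<rfloor>)"
    using NLow.prems by (auto simp: store_rel_def elim!: Nats_cases)
  ultimately show ?case
    by (auto simp: run_append intro!: same_below_upd)
qed

lemma rcode_correct:
  assumes "rsafe Z s e" "store_rel Z s (R, M)"
  shows "\<exists>R'. run (rcode d e) (R, M) = Some (R', M) \<and>
    R' (tmp d) = rval s e \<and> same_below d R R'"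
  using assms
proof (induction e arbitrary: d R)
  case (RV v)
  then show ?case
    by (auto simp: store_rel_def intro: same_below_upd[OF same_below_refl])
next
  case (RN e)
  then show ?case
    using ncode_correct by simp
next
  case (RAdd a b)
  from RAdd obtain R1 where 1: "run (rcode d a) (R, M) = Some (R1, M)"
    "R1 (tmp d) = rval s a" "same_below d R R1" by fastforce
  obtain R2 where 2: "run (rcode (d+1) b) (R1, M) = Some (R2, M)"
    "R2 (tmp (d+1)) = rval s b" "same_below (d+1) R1 R2"
    using RAdd.IH(2)[of R1 "d+1"] RAdd.prems same_below_rel[OF 1(3)] by auto
  show ?case
    using run_binary[OF 1 2, of "Add (tmp d) (tmp d) (tmp (d + 1))" plus] by simp
next
  case (RMul a b)
  from RMul obtain R1 where 1: "run (rcode d a) (R, M) = Some (R1, M)"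
    "R1 (tmp d) = rval s a" "same_below d R R1" by fastforce
  obtain R2 where 2: "run (rcode (d+1) b) (R1, M) = Some (R2, M)"
    "R2 (tmp (d+1)) = rval s b" "same_below (d+1) R1 R2"
    using RMul.IH(2)[of R1 "d+1"] RMul.prems same_below_rel[OF 1(3)] by auto
  show ?case
    using run_binary[OF 1 2, of "Mul (tmp d) (tmp d) (tmp (d + 1))" times] by simp
next
  case (RArr f a)
  obtain R1 where 1: "run (ncode d a) (R, M) = Some (R1, M)"
    "R1 (tmp d) = real (nval s a)" "same_below d R R1"
    using ncode_correct[of Z s a R M d] RArr by auto
  moreover obtain R2 where 2: "run (array_address d (2 * f + 1)) (R1, M) = Some (R2, M)"
    "R2 (tmp d) = real (Z + 16 * nval s a + (2 * f + 1))" "same_below d R1 R2"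
    using run_array_address[OF same_below_rel[OF 1(3) RArr.prems(2)] 1(2)] by blast
  moreover have "M (Z + 16 * nval s a + (2 * f + 1)) = ra s f (nval s a)"
    using RArr.prems unfolding store_rel_def by auto
  moreover have "same_below d R R2"
    using same_below_trans[OF 1(3) 2(3)] by simp
  ultimately show ?case
    by (auto simp: run_append simp del: of_nat_add of_nat_mult of_nat_Suc add_Suc_right intro!: same_below_upd)
next
  case (RLow a)
  obtain R1 where 1: "run (ncode d a) (R, M) = Some (R1, M)"
    "R1 (tmp d) = real (nval s a)" "same_below d R R1"
    using ncode_correct[of Z s a R M d] RLow by auto
  moreover have "M (nval s a) = low s (nval s a)"
    using RLow.prems by (auto simp: store_rel_def)
  ultimately show ?case
    by (auto simp: run_append intro!: same_below_upd)
qed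


subsection \<open>Total correctness with running time\<close>

text \<open>Total correctness with a time bound, for every program that contains the code at any
  address and every machine state that represents \<open>s\<close>; this generality is what lets
  pieces of code be composed.\<close>

definition runs :: "nat \<Rightarrow> com \<Rightarrow> store \<Rightarrow> nat \<Rightarrow> (store \<Rightarrow> bool) \<Rightarrow> bool" where
  "runs Z c s T Q \<longleftrightarrow>
     (\<forall>P l \<mu>. code_at P l (comp l c) \<longrightarrow> store_rel Z s \<mu> \<longrightarrow>
       (\<exists>t \<mu>' s'. t \<le> T \<and> ((l, \<mu>), (l + length (comp l c), \<mu>')) \<in> step P ^^ t \<and>
          store_rel Z s' \<mu>' \<and> Q s'))"

lemma runs_conseq:
  assumes "runs Z c s T Q" "T \<le> T'" "\<And>s'. Q s' \<Longrightarrow> Q' s'"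
  shows "runs Z c s T' Q'"
  unfolding runs_def
proof (intro allI impI)
  fix P l \<mu> assume "code_at P l (comp l c)" "store_rel Z s \<mu>"
  then obtain t \<mu>' s' where "t \<le> T" "((l, \<mu>), (l + length (comp l c), \<mu>')) \<in> step P ^^ t"
    "store_rel Z s' \<mu>'" "Q s'"
    using assms(1) unfolding runs_def by blast
  then show "\<exists>t \<mu>' s'. t \<le> T' \<and> ((l, \<mu>), (l + length (comp l c), \<mu>')) \<in> step P ^^ t \<and>
          store_rel Z s' \<mu>' \<and> Q' s'"
    using assms(2,3) le_trans by blast
qed

text \<open>The second command is specified inside the postcondition of the first, so no
  intermediate assertion has to be named.\<close>

lemma runs_Seq:
  assumes "runs Z c1 s T1 (\<lambda>s'. runs Z c2 s' T2 Q)"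
  shows "runs Z (c1 ;; c2) s (T1 + T2) Q"
  unfolding runs_def
proof (intro allI impI)
  fix P l \<mu> assume c: "code_at P l (comp l (c1 ;; c2))" and r: "store_rel Z s \<mu>"
  let ?l = "l + length (comp l c1)"
  have c: "code_at P l (comp l c1)" "code_at P ?l (comp ?l c2)"
    using c by (auto simp: code_at_append)
  obtain t \<mu>' s' where 1: "t \<le> T1" "((l, \<mu>), (?l, \<mu>')) \<in> step P ^^ t"
    "store_rel Z s' \<mu>'" "runs Z c2 s' T2 Q"
    using assms c(1) r unfolding runs_def[of _ c1] by blast
  then obtain t' \<mu>'' s'' where 2: "t' \<le> T2" "((?l, \<mu>'), (?l + length (comp ?l c2), \<mu>'')) \<in> step P ^^ t'"
    "store_rel Z s'' \<mu>''" "Q s''"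
    using c(2) unfolding runs_def by blast
  show "\<exists>t \<mu>' s'. t \<le> T1 + T2 \<and> ((l, \<mu>), (l + length (comp l (c1 ;; c2)), \<mu>')) \<in> step P ^^ t \<and>
          store_rel Z s' \<mu>' \<and> Q s'"
    using 1 2 step_comp[OF 1(2) 2(2)]
    by (intro exI[of _ "t + t'"] exI[of _ \<mu>''] exI[of _ s'']) (auto simp: add.assoc)
qed

lemma runs_straight:
  assumes "\<And>l. comp l c = C" "list_all straight C"
    and "\<And>R M. store_rel Z s (R, M) \<Longrightarrow> \<exists>\<mu>'. run C (R, M) = Some \<mu>' \<and> store_rel Z s' \<mu>'"
    and "Q s'"
  shows "runs Z c s (length C) Q"
  unfolding runs_def assms(1)
proof (intro allI impI)
  fix P l \<mu> assume c: "code_at P l C" and r: "store_rel Z s \<mu>"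
  obtain R M where \<mu>: "\<mu> = (R, M)" by force
  with assms(3) r obtain \<mu>' where \<mu>': "run C \<mu> = Some \<mu>'" "store_rel Z s' \<mu>'" by blast
  from run_steps[OF \<mu>'(1) c assms(2)] \<mu>'(2) assms(4)
  show "\<exists>t \<mu>' s'. t \<le> length C \<and> ((l, \<mu>), (l + length C, \<mu>')) \<in> step P ^^ t \<and>
      store_rel Z s' \<mu>' \<and> Q s'" by blast
qed

lemma runs_NAsg:
  assumes "nsafe Z s e" "Q (s\<lparr>nv := (nv s)(v := nval s e)\<rparr>)"
  shows "runs Z (NAsg v e) s (nsize e + 1) Q"
proof -
  have "runs Z (NAsg v e) s (length (ncode 0 e @ [Move (nreg v) (tmp 0)])) Q"
  proof (rule runs_straight[where Q = Q, OF _ _ _ assms(2)])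
    fix R M assume r: "store_rel Z s (R, M)"
    obtain R' where R': "run (ncode 0 e) (R, M) = Some (R', M)" "R' (tmp 0) = real (nval s e)"
      "store_rel Z s (R', M)"
      using ncode_correct[OF assms(1) r] same_below_rel[OF _ r] by blast
    then show "\<exists>\<mu>'. run (ncode 0 e @ [Move (nreg v) (tmp 0)]) (R, M) = Some \<mu>' \<and>
        store_rel Z (s\<lparr>nv := (nv s)(v := nval s e)\<rparr>) \<mu>'"
      by (auto simp: run_append store_rel_def)
  qed (simp_all add: straight_ncode)
  then show ?thesis by simp
qed

lemma runs_RAsg:
  assumes "rsafe Z s e" "Q (s\<lparr>rv := (rv s)(v := rval s e)\<rparr>)"
  shows "runs Z (RAsg v e) s (rsize e + 1) Q"
proof -
  have "runs Z (RAsg v e) s (length (rcode 0 e @ [Move (rreg v) (tmp 0)])) Q"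
  proof (rule runs_straight[where Q = Q, OF _ _ _ assms(2)])
    fix R M assume r: "store_rel Z s (R, M)"
    obtain R' where R': "run (rcode 0 e) (R, M) = Some (R', M)" "R' (tmp 0) = rval s e"
      "store_rel Z s (R', M)"
      using rcode_correct[OF assms(1) r] same_below_rel[OF _ r] by blast
    then show "\<exists>\<mu>'. run (rcode 0 e @ [Move (rreg v) (tmp 0)]) (R, M) = Some \<mu>' \<and>
        store_rel Z (s\<lparr>rv := (rv s)(v := rval s e)\<rparr>) \<mu>'"
      by (auto simp: run_append store_rel_def)
  qed (simp_all add: straight_rcode)
  then show ?thesis by simp
qed

lemma array_address_inject:
  fixes Z :: nat
  assumes "Z + 16 * x + a = Z + 16 * y + b" "a < 16" "b < 16"
  shows "x = y \<and> a = b"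
proof -
  have "(16 * x + a) div 16 = (16 * y + b) div 16" "(16 * x + a) mod 16 = (16 * y + b) mod 16"
    using assms(1) by simp_all
  then show ?thesis
    using assms(2,3) by simp
qed

text \<open>The offset from \<open>Z\<close> identifies an array cell: its remainder modulo 16 gives
  the array, even for natural and odd for real ones, and its quotient the index. Low memory lies
  below \<open>Z\<close>.\<close>

lemma store_rel_na_upd:
  assumes "store_rel Z s (R, M)" "f < 8"
  shows "store_rel Z (s\<lparr>na := (na s)(f := (na s f)(x := k))\<rparr>) (R, M(Z + 16 * x + 2 * f := real k))"
proof -
  have *: "Z + 16 * y + 2 * g = Z + 16 * x + 2 * f \<longleftrightarrow> y = x \<and> g = f"
    "Z + 16 * y + (2 * g + 1) \<noteq> Z + 16 * x + 2 * f" if "g < 8" for y g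
    using array_address_inject[of Z y "2 * g" x "2 * f"] array_address_inject[of Z y "2 * g + 1" x "2 * f"]
      that assms(2) by (auto simp: double_not_eq_Suc_double Suc_double_not_eq_double)
  show ?thesis
    using assms unfolding store_rel_def by (auto simp: * simp del: One_nat_def add_Suc_right)
qed

lemma store_rel_ra_upd:
  assumes "store_rel Z s (R, M)" "f < 8"
  shows "store_rel Z (s\<lparr>ra := (ra s)(f := (ra s f)(x := k))\<rparr>) (R, M(Z + 16 * x + (2 * f + 1) := k))"
proof -
  have *: "Z + 16 * y + (2 * g + 1) = Z + 16 * x + (2 * f + 1) \<longleftrightarrow> y = x \<and> g = f"
    "Z + 16 * y + 2 * g \<noteq> Z + 16 * x + (2 * f + 1)" if "g < 8" for y g
    using array_address_inject[of Z y "2 * g + 1" x "2 * f + 1"]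
      array_address_inject[of Z y "2 * g" x "2 * f + 1"]
      that assms(2) by (auto simp: double_not_eq_Suc_double Suc_double_not_eq_double)
  show ?thesis
    using assms unfolding store_rel_def by (auto simp: * simp del: One_nat_def add_Suc_right)
qed

lemma store_rel_low_upd:
  assumes "store_rel Z s (R, M)" "x < Z"
  shows "store_rel Z (s\<lparr>low := (low s)(x := k)\<rparr>) (R, M(x := k))"
  using assms unfolding store_rel_def by auto

lemma runs_NSto:
  assumes "nsafe Z s a" "nsafe Z s e" "f < 8"
    "Q (s\<lparr>na := (na s)(f := (na s f)(nval s a := nval s e))\<rparr>)"
  shows "runs Z (NSto f a e) s (nsize a + nsize e + 6) Q"
proof -
  let ?C = "ncode 0 a @ array_address 0 (2 * f) @ ncode 1 e @ [Store (tmp 0) (tmp 1)]"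
  have "runs Z (NSto f a e) s (length ?C) Q"
  proof (rule runs_straight[where Q = Q, OF _ _ _ assms(4)])
    let ?a = "Z + 16 * nval s a + 2 * f"
    fix R M assume r: "store_rel Z s (R, M)"
    obtain R1 where R1: "run (ncode 0 a) (R, M) = Some (R1, M)" "R1 (tmp 0) = real (nval s a)"
      "store_rel Z s (R1, M)"
      using ncode_correct[OF assms(1) r] same_below_rel[OF _ r] by blast
    obtain R2 where R2: "run (array_address 0 (2 * f)) (R1, M) = Some (R2, M)"
      "R2 (tmp 0) = real ?a" "store_rel Z s (R2, M)"
      using run_array_address[OF R1(3,2)] same_below_rel R1(3) by blast
    obtain R3 where R3: "run (ncode 1 e) (R2, M) = Some (R3, M)" "R3 (tmp 1) = real (nval s e)"
      "same_below 1 R2 R3"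
      using ncode_correct[OF assms(2) R2(3)] by blast
    have "R3 (tmp 0) = real ?a"
      using same_below_tmp[OF R3(3)] R2(2) by simp
    then have "run ?C (R, M) = Some (R3, M(?a := real (nval s e)))"
      using R1 R2 R3 by (simp add: run_append del: of_nat_add of_nat_mult of_nat_Suc One_nat_def add_Suc_right)
    with store_rel_na_upd[OF same_below_rel[OF R3(3) R2(3)] assms(3)]
    show "\<exists>\<mu>'. run ?C (R, M) = Some \<mu>' \<and>
        store_rel Z (s\<lparr>na := (na s)(f := (na s f)(nval s a := nval s e))\<rparr>) \<mu>'" by blast
  qed (simp_all add: straight_ncode straight_rcode array_address_def)
  then show ?thesis by (simp add: add_ac)
qed

lemma runs_RSto:
  assumes "nsafe Z s a" "rsafe Z s e" "f < 8"
    "Q (s\<lparr>ra := (ra s)(f := (ra s f)(nval s a := rval s e))\<rparr>)"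
  shows "runs Z (RSto f a e) s (nsize a + rsize e + 6) Q"
proof -
  let ?C = "ncode 0 a @ array_address 0 (2 * f + 1) @ rcode 1 e @ [Store (tmp 0) (tmp 1)]"
  have "runs Z (RSto f a e) s (length ?C) Q"
  proof (rule runs_straight[where Q = Q, OF _ _ _ assms(4)])
    let ?a = "Z + 16 * nval s a + (2 * f + 1)"
    fix R M assume r: "store_rel Z s (R, M)"
    obtain R1 where R1: "run (ncode 0 a) (R, M) = Some (R1, M)" "R1 (tmp 0) = real (nval s a)"
      "store_rel Z s (R1, M)"
      using ncode_correct[OF assms(1) r] same_below_rel[OF _ r] by blast
    obtain R2 where R2: "run (array_address 0 (2 * f + 1)) (R1, M) = Some (R2, M)"
      "R2 (tmp 0) = real ?a" "store_rel Z s (R2, M)"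
      using run_array_address[OF R1(3,2)] same_below_rel R1(3) by blast
    obtain R3 where R3: "run (rcode 1 e) (R2, M) = Some (R3, M)" "R3 (tmp 1) = rval s e"
      "same_below 1 R2 R3"
      using rcode_correct[OF assms(2) R2(3)] by blast
    have "R3 (tmp 0) = real ?a"
      using same_below_tmp[OF R3(3)] R2(2) by simp
    then have "run ?C (R, M) = Some (R3, M(?a := rval s e))"
      using R1 R2 R3 by (simp add: run_append del: of_nat_add of_nat_mult of_nat_Suc One_nat_def add_Suc_right)
    with store_rel_ra_upd[OF same_below_rel[OF R3(3) R2(3)] assms(3)]
    show "\<exists>\<mu>'. run ?C (R, M) = Some \<mu>' \<and>
        store_rel Z (s\<lparr>ra := (ra s)(f := (ra s f)(nval s a := rval s e))\<rparr>) \<mu>'" by blast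
  qed (simp_all add: straight_ncode straight_rcode array_address_def)
  then show ?thesis by (simp add: add_ac)
qed

lemma runs_Out:
  assumes "nsafe Z s a" "nsafe Z s e" "nval s a < Z"
    "Q (s\<lparr>low := (low s)(nval s a := real (nval s e))\<rparr>)"
  shows "runs Z (Out a e) s (nsize a + nsize e + 1) Q"
proof -
  let ?C = "ncode 0 a @ ncode 1 e @ [Store (tmp 0) (tmp 1)]"
  have "runs Z (Out a e) s (length ?C) Q"
  proof (rule runs_straight[where Q = Q, OF _ _ _ assms(4)])
    fix R M assume r: "store_rel Z s (R, M)"
    obtain R1 where R1: "run (ncode 0 a) (R, M) = Some (R1, M)" "R1 (tmp 0) = real (nval s a)"
      "store_rel Z s (R1, M)"
      using ncode_correct[OF assms(1) r] same_below_rel[OF _ r] by blast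
    obtain R3 where R3: "run (ncode 1 e) (R1, M) = Some (R3, M)" "R3 (tmp 1) = real (nval s e)"
      "same_below 1 R1 R3"
      using ncode_correct[OF assms(2) R1(3)] by blast
    have "R3 (tmp 0) = real (nval s a)"
      using same_below_tmp[OF R3(3)] R1(2) by simp
    then have "run ?C (R, M) = Some (R3, M(nval s a := real (nval s e)))"
      using R1 R3 by (simp add: run_append)
    with store_rel_low_upd[OF same_below_rel[OF R3(3) R1(3)] assms(3)]
    show "\<exists>\<mu>'. run ?C (R, M) = Some \<mu>' \<and>
        store_rel Z (s\<lparr>low := (low s)(nval s a := real (nval s e))\<rparr>) \<mu>'" by blast
  qed (simp_all add: straight_ncode)
  then show ?thesis by simp
qed

lemma runs_Skip: "Q s \<Longrightarrow> runs Z Skip s 0 Q"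
  by (auto simp: runs_def)

lemma steps_ntest:
  assumes "nsafe Z s a" "nsafe Z s b" "store_rel Z s \<mu>" "code_at P l (ncode 0 a @ ncode 1 b)"
  shows "\<exists>R' M. ((l, \<mu>), (l + (nsize a + nsize b), (R', M))) \<in> step P ^^ (nsize a + nsize b) \<and>
    R' (tmp 0) = real (nval s a) \<and> R' (tmp 1) = real (nval s b) \<and> store_rel Z s (R', M)"
proof -
  obtain R M where \<mu>: "\<mu> = (R, M)" by force
  obtain R1 where R1: "run (ncode 0 a) (R, M) = Some (R1, M)" "R1 (tmp 0) = real (nval s a)"
    "store_rel Z s (R1, M)"
    using ncode_correct[OF assms(1)] same_below_rel assms(3) \<mu> by blast
  obtain R3 where R3: "run (ncode 1 b) (R1, M) = Some (R3, M)" "R3 (tmp 1) = real (nval s b)"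
    "same_below 1 R1 R3"
    using ncode_correct[OF assms(2)] R1(3) by blast
  have "run (ncode 0 a @ ncode 1 b) \<mu> = Some (R3, M)"
    using R1 R3 \<mu> by (simp add: run_append)
  from run_steps[OF this assms(4)]
  have "((l, \<mu>), (l + (nsize a + nsize b), (R3, M))) \<in> step P ^^ (nsize a + nsize b)"
    by (simp add: straight_ncode)
  then show ?thesis
    using R3 same_below_tmp[OF R3(3), of 0] same_below_rel[OF R3(3) R1(3)] R1(2) by auto
qed

lemma steps_rtest:
  assumes "rsafe Z s a" "rsafe Z s b" "store_rel Z s \<mu>" "code_at P l (rcode 0 a @ rcode 1 b)"
  shows "\<exists>R' M. ((l, \<mu>), (l + (rsize a + rsize b), (R', M))) \<in> step P ^^ (rsize a + rsize b) \<and>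
    R' (tmp 0) = rval s a \<and> R' (tmp 1) = rval s b \<and> store_rel Z s (R', M)"
proof -
  obtain R M where \<mu>: "\<mu> = (R, M)" by force
  obtain R1 where R1: "run (rcode 0 a) (R, M) = Some (R1, M)" "R1 (tmp 0) = rval s a"
    "store_rel Z s (R1, M)"
    using rcode_correct[OF assms(1)] same_below_rel assms(3) \<mu> by blast
  obtain R3 where R3: "run (rcode 1 b) (R1, M) = Some (R3, M)" "R3 (tmp 1) = rval s b"
    "same_below 1 R1 R3"
    using rcode_correct[OF assms(2)] R1(3) by blast
  have "run (rcode 0 a @ rcode 1 b) \<mu> = Some (R3, M)"
    using R1 R3 \<mu> by (simp add: run_append)
  from run_steps[OF this assms(4)]
  have "((l, \<mu>), (l + (rsize a + rsize b), (R3, M))) \<in> step P ^^ (rsize a + rsize b)"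
    by (simp add: straight_rcode)
  then show ?thesis
    using R3 same_below_tmp[OF R3(3), of 0] same_below_rel[OF R3(3) R1(3)] R1(2) by auto
qed

text \<open>The two conditionals compile to the same jump pattern around their test code \<open>B\<close>.\<close>

lemma runs_branch:
  assumes test: "\<And>P l \<mu>. store_rel Z s \<mu> \<Longrightarrow> code_at P l B \<Longrightarrow>
      \<exists>R' M. ((l, \<mu>), (l + length B, (R', M))) \<in> step P ^^ length B \<and>
        (R' (tmp 0) < R' (tmp 1) \<longleftrightarrow> b) \<and> store_rel Z s (R', M)"
    and code: "\<And>l. comp l c =
      (let C2 = comp (l + length B + 1) c2;
           l1 = l + length B + length C2 + 2; C1 = comp l1 c1
       in B @ JumpLess (tmp 0) (tmp 1) l1 # C2 @ Jump (l1 + length C1) # C1)"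
    and branch: "if b then runs Z c1 s T Q else runs Z c2 s T Q"
  shows "runs Z c s (length B + T + 2) Q"
  unfolding runs_def
proof (intro allI impI)
  fix P l \<mu> assume c: "code_at P l (comp l c)" and r: "store_rel Z s \<mu>"
  let ?lB = "l + length B"
  define C2 where "C2 = comp (?lB + 1) c2"
  define l1 where "l1 = ?lB + length C2 + 2"
  define C1 where "C1 = comp l1 c1"
  have len: "length (comp l c) = length B + length C2 + length C1 + 2"
    by (simp add: code Let_def C1_def C2_def l1_def)
  have "code_at P l (B @ JumpLess (tmp 0) (tmp 1) l1 # C2 @ Jump (l1 + length C1) # C1)"
    using c by (simp add: code Let_def C1_def C2_def l1_def)
  then have cB: "code_at P l B" and jl: "?lB < length P" "P ! ?lB = JumpLess (tmp 0) (tmp 1) l1"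
    and cC2: "code_at P (?lB + 1) C2"
    and j: "?lB + 1 + length C2 < length P" "P ! (?lB + 1 + length C2) = Jump (l1 + length C1)"
    and cC1: "code_at P l1 C1"
    by (auto simp: code_at_append code_at_Cons l1_def add_ac)
  obtain R' M where B: "((l, \<mu>), (?lB, (R', M))) \<in> step P ^^ length B"
    "R' (tmp 0) < R' (tmp 1) \<longleftrightarrow> b" "store_rel Z s (R', M)"
    using test[OF r cB] by blast
  show "\<exists>t \<mu>' s'. t \<le> length B + T + 2 \<and>
      ((l, \<mu>), (l + length (comp l c), \<mu>')) \<in> step P ^^ t \<and> store_rel Z s' \<mu>' \<and> Q s'"
  proof (cases b)
    case True
    have "((?lB, (R', M)), (l1, (R', M))) \<in> step P ^^ 1"
      using jl B(2) True by (intro step_one) auto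
    moreover obtain t \<mu>' s' where *: "t \<le> T" "((l1, (R', M)), (l1 + length C1, \<mu>')) \<in> step P ^^ t"
      "store_rel Z s' \<mu>'" "Q s'"
      using branch True cC1 B(3) unfolding runs_def C1_def by meson
    ultimately have "((l, \<mu>), (l1 + length C1, \<mu>')) \<in> step P ^^ (length B + 1 + t)"
      using step_comp B(1) by blast
    moreover have "l1 + length C1 = l + length (comp l c)"
      by (simp add: len l1_def)
    ultimately show ?thesis
      using * by (intro exI[of _ "length B + 1 + t"] exI[of _ \<mu>'] exI[of _ s']) auto
  next
    case False
    have "((?lB, (R', M)), (?lB + 1, (R', M))) \<in> step P ^^ 1"
      using jl B(2) False by (intro step_one) auto
    moreover obtain t \<mu>' s' where *: "t \<le> T"
      "((?lB + 1, (R', M)), (?lB + 1 + length C2, \<mu>')) \<in> step P ^^ t" "store_rel Z s' \<mu>'" "Q s'"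
      using branch False cC2 B(3) unfolding runs_def C2_def by meson
    moreover have "((?lB + 1 + length C2, \<mu>'), (l1 + length C1, \<mu>')) \<in> step P ^^ 1"
      using j by (cases \<mu>') (intro step_one, auto)
    ultimately have "((l, \<mu>), (l1 + length C1, \<mu>')) \<in> step P ^^ (length B + 1 + t + 1)"
      using step_comp B(1) by blast
    moreover have "l1 + length C1 = l + length (comp l c)"
      by (simp add: len l1_def)
    ultimately show ?thesis
      using * by (intro exI[of _ "length B + 1 + t + 1"] exI[of _ \<mu>'] exI[of _ s']) auto
  qed
qed

lemma runs_IfN:
  assumes "nsafe Z s a" "nsafe Z s b"
    "if nval s a < nval s b then runs Z c1 s T Q else runs Z c2 s T Q"
  shows "runs Z (IfN a b c1 c2) s (nsize a + nsize b + T + 2) Q"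
proof -
  have "runs Z (IfN a b c1 c2) s (length (ncode 0 a @ ncode 1 b) + T + 2) Q"
  proof (rule runs_branch[OF _ _ assms(3)])
    show "\<exists>R' M. ((l, \<mu>), (l + length (ncode 0 a @ ncode 1 b), (R', M)))
          \<in> step P ^^ length (ncode 0 a @ ncode 1 b) \<and>
        (R' (tmp 0) < R' (tmp 1) \<longleftrightarrow> nval s a < nval s b) \<and> store_rel Z s (R', M)"
      if t: "store_rel Z s \<mu>" "code_at P l (ncode 0 a @ ncode 1 b)" for P l \<mu>
    proof -
      obtain R' M where "((l, \<mu>), (l + (nsize a + nsize b), (R', M))) \<in> step P ^^ (nsize a + nsize b)"
        "R' (tmp 0) = real (nval s a)" "R' (tmp 1) = real (nval s b)" "store_rel Z s (R', M)"
        using steps_ntest[OF assms(1,2) t] by auto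
      then show ?thesis
        by (intro exI[of _ R'] exI[of _ M]) simp
    qed
  qed (simp add: Let_def)
  then show ?thesis by simp
qed

lemma runs_IfR:
  assumes "rsafe Z s a" "rsafe Z s b"
    "if rval s a < rval s b then runs Z c1 s T Q else runs Z c2 s T Q"
  shows "runs Z (IfR a b c1 c2) s (rsize a + rsize b + T + 2) Q"
proof -
  have "runs Z (IfR a b c1 c2) s (length (rcode 0 a @ rcode 1 b) + T + 2) Q"
  proof (rule runs_branch[OF _ _ assms(3)])
    show "\<exists>R' M. ((l, \<mu>), (l + length (rcode 0 a @ rcode 1 b), (R', M)))
          \<in> step P ^^ length (rcode 0 a @ rcode 1 b) \<and>
        (R' (tmp 0) < R' (tmp 1) \<longleftrightarrow> rval s a < rval s b) \<and> store_rel Z s (R', M)"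
      if t: "store_rel Z s \<mu>" "code_at P l (rcode 0 a @ rcode 1 b)" for P l \<mu>
    proof -
      obtain R' M where "((l, \<mu>), (l + (rsize a + rsize b), (R', M))) \<in> step P ^^ (rsize a + rsize b)"
        "R' (tmp 0) = (rval s a)" "R' (tmp 1) = (rval s b)" "store_rel Z s (R', M)"
        using steps_rtest[OF assms(1,2) t] by auto
      then show ?thesis
        by (intro exI[of _ R'] exI[of _ M]) simp
    qed
  qed (simp add: Let_def)
  then show ?thesis by simp
qed

text \<open>The measure \<open>m\<close> bounds the remaining iterations, and every run of the body
  lowers it. An iteration pays for the test, the conditional jump and the jump back; the final test
  pays for one jump only.\<close>

lemma runs_WhileNe:
  assumes "I m s"
    and safe: "\<And>m s. I m s \<Longrightarrow> nsafe Z s a \<and> nsafe Z s b"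
    and body: "\<And>m s. I m s \<Longrightarrow> nval s a \<noteq> nval s b \<Longrightarrow> runs Z c s T (\<lambda>s'. \<exists>m'<m. I m' s')"
  shows "runs Z (WhileNe a b c) s (m * (nsize a + nsize b + T + 2) + (nsize a + nsize b + 1))
    (\<lambda>s'. (\<exists>m. I m s') \<and> nval s' a = nval s' b)"
  using assms(1)
proof (induction m arbitrary: s rule: less_induct)
  case (less m)
  let ?t = "nsize a + nsize b"
  show ?case
    unfolding runs_def
  proof (intro allI impI)
    fix P l \<mu> assume c: "code_at P l (comp l (WhileNe a b c))" and r: "store_rel Z s \<mu>"
    define C where "C = comp (l + ?t + 1) c"
    let ?end = "l + ?t + length C + 2"
    have len: "l + length (comp l (WhileNe a b c)) = ?end"
      by (simp add: Let_def C_def add_ac)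
    have "code_at P l ((ncode 0 a @ ncode 1 b) @ JumpEq (tmp 0) (tmp 1) ?end # C @ [Jump l])"
      using c by (simp add: Let_def C_def add_ac)
    then have cB: "code_at P l (ncode 0 a @ ncode 1 b)"
      and je: "l + ?t < length P" "P ! (l + ?t) = JumpEq (tmp 0) (tmp 1) ?end"
      and cC: "code_at P (l + ?t + 1) C"
      and j: "l + ?t + 1 + length C < length P" "P ! (l + ?t + 1 + length C) = Jump l"
      by (auto simp: code_at_append code_at_Cons add_ac)
    obtain R' M where B: "((l, \<mu>), (l + ?t, (R', M))) \<in> step P ^^ ?t"
      "R' (tmp 0) = real (nval s a)" "R' (tmp 1) = real (nval s b)" "store_rel Z s (R', M)"
      using steps_ntest[OF _ _ r cB] safe[OF less.prems] by blast
    show "\<exists>t \<mu>' s'. t \<le> m * (?t + T + 2) + (?t + 1) \<and>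
      ((l, \<mu>), (l + length (comp l (WhileNe a b c)), \<mu>')) \<in> step P ^^ t \<and> store_rel Z s' \<mu>' \<and>
      ((\<exists>m. I m s') \<and> nval s' a = nval s' b)"
    proof (cases "nval s a = nval s b")
      case True
      have "((l + ?t, (R', M)), (?end, (R', M))) \<in> step P ^^ 1"
        using je B True by (intro step_one) auto
      then have "((l, \<mu>), (?end, (R', M))) \<in> step P ^^ (?t + 1)"
        using step_comp B(1) by blast
      then show ?thesis
        unfolding len using True less.prems B(4) by (intro exI[of _ "?t + 1"] exI conjI) auto
    next
      case False
      have 1: "((l + ?t, (R', M)), (l + ?t + 1, (R', M))) \<in> step P ^^ 1"
        using je B False by (intro step_one) auto
      obtain t \<mu>1 s1 m' where 2: "t \<le> T"
        "((l + ?t + 1, (R', M)), (l + ?t + 1 + length C, \<mu>1)) \<in> step P ^^ t"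
        "store_rel Z s1 \<mu>1" "m' < m" "I m' s1"
        using body[OF less.prems False] cC B(4) unfolding runs_def C_def by meson
      have 3: "((l + ?t + 1 + length C, \<mu>1), (l, \<mu>1)) \<in> step P ^^ 1"
        using j by (cases \<mu>1) (intro step_one, auto)
      obtain t' \<mu>' s' where 4: "t' \<le> m' * (?t + T + 2) + (?t + 1)"
        "((l, \<mu>1), (?end, \<mu>')) \<in> step P ^^ t'" "store_rel Z s' \<mu>'"
        "(\<exists>m. I m s') \<and> nval s' a = nval s' b"
        using less.IH[OF 2(4,5), unfolded runs_def, rule_format, OF c 2(3)] unfolding len by blast
      have "((l, \<mu>), (?end, \<mu>')) \<in> step P ^^ (?t + 1 + t + 1 + t')"
        using step_comp[OF step_comp[OF step_comp[OF step_comp[OF B(1) 1] 2(2)] 3] 4(2)] .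
      moreover have "?t + 1 + t + 1 + t' \<le> m * (?t + T + 2) + (?t + 1)"
      proof -
        have "Suc m' * (?t + T + 2) \<le> m * (?t + T + 2)"
          using 2(4) by (intro mult_right_mono) auto
        then show ?thesis
          using 2(1) 4(1) by simp
      qed
      ultimately show ?thesis
        unfolding len using 4 by blast
    qed
  qed
qed

text \<open>The increment of the counter belongs to the body, and the invariant fixes the counter,
  so \<open>N - i\<close> is the measure. The extra round in the bound covers the final
  test.\<close>

lemma runs_for:
  assumes "I i0 s" "i0 \<le> N"
    and inv: "\<And>i s. I i s \<Longrightarrow> nv s v = i \<and> nsafe Z s b \<and> nval s b = N"
    and body: "\<And>i s. I i s \<Longrightarrow> i0 \<le> i \<Longrightarrow> i < N \<Longrightarrow> runs Z c s T (I (Suc i))"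
  shows "runs Z (WhileNe (NV v) b c) s ((N - i0 + 1) * (nsize b + T + 3)) (I N)"
proof -
  let ?I = "\<lambda>m s. \<exists>i. i0 \<le> i \<and> i \<le> N \<and> m = N - i \<and> I i s"
  have "runs Z (WhileNe (NV v) b c) s ((N - i0) * (nsize (NV v) + nsize b + T + 2) +
      (nsize (NV v) + nsize b + 1)) (\<lambda>s'. (\<exists>m. ?I m s') \<and> nval s' (NV v) = nval s' b)"
  proof (rule runs_WhileNe[where I = ?I])
    show "?I (N - i0) s"
      using assms(1,2) by auto
  next
    fix m s assume "?I m s" and ne: "nval s (NV v) \<noteq> nval s b"
    then obtain i where i: "i0 \<le> i" "i \<le> N" "m = N - i" "I i s" by blast
    with ne inv[OF i(4)] have "i < N" by simp
    show "runs Z c s T (\<lambda>s'. \<exists>m'<m. ?I m' s')"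
      using body[OF i(4,1) \<open>i < N\<close>]
    proof (rule runs_conseq)
      fix s' assume "I (Suc i) s'"
      then show "\<exists>m'<m. ?I m' s'"
        using i(1,3) \<open>i < N\<close> by (intro exI[of _ "N - Suc i"] conjI exI[of _ "Suc i"]) auto
    qed simp
  qed (use inv in auto)
  then show ?thesis
  proof (rule runs_conseq)
    fix s' assume "(\<exists>m. ?I m s') \<and> nval s' (NV v) = nval s' b"
    then obtain i where "I i s'" "nval s' (NV v) = nval s' b" by blast
    with inv[OF this(1)] show "I N s'" by simp
  qed (simp add: algebra_simps)
qed

text \<open>Intended for loop-free code: a loop gets the precondition \<open>False\<close> and is
  handled with an invariant through \<open>runs_WhileNe\<close> instead.\<close>

fun wp :: "nat \<Rightarrow> com \<Rightarrow> (store \<Rightarrow> bool) \<Rightarrow> store \<Rightarrow> bool" where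
  "wp Z Skip Q s = Q s"
| "wp Z (NAsg v e) Q s = (nsafe Z s e \<and> Q (s\<lparr>nv := (nv s)(v := nval s e)\<rparr>))"
| "wp Z (RAsg v e) Q s = (rsafe Z s e \<and> Q (s\<lparr>rv := (rv s)(v := rval s e)\<rparr>))"
| "wp Z (NSto f a e) Q s =
     (nsafe Z s a \<and> nsafe Z s e \<and> f < 8 \<and> Q (s\<lparr>na := (na s)(f := (na s f)(nval s a := nval s e))\<rparr>))"
| "wp Z (RSto f a e) Q s =
     (nsafe Z s a \<and> rsafe Z s e \<and> f < 8 \<and> Q (s\<lparr>ra := (ra s)(f := (ra s f)(nval s a := rval s e))\<rparr>))"
| "wp Z (Out a e) Q s =
     (nsafe Z s a \<and> nsafe Z s e \<and> nval s a < Z \<and> Q (s\<lparr>low := (low s)(nval s a := real (nval s e))\<rparr>))"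
| "wp Z (c1 ;; c2) Q s = wp Z c1 (wp Z c2 Q) s"
| "wp Z (IfN a b c1 c2) Q s =
     (nsafe Z s a \<and> nsafe Z s b \<and> (if nval s a < nval s b then wp Z c1 Q s else wp Z c2 Q s))"
| "wp Z (IfR a b c1 c2) Q s =
     (rsafe Z s a \<and> rsafe Z s b \<and> (if rval s a < rval s b then wp Z c1 Q s else wp Z c2 Q s))"
| "wp Z (WhileNe a b c) Q s = False"

fun time :: "com \<Rightarrow> nat" where
  "time Skip = 0"
| "time (NAsg v e) = nsize e + 1"
| "time (RAsg v e) = rsize e + 1"
| "time (NSto f a e) = nsize a + nsize e + 6"
| "time (RSto f a e) = nsize a + rsize e + 6"
| "time (Out a e) = nsize a + nsize e + 1"
| "time (c1 ;; c2) = time c1 + time c2"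
| "time (IfN a b c1 c2) = nsize a + nsize b + max (time c1) (time c2) + 2"
| "time (IfR a b c1 c2) = rsize a + rsize b + max (time c1) (time c2) + 2"
| "time (WhileNe a b c) = 0"

lemma runs_wp: "wp Z c Q s \<Longrightarrow> runs Z c s (time c) Q"
proof (induction c arbitrary: s Q)
  case (Seq c1 c2)
  then have "runs Z c1 s (time c1) (wp Z c2 Q)" by simp
  then have "runs Z c1 s (time c1) (\<lambda>s'. runs Z c2 s' (time c2) Q)"
    by (rule runs_conseq) (auto intro: Seq.IH)
  then show ?case by (simp add: runs_Seq)
next
  case (IfN a b c1 c2)
  have "runs Z c1 s (max (time c1) (time c2)) Q" if "nval s a < nval s b"
    by (rule runs_conseq[OF IfN.IH(1)]) (use IfN.prems that in auto)
  moreover have "runs Z c2 s (max (time c1) (time c2)) Q" if "\<not> nval s a < nval s b"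
    by (rule runs_conseq[OF IfN.IH(2)]) (use IfN.prems that in auto)
  ultimately show ?case
    using IfN.prems by (simp only: time.simps, intro runs_IfN) auto
next
  case (IfR a b c1 c2)
  have "runs Z c1 s (max (time c1) (time c2)) Q" if "rval s a < rval s b"
    by (rule runs_conseq[OF IfR.IH(1)]) (use IfR.prems that in auto)
  moreover have "runs Z c2 s (max (time c1) (time c2)) Q" if "\<not> rval s a < rval s b"
    by (rule runs_conseq[OF IfR.IH(2)]) (use IfR.prems that in auto)
  ultimately show ?case
    using IfR.prems by (simp only: time.simps, intro runs_IfR) auto
qed (simp_all add: runs_Skip runs_NAsg[simplified] runs_RAsg[simplified] runs_NSto[simplified]
    runs_RSto[simplified] runs_Out[simplified])

section \<open>The cost of a solution by recursion on the tree\<close>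

text \<open>Search trees with the keys \<open>i + 1, ..., j\<close> and the gaps
  \<open>i, ..., j\<close>. With keys in a half-open range, a root \<open>x\<close> leaves the
  intervals \<open>i, x - 1\<close> and \<open>x, j\<close>, whose closed gap ranges are
  disjoint.\<close>

fun bst :: "nat \<Rightarrow> nat \<Rightarrow> bintree \<Rightarrow> bool" where
  "bst i j (External g) \<longleftrightarrow> i = j \<and> g = i"
| "bst i j (Internal l x r) \<longleftrightarrow> i < x \<and> x \<le> j \<and> bst i (x - 1) l \<and> bst x j r"

lemma bst_le: "bst i j T \<Longrightarrow> i \<le> j"
  by (cases T) auto

definition segment :: "nat \<Rightarrow> nat \<Rightarrow> node list" where
  "segment i j = Gap i # concat (map (\<lambda>x. [Key x, Gap x]) [Suc i..<Suc j])"

lemma segment_split: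
  assumes "i < x" "x \<le> j"
  shows "segment i j = segment i (x - 1) @ Key x # segment x j"
proof -
  have "[Suc i..<Suc j] = [Suc i..<x] @ [x..<Suc j]"
    using assms upt_add_eq_append[of "Suc i" x "Suc j - x"] by simp
  moreover have "[x..<Suc j] = x # [Suc x..<Suc j]"
    using assms by (simp add: upt_conv_Cons)
  ultimately show ?thesis
    using assms by (simp add: segment_def)
qed

lemma Key_in_segment: "Key x \<in> set (segment i j) \<longleftrightarrow> i < x \<and> x \<le> j"
  by (auto simp: segment_def)

text \<open>A key occurs at most once in a segment, so the root fixes where the list splits and the
  two halves can be compared separately.\<close>

lemma inorder_eq_segment: "i \<le> j \<Longrightarrow> inorder T = segment i j \<longleftrightarrow> bst i j T"
proof (induction T arbitrary: i j)
  case (External g)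
  then show ?case by (auto simp: segment_def)
next
  case (Internal l x r)
  show ?case
  proof (cases "i < x \<and> x \<le> j")
    case True
    have "inorder (Internal l x r) = segment i j \<longleftrightarrow>
      inorder l @ Key x # inorder r = segment i (x - 1) @ Key x # segment x j"
      using segment_split[of i x j] True by simp
    also have "\<dots> \<longleftrightarrow> inorder l = segment i (x - 1) \<and> inorder r = segment x j"
    proof
      assume *: "inorder l @ Key x # inorder r = segment i (x - 1) @ Key x # segment x j"
      have "Key x \<notin> set (segment i (x - 1))" "Key x \<notin> set (segment x j)"
        using True by (auto simp: Key_in_segment)
      then show "inorder l = segment i (x - 1) \<and> inorder r = segment x j"
        using * append_Cons_eq_iff by metis
    qed simp
    also have "\<dots> \<longleftrightarrow> bst i (x - 1) l \<and> bst x j r"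
      using Internal.IH(1)[of i "x - 1"] Internal.IH(2)[of x j] True by auto
    finally show ?thesis using True by simp
  next
    case False
    then have "Key x \<notin> set (segment i j)" by (auto simp: Key_in_segment)
    moreover have "Key x \<in> set (inorder (Internal l x r))" by simp
    ultimately have "inorder (Internal l x r) \<noteq> segment i j" by metis
    then show ?thesis using False by auto
  qed
qed

lemma is_bst_iff: "is_bst n T \<longleftrightarrow> bst 0 n T"
  using inorder_eq_segment[of 0 n T] by (simp add: is_bst_def segment_def)

section \<open>Subtrees of a search tree and parents of its gaps\<close>

lemma bst_subtree_Key:
  "bst i j T \<Longrightarrow> S \<in> subtrees T \<Longrightarrow> root_node S = Key x \<Longrightarrow> i < x \<and> x \<le> j"
proof (induction T arbitrary: i j)
  case (Internal l y r)
  then have y: "i < y" "y \<le> j" "bst i (y - 1) l" "bst y j r" by auto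
  from Internal.prems(2,3) consider "x = y" | "S \<in> subtrees l" | "S \<in> subtrees r" by auto
  then show ?case
  proof cases
    case 2
    then show ?thesis using Internal.IH(1)[OF y(3) _ Internal.prems(3)] y(1,2) by auto
  next
    case 3
    then show ?thesis using Internal.IH(2)[OF y(4) _ Internal.prems(3)] y(1,2) by auto
  qed (use y in auto)
qed simp

lemma subtrees_refl: "T \<in> subtrees T"
  by (cases T) auto

lemma subtrees_trans: "S \<in> subtrees T \<Longrightarrow> U \<in> subtrees S \<Longrightarrow> U \<in> subtrees T"
  by (induction T) auto

lemma External_in_subtrees: "bst i j T \<Longrightarrow> External g \<in> subtrees T \<longleftrightarrow> i \<le> g \<and> g \<le> j"
proof (induction T arbitrary: i j)
  case (Internal l x r)
  then have x: "i < x" "x \<le> j" "bst i (x - 1) l" "bst x j r" by auto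
  from Internal.IH(1)[OF x(3)] Internal.IH(2)[OF x(4)] x(1,2)
  have "External g \<in> subtrees l \<longleftrightarrow> i \<le> g \<and> g \<le> x - 1"
    "External g \<in> subtrees r \<longleftrightarrow> x \<le> g \<and> g \<le> j" "i < x" "x \<le> j"
    by auto
  then show ?case by auto
qed auto

text \<open>Both sides are definite descriptions with equivalent defining properties: keys below the
  root occur only in the left subtree, keys above it only in the right one. Hence they agree without
  any proof of existence.\<close>

lemma subtree_at_Key:
  assumes "bst i j (Internal l x r)"
  shows "subtree_at (Internal l x r) (Key y) =
    (if y < x then subtree_at l (Key y) else if y = x then Internal l x r else subtree_at r (Key y))"
proof -
  have l: "y \<le> x - 1" if "S \<in> subtrees l" "root_node S = Key y" for S
    using bst_subtree_Key[of i "x - 1" l S y] assms that by simp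
  have r: "x < y" if "S \<in> subtrees r" "root_node S = Key y" for S
    using bst_subtree_Key[of x j r S y] assms that by simp
  have x: "0 < x" using assms by simp
  consider "y < x" | "y = x" | "x < y" by linarith
  then show ?thesis
  proof cases
    case 1
    then have "(S \<in> subtrees (Internal l x r) \<and> root_node S = Key y) \<longleftrightarrow>
      (S \<in> subtrees l \<and> root_node S = Key y)" for S
      using r by force
    then show ?thesis using 1 by (simp add: subtree_at_def)
  next
    case 2
    then have "(S \<in> subtrees (Internal l x r) \<and> root_node S = Key y) \<longleftrightarrow> S = Internal l x r" for S
      using l r x by fastforce
    then show ?thesis using 2 by (simp add: subtree_at_def)
  next
    case 3
    then have "(S \<in> subtrees (Internal l x r) \<and> root_node S = Key y) \<longleftrightarrow>
      (S \<in> subtrees r \<and> root_node S = Key y)" for S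
      using l by force
    then show ?thesis using 3 by (simp add: subtree_at_def)
  qed
qed

lemma subtree_at_Gap:
  assumes "bst i j T" "i \<le> g" "g \<le> j"
  shows "subtree_at T (Gap g) = External g"
proof -
  have "(S \<in> subtrees T \<and> root_node S = Gap g) \<longleftrightarrow> S = External g" for S
    using External_in_subtrees[OF assms(1)] assms(2,3) by (cases S) auto
  then show ?thesis by (simp add: subtree_at_def)
qed

text \<open>A gap whose parent lies in a subtree is itself a subtree there, hence within the gap
  range of that side. So the parent of \<open>g\<close> is the root or lies on the side of
  \<open>g\<close>.\<close>

lemma gap_parent_Internal:
  assumes "bst i j (Internal l x r)" "i \<le> g" "g \<le> j"
  shows "gap_parent (Internal l x r) g =
    (if g < x then if l = External g then x else gap_parent l g
     else if r = External g then x else gap_parent r g)"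
proof -
  have sub: "External g \<in> subtrees S"
    if "Internal l' y r' \<in> subtrees S" "l' = External g \<or> r' = External g" for l' y r' S
    using subtrees_trans[OF that(1), of "External g"] that(2) by auto
  have l: "g \<le> x - 1" if "Internal l' y r' \<in> subtrees l" "l' = External g \<or> r' = External g" for l' y r'
    using External_in_subtrees[of i "x - 1" l g] sub[OF that] assms(1) by simp
  have r: "x \<le> g" if "Internal l' y r' \<in> subtrees r" "l' = External g \<or> r' = External g" for l' y r'
    using External_in_subtrees[of x j r g] sub[OF that] assms(1) by simp
  have lr: "l = External g \<Longrightarrow> g < x" "r = External g \<Longrightarrow> x \<le> g"
    using assms(1) by auto
  show ?thesis
  proof (cases "g < x")
    case True
    then have "(\<exists>l' r'. Internal l' y r' \<in> subtrees (Internal l x r) \<and> (l' = External g \<or> r' = External g))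
      \<longleftrightarrow> (if l = External g then y = x
           else \<exists>l' r'. Internal l' y r' \<in> subtrees l \<and> (l' = External g \<or> r' = External g))" for y
      using r[of _ y] lr(2) by (cases "l = External g") (auto dest: leD)
    then show ?thesis using True by (simp add: gap_parent_def)
  next
    case False
    then have "(\<exists>l' r'. Internal l' y r' \<in> subtrees (Internal l x r) \<and> (l' = External g \<or> r' = External g))
      \<longleftrightarrow> (if r = External g then y = x
           else \<exists>l' r'. Internal l' y r' \<in> subtrees r \<and> (l' = External g \<or> r' = External g))" for y
    proof -
      have "\<not> (Internal l' y r' \<in> subtrees l \<and> (l' = External g \<or> r' = External g))" for l' r'
        using l[of l' y r'] False assms(1) by auto
      then show ?thesis
        using False lr(1) by (cases "r = External g") auto
    qed
    then show ?thesis using False by (simp add: gap_parent_def)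
  qed
qed

text \<open>
  An external child is charged at the address of its parent, hence its weight counts twice in
  what the parent pays: once inside the weight of the parent's subtree, once for itself.
\<close>

fun child_weight :: "(nat \<Rightarrow> real) \<Rightarrow> (nat \<Rightarrow> real) \<Rightarrow> bintree \<Rightarrow> real" where
  "child_weight p q (External g) = 2 * q g"
| "child_weight p q (Internal l x r) = weight p q (Internal l x r)"

fun tree_cost :: "(nat \<Rightarrow> real) \<Rightarrow> (nat \<Rightarrow> real) \<Rightarrow> (nat \<Rightarrow> real) \<Rightarrow> bintree \<Rightarrow> real" where
  "tree_cost p q f (External g) = 0"
| "tree_cost p q f (Internal l x r) = tree_cost p q f l + tree_cost p q f r +
     (child_weight p q l + p x + child_weight p q r) * f x"

lemma keys_split: "(i::nat) < x \<Longrightarrow> x \<le> j \<Longrightarrow> {i<..j} = {i<..x - 1} \<union> ({x} \<union> {x<..j})"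
  by auto

lemma sum_keys_split:
  fixes F :: "nat \<Rightarrow> real"
  assumes "i < x" "x \<le> j"
  shows "sum F {i<..j} = sum F {i<..x - 1} + F x + sum F {x<..j}"
proof -
  have "{i<..x - 1} \<inter> ({x} \<union> {x<..j}) = {}" "{x} \<inter> {x<..j} = {}"
    using assms by auto
  then show ?thesis
    unfolding keys_split[OF assms] by (simp add: sum.union_disjoint)
qed

lemma sum_gaps_split:
  fixes F :: "nat \<Rightarrow> real"
  assumes "i < x" "x \<le> j"
  shows "sum F {i..j} = sum F {i..x - 1} + sum F {x..j}"
proof -
  have "{i..j} = {i..x - 1} \<union> {x..j}" "{i..x - 1} \<inter> {x..j} = {}"
    using assms by auto
  then show ?thesis by (simp add: sum.union_disjoint)
qed

text \<open>A lone external node has no parent inside its tree and is charged by the root above it;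
  hence the case distinction on \<open>i = j\<close>.\<close>

lemma cost_sum_eq_tree_cost:
  assumes "bst i j T"
  shows "(\<Sum>x\<in>{i<..j}. weight p q (subtree_at T (Key x)) * f x) +
    (if i = j then 0 else \<Sum>g\<in>{i..j}. q g * f (gap_parent T g)) = tree_cost p q f T"
  using assms
proof (induction T arbitrary: i j)
  case (Internal l x r)
  let ?T = "Internal l x r"
  have x: "i < x" "x \<le> j" "bst i (x - 1) l" "bst x j r"
    using Internal.prems by auto
  \<comment> \<open>\<open>G\<close> is what a subtree itself charges for its gaps, \<open>E\<close>
    the second weight of an external child, which is paid by the root \<open>x\<close>.\<close>
  define G where "G l i j = (if i = j then 0 else \<Sum>g\<in>{i..j}. q g * f (gap_parent l g))" for l i j
  define E where "E l i j = (if i = j then q i else 0)" for l :: bintree and i j :: nat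
  have ext: "l = External g \<longleftrightarrow> i = j \<and> g = i" if "bst i j l" for l g i j
    using that by (cases l) (auto dest: bst_le)
  have "(\<Sum>y\<in>{i<..j}. weight p q (subtree_at ?T (Key y)) * f y) =
    (\<Sum>y\<in>{i<..x - 1}. weight p q (subtree_at l (Key y)) * f y) + weight p q ?T * f x +
    (\<Sum>y\<in>{x<..j}. weight p q (subtree_at r (Key y)) * f y)"
    unfolding sum_keys_split[OF x(1,2)] using x(1)
    by (intro arg_cong2[of _ _ _ _ "(+)"] sum.cong) (auto simp: subtree_at_Key[OF Internal.prems])
  moreover have "(\<Sum>g\<in>{i..x - 1}. q g * f (gap_parent ?T g)) = E l i (x - 1) * f x + G l i (x - 1)"
  proof (cases "i = x - 1")
    case True
    then have "l = External i" using x(3) ext by blast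
    then show ?thesis
      using True x gap_parent_Internal[OF Internal.prems, of i] by (simp add: E_def G_def)
  next
    case False
    have "(\<Sum>g\<in>{i..x - 1}. q g * f (gap_parent ?T g)) = (\<Sum>g\<in>{i..x - 1}. q g * f (gap_parent l g))"
      using False x ext[OF x(3)]
      by (intro sum.cong refl) (subst gap_parent_Internal[OF Internal.prems], auto)
    then show ?thesis using False by (simp add: E_def G_def)
  qed
  moreover have "(\<Sum>g\<in>{x..j}. q g * f (gap_parent ?T g)) = E r x j * f x + G r x j"
  proof (cases "x = j")
    case True
    then have "r = External x" using x(4) ext by blast
    then show ?thesis
      using True x gap_parent_Internal[OF Internal.prems, of x] by (simp add: E_def G_def)
  next
    case False
    have "(\<Sum>g\<in>{x..j}. q g * f (gap_parent ?T g)) = (\<Sum>g\<in>{x..j}. q g * f (gap_parent r g))"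
      using False x ext[OF x(4)]
      by (intro sum.cong refl) (subst gap_parent_Internal[OF Internal.prems], auto)
    then show ?thesis using False by (simp add: E_def G_def)
  qed
  moreover have "child_weight p q l = weight p q l + E l i j" if "bst i j l" for l i j
    using that by (cases l) (auto simp: E_def)
  from this[OF x(3)] this[OF x(4)] have
    "child_weight p q l = weight p q l + E l i (x - 1)" "child_weight p q r = weight p q r + E r x j" .
  moreover note Internal.IH(1)[OF x(3)] Internal.IH(2)[OF x(4)]
  ultimately show ?case
    using x(1,2) unfolding sum_gaps_split[OF x(1,2)] G_def by (simp add: algebra_simps)
qed auto

lemma solution_cost_eq_tree_cost:
  assumes "bst 0 n T" "1 \<le> n"
  shows "solution_cost n h m c p q T \<phi> = tree_cost p q (\<lambda>x. real (mem_cost h m c (\<phi> x))) T"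
proof -
  have "{1..n} = {0<..n}" by auto
  moreover have "(\<Sum>g=0..n. weight p q (subtree_at T (Gap g)) * real (mem_cost h m c (\<phi> (gap_parent T g))))
    = (\<Sum>g=0..n. q g * real (mem_cost h m c (\<phi> (gap_parent T g))))"
    using subtree_at_Gap[OF assms(1)] by (intro sum.cong) auto
  ultimately show ?thesis
    using cost_sum_eq_tree_cost[OF assms(1), of p q "\<lambda>x. real (mem_cost h m c (\<phi> x))"] assms(2)
    by (simp add: solution_cost_def)
qed

lemma tree_cost_cong:
  "bst i j T \<Longrightarrow> (\<And>x. i < x \<Longrightarrow> x \<le> j \<Longrightarrow> f x = g x) \<Longrightarrow> tree_cost p q f T = tree_cost p q g T"
proof (induction T arbitrary: i j)
  case (Internal l x r)
  then have "tree_cost p q f l = tree_cost p q g l"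
    by (intro Internal.IH(1)[of i "x - 1"]) auto
  moreover have "tree_cost p q f r = tree_cost p q g r"
    using Internal.prems by (intro Internal.IH(2)[of x j]) auto
  ultimately show ?case using Internal.prems by simp
qed simp

text \<open>The value of \<open>child_weight\<close> on every search tree of the interval. The shape
  of the tree does not enter, so the charge of a root is known from its two subintervals
  alone.\<close>

definition interval_weight :: "(nat \<Rightarrow> real) \<Rightarrow> (nat \<Rightarrow> real) \<Rightarrow> nat \<Rightarrow> nat \<Rightarrow> real" where
  "interval_weight p q i j =
     (if i = j then 2 * q i else (\<Sum>x\<in>{i<..j}. p x) + (\<Sum>g\<in>{i..j}. q g))"

lemma weight_eq_sum: "bst i j T \<Longrightarrow> weight p q T = (\<Sum>x\<in>{i<..j}. p x) + (\<Sum>g\<in>{i..j}. q g)"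
proof (induction T arbitrary: i j)
  case (Internal l x r)
  then have x: "i < x" "x \<le> j" "bst i (x - 1) l" "bst x j r" by auto
  show ?case
    using Internal.IH(1)[OF x(3)] Internal.IH(2)[OF x(4)]
    by (simp add: sum_keys_split[OF x(1,2)] sum_gaps_split[OF x(1,2)])
qed simp

lemma child_weight_eq: "bst i j T \<Longrightarrow> child_weight p q T = interval_weight p q i j"
proof (cases T)
  case (Internal l x r)
  moreover assume T: "bst i j T"
  ultimately have "i \<noteq> j" by auto
  then show ?thesis
    using weight_eq_sum[OF T, of p q] Internal by (simp add: interval_weight_def)
qed (auto simp: interval_weight_def)


section \<open>Distributing a set of addresses over a root and its two subtrees\<close>

text \<open>\<open>a = 0\<close> stands for a root in the slowest level, which takes no element of
  \<open>S\<close>.\<close>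

definition splits :: "nat set \<Rightarrow> nat set \<Rightarrow> nat set \<Rightarrow> nat \<Rightarrow> bool" where
  "splits S L R a \<longleftrightarrow> S = L \<union> R \<union> ({a} - {0}) \<and> L \<inter> R = {} \<and> a \<notin> L \<union> R"

type_synonym split_code = "nat \<times> nat \<times> nat \<times> nat"

text \<open>The codes of \<open>S\<close>, \<open>L\<close>, \<open>R\<close> and \<open>a\<close>, where \<open>a = 0\<close> puts the root in the slowest level.\<close>

definition extensions :: "nat \<Rightarrow> split_code \<Rightarrow> split_code set" where
  "extensions t = (\<lambda>(s, l, r, a). {(s + 2 ^ t, l + 2 ^ t, r, a), (s + 2 ^ t, l, r + 2 ^ t, a)} \<union>
     (if a = 0 then {(s + 2 ^ t, l, r, t)} else {}))"

primrec split_codes :: "nat \<Rightarrow> split_code set" where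
  "split_codes 0 = {(0, 0, 0, 0)}"
| "split_codes (Suc t) = split_codes t \<union> (\<Union>x\<in>split_codes t. extensions (Suc t) x)"

lemma set_encode_remove:
  assumes "finite A" "x \<in> A"
  shows "set_encode A = set_encode (A - {x}) + 2 ^ x"
proof -
  have "set_encode (insert x (A - {x})) = 2 ^ x + set_encode (A - {x})"
    by (rule set_encode_insert) (use assms(1) in auto)
  then show ?thesis
    unfolding insert_Diff[OF assms(2)] by (rule trans[OF _ add.commute])
qed

lemma split_codes_sound:
  "(s, l, r, a) \<in> split_codes t \<Longrightarrow> \<exists>S L R. S \<subseteq> {1..t} \<and> splits S L R a \<and>
     s = set_encode S \<and> l = set_encode L \<and> r = set_encode R"
proof (induction t arbitrary: s l r a)
  case 0
  then have "s = set_encode {}" "l = set_encode {}" "r = set_encode {}" "splits {} {} {} a"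
    by (simp_all add: splits_def)
  then show ?case by blast
next
  case (Suc t)
  from Suc.prems consider "(s, l, r, a) \<in> split_codes t" |
    s' l' r' a' where "(s', l', r', a') \<in> split_codes t" "(s, l, r, a) \<in> extensions (Suc t) (s', l', r', a')"
    by auto
  then show ?case
  proof cases
    case 1
    from Suc.IH[OF this] obtain S L R where "S \<subseteq> {1..t}" "splits S L R a"
      "s = set_encode S" "l = set_encode L" "r = set_encode R" by blast
    moreover have "{1..t} \<subseteq> {1..Suc t}" by simp
    ultimately show ?thesis by blast
  next
    case 2
    from Suc.IH[OF 2(1)] obtain S L R where *: "S \<subseteq> {1..t}" "splits S L R a'"
      "s' = set_encode S" "l' = set_encode L" "r' = set_encode R" by blast
    have sub: "L \<subseteq> {1..t}" "R \<subseteq> {1..t}" "a' \<le> t"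
      using *(1,2) by (auto simp: splits_def)
    then have fin: "finite S" "finite L" "finite R"
      using *(1) finite_subset by blast+
    have new: "Suc t \<notin> S" "Suc t \<notin> L" "Suc t \<notin> R" "a' \<noteq> Suc t"
      using *(1) sub by auto
    have enc: "set_encode (insert (Suc t) A) = set_encode A + 2 ^ Suc t" if "finite A" "Suc t \<notin> A" for A
      using set_encode_insert[OF that] by simp
    have S: "insert (Suc t) S \<subseteq> {1..Suc t}" using *(1) by auto
    from 2(2) consider "(s, l, r, a) = (s' + 2 ^ Suc t, l' + 2 ^ Suc t, r', a')" |
      "(s, l, r, a) = (s' + 2 ^ Suc t, l', r' + 2 ^ Suc t, a')" |
      "a' = 0" "(s, l, r, a) = (s' + 2 ^ Suc t, l', r', Suc t)"
      by (auto simp: extensions_def split: if_splits)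
    then show ?thesis
    proof cases
      case 1
      have "splits (insert (Suc t) S) (insert (Suc t) L) R a"
        using *(2) new 1 by (auto simp: splits_def)
      moreover have "s = set_encode (insert (Suc t) S)" "l = set_encode (insert (Suc t) L)" "r = set_encode R"
        using 1 *(3-5) enc fin new by simp_all
      ultimately show ?thesis using S by blast
    next
      case 2
      have "splits (insert (Suc t) S) L (insert (Suc t) R) a"
        using *(2) new 2 by (auto simp: splits_def)
      moreover have "s = set_encode (insert (Suc t) S)" "l = set_encode L" "r = set_encode (insert (Suc t) R)"
        using 2 *(3-5) enc fin new by simp_all
      ultimately show ?thesis using S by blast
    next
      case 3
      have "splits (insert (Suc t) S) L R a"
        using *(2) new 3 by (auto simp: splits_def)
      moreover have "s = set_encode (insert (Suc t) S)" "l = set_encode L" "r = set_encode R"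
        using 3 *(3-5) enc fin new by simp_all
      ultimately show ?thesis using S by blast
    qed
  qed
qed

text \<open>Removing \<open>Suc t\<close> from \<open>S\<close> and from the component that holds it
  leaves a split of the previous stage. The four possible places of \<open>Suc t\<close> correspond
  to a kept entry and to the three extensions.\<close>

lemma split_codes_complete:
  "S \<subseteq> {1..t} \<Longrightarrow> splits S L R a \<Longrightarrow> (set_encode S, set_encode L, set_encode R, a) \<in> split_codes t"
proof (induction t arbitrary: S L R a)
  case 0
  then show ?case by (auto simp: splits_def)
next
  case (Suc t)
  have fin: "finite S" "finite L" "finite R"
    using Suc.prems finite_subset[of _ "{1..Suc t}"] by (auto simp: splits_def)
  have S: "S - {Suc t} \<subseteq> {1..t}" using Suc.prems(1) by (auto simp: le_Suc_eq)
  have ext: "x \<in> split_codes (Suc t)" if "y \<in> split_codes t" "x \<in> extensions (Suc t) y" for x y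
    using that by auto
  consider "Suc t \<notin> S" | "Suc t \<in> L" | "Suc t \<in> R" | "a = Suc t"
    using Suc.prems by (auto simp: splits_def)
  then show ?case
  proof cases
    case 1
    then have "S \<subseteq> {1..t}" using S by auto
    then show ?thesis using Suc.IH Suc.prems(2) by simp
  next
    case 2
    have "splits (S - {Suc t}) (L - {Suc t}) R a"
      using Suc.prems(2) 2 by (auto simp: splits_def)
    moreover have "Suc t \<in> S" using Suc.prems(2) 2 by (auto simp: splits_def)
    ultimately show ?thesis
      using 2 set_encode_remove[OF fin(1), of "Suc t"] set_encode_remove[OF fin(2), of "Suc t"]
      by (intro ext[OF Suc.IH[OF S]]) (auto simp: extensions_def)
  next
    case 3
    have "splits (S - {Suc t}) L (R - {Suc t}) a"
      using Suc.prems(2) 3 by (auto simp: splits_def)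
    moreover have "Suc t \<in> S" using Suc.prems(2) 3 by (auto simp: splits_def)
    ultimately show ?thesis
      using 3 set_encode_remove[OF fin(1), of "Suc t"] set_encode_remove[OF fin(3), of "Suc t"]
      by (intro ext[OF Suc.IH[OF S]]) (auto simp: extensions_def)
  next
    case 4
    \<comment> \<open>Deprived of its address the root is slow, which is the condition for the third
      extension.\<close>
    have "splits (S - {Suc t}) L R 0"
      using Suc.prems 4 by (auto simp: splits_def)
    moreover have "Suc t \<in> S" using Suc.prems(2) 4 by (auto simp: splits_def)
    ultimately show ?thesis
      using 4 set_encode_remove[OF fin(1), of "Suc t"]
      by (intro ext[OF Suc.IH[OF S]]) (auto simp: extensions_def)
  qed
qed

text \<open>All bits from 1 to \<open>k\<close>; bit 0 is missing because addresses start at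
  1.\<close>

lemma set_encode_interval: "set_encode {1..k} = 2 ^ (k + 1) - 2"
proof (induction k)
  case (Suc k)
  have "{1..Suc k} = insert (Suc k) {1..k}" by auto
  then have "set_encode {1..Suc k} = 2 ^ Suc k + (2 ^ (k + 1) - 2)"
    using Suc set_encode_insert[of "{1..k}" "Suc k"] by simp
  moreover have "(2::nat) \<le> 2 ^ (k + 1)" by simp
  ultimately show ?case by simp
qed simp

lemma set_encode_less:
  assumes "S \<subseteq> {1..k}"
  shows "set_encode S < 2 ^ (k + 1)"
proof -
  have "set_encode S \<le> set_encode {1..k}"
    unfolding set_encode_def using assms by (intro sum_mono2) auto
  moreover have "(2::nat) \<le> 2 ^ (k + 1)" by simp
  ultimately show ?thesis
    using set_encode_interval[of k] by linarith
qed

section \<open>Correctness of the dynamic programme\<close>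

text \<open>
  \<open>v\<close> maps the code of an address set to the best cost found, \<open>0\<close> meaning that none has been
  found yet; \<open>rt\<close> and \<open>ch\<close> record the choice that achieves it. \<open>D\<close> is the set of choices
  examined so far.
\<close>

definition best_of :: "nat \<Rightarrow> (nat \<Rightarrow> nat) \<Rightarrow> (nat \<times> nat) set \<Rightarrow> (nat \<times> nat \<Rightarrow> bool) \<Rightarrow>
    (nat \<times> nat \<Rightarrow> real) \<Rightarrow> (nat \<Rightarrow> real) \<Rightarrow> (nat \<Rightarrow> nat) \<Rightarrow> (nat \<Rightarrow> nat) \<Rightarrow> bool" where
  "best_of K ls D feas cand v rt ch \<longleftrightarrow>
     (\<forall>x\<in>D. feas x \<longrightarrow> 0 < v (ls (snd x)) \<and> v (ls (snd x)) \<le> cand x) \<and>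
     (\<forall>s<K. v s \<noteq> 0 \<longrightarrow> (\<exists>x\<in>D. feas x \<and> ls (snd x) = s \<and> v s = cand x \<and>
        rt s = Suc (fst x) \<and> ch s = snd x))"

lemma best_of_empty: "(\<And>s. s < K \<Longrightarrow> v s = 0) \<Longrightarrow> best_of K ls {} feas cand v rt ch"
  by (auto simp: best_of_def)

lemma best_of_skip:
  assumes "best_of K ls D feas cand v rt ch"
    "feas x \<Longrightarrow> 0 < v (ls (snd x)) \<and> v (ls (snd x)) \<le> cand x"
  shows "best_of K ls (insert x D) feas cand v rt ch"
  using assms unfolding best_of_def by blast

text \<open>Earlier feasible choices with the same code stay bounded: a positive old value was at
  most their candidates and is lowered now, and a nonpositive one excludes such choices. Positivity
  of the new value keeps 0 free as the mark of an empty cell.\<close>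

lemma best_of_update:
  assumes "best_of K ls D feas cand v rt ch" "feas x" "0 < cand x"
    "\<not> 0 < v (ls (snd x)) \<or> cand x < v (ls (snd x))"
  shows "best_of K ls (insert x D) feas cand (v(ls (snd x) := cand x))
    (rt(ls (snd x) := Suc (fst x))) (ch(ls (snd x) := snd x))"
  unfolding best_of_def
proof (intro conjI ballI impI allI)
  let ?v = "v(ls (snd x) := cand x)"
  fix y assume y: "y \<in> insert x D" "feas y"
  have old: "0 < v (ls (snd y)) \<and> v (ls (snd y)) \<le> cand y" if "y \<noteq> x"
    using assms(1) y that by (auto simp: best_of_def)
  show "0 < ?v (ls (snd y))"
    using old assms(3) by (cases "y = x") auto
  show "?v (ls (snd y)) \<le> cand y"
    using old assms(4) by (cases "y = x"; cases "ls (snd y) = ls (snd x)") auto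
next
  fix s assume s: "s < K" "(v(ls (snd x) := cand x)) s \<noteq> 0"
  show "\<exists>y\<in>insert x D. feas y \<and> ls (snd y) = s \<and> (v(ls (snd x) := cand x)) s = cand y \<and>
    (rt(ls (snd x) := Suc (fst x))) s = Suc (fst y) \<and> (ch(ls (snd x) := snd x)) s = snd y"
  proof (cases "s = ls (snd x)")
    case True
    then show ?thesis using assms(2) by (intro bexI[of _ x]) auto
  next
    case False
    then have "v s \<noteq> 0" using s(2) by simp
    then obtain y where "y \<in> D" "feas y" "ls (snd y) = s" "v s = cand y" "rt s = Suc (fst y)" "ch s = snd y"
      using assms(1) s(1) unfolding best_of_def by blast
    then show ?thesis using False by (intro bexI[of _ y]) auto
  qed
qed

text \<open>\<open>\<alpha>\<close> sends a key to its fast address, or to 0 for the slowest level.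
  The value 0 may be shared by many keys and is no address.\<close>

definition addresses_used :: "(nat \<Rightarrow> nat) \<Rightarrow> nat \<Rightarrow> nat \<Rightarrow> nat set" where
  "addresses_used \<alpha> i j = \<alpha> ` {i<..j} - {0}"

definition nonzero_inj :: "(nat \<Rightarrow> nat) \<Rightarrow> nat \<Rightarrow> nat \<Rightarrow> bool" where
  "nonzero_inj \<alpha> i j \<longleftrightarrow> inj_on \<alpha> {x \<in> {i<..j}. \<alpha> x \<noteq> 0}"

lemma finite_addresses_used [simp]: "finite (addresses_used \<alpha> i j)"
  by (simp add: addresses_used_def)

lemma addresses_used_split:
  assumes "i < x" "x \<le> j"
  shows "addresses_used \<alpha> i j =
    addresses_used \<alpha> i (x - 1) \<union> addresses_used \<alpha> x j \<union> ({\<alpha> x} - {0})"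
  unfolding addresses_used_def keys_split[OF assms] by auto

lemma nonzero_injD:
  assumes "nonzero_inj \<alpha> i j" "i < y" "y \<le> j" "i < z" "z \<le> j" "\<alpha> y = \<alpha> z" "\<alpha> z \<noteq> 0"
  shows "y = z"
  using assms unfolding nonzero_inj_def inj_on_def by simp

text \<open>The link between assignments and listed splits: injectivity on an interval is
  injectivity on both sides of the root plus disjointness of the three parts. The forward direction
  analyses a given tree, the backward one assembles an assignment from recorded choices.\<close>

lemma nonzero_inj_iff:
  assumes "i < x" "x \<le> j"
  shows "nonzero_inj \<alpha> i j \<longleftrightarrow> nonzero_inj \<alpha> i (x - 1) \<and> nonzero_inj \<alpha> x j \<and>
    splits (addresses_used \<alpha> i j) (addresses_used \<alpha> i (x - 1)) (addresses_used \<alpha> x j) (\<alpha> x)"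
    (is "?A \<longleftrightarrow> ?B")
proof
  assume ?A
  note inj = nonzero_injD[OF this]
  have "nonzero_inj \<alpha> i (x - 1)" "nonzero_inj \<alpha> x j"
    using \<open>?A\<close> assms unfolding nonzero_inj_def by (auto elim!: inj_on_subset)
  moreover have "addresses_used \<alpha> i (x - 1) \<inter> addresses_used \<alpha> x j = {}"
  proof (rule ccontr)
    assume "addresses_used \<alpha> i (x - 1) \<inter> addresses_used \<alpha> x j \<noteq> {}"
    then obtain y z where "i < y" "y \<le> x - 1" "x < z" "z \<le> j" "\<alpha> y = \<alpha> z" "\<alpha> z \<noteq> 0"
      by (auto simp: addresses_used_def)
    moreover from this have "y \<le> j" "i < z" "y < z" using assms by linarith+
    ultimately show False using inj[of y z] by simp
  qed
  moreover have "\<alpha> x \<notin> addresses_used \<alpha> i (x - 1) \<union> addresses_used \<alpha> x j"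
  proof
    assume "\<alpha> x \<in> addresses_used \<alpha> i (x - 1) \<union> addresses_used \<alpha> x j"
    then have "\<alpha> x \<noteq> 0" "\<alpha> x \<in> \<alpha> ` ({i<..x - 1} \<union> {x<..j})"
      by (auto simp: addresses_used_def)
    then obtain y where "i < y \<and> y \<le> x - 1 \<or> x < y \<and> y \<le> j" "\<alpha> x = \<alpha> y" "\<alpha> y \<noteq> 0"
      by (elim imageE) simp
    moreover from this have "y \<le> j" "i < y" "x \<noteq> y" using assms by linarith+
    ultimately show False using inj[of x y] assms by simp
  qed
  ultimately show ?B
    using addresses_used_split[OF assms] by (simp add: splits_def)
next
  assume B: ?B
  have used: "\<alpha> y \<in> addresses_used \<alpha> i' j'" if "i' < y" "y \<le> j'" "\<alpha> y \<noteq> 0" for y i' j'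
    using that by (auto simp: addresses_used_def)
  \<comment> \<open>By symmetry \<open>y < z\<close> may be assumed; the cases are the positions of
    the pair relative to the root \<open>x\<close>.\<close>
  have ne: "\<alpha> y \<noteq> \<alpha> z" if "i < y" "y < z" "z \<le> j" "\<alpha> z \<noteq> 0" "\<alpha> y \<noteq> 0" for y z
  proof -
    consider "z \<le> x - 1" | "x < y" | "z = x" | "y = x" | "y \<le> x - 1" "x < z"
      using that by linarith
    then show ?thesis
    proof cases
      case 1
      then have "y \<le> x - 1" "i < z" "y \<noteq> z" using that by simp_all
      with 1 B that(1,4) nonzero_injD[of \<alpha> i "x - 1" y z] show ?thesis by blast
    next
      case 2
      then have "x < z" "y \<le> j" "y \<noteq> z" using that by simp_all
      with 2 B that(3,4) nonzero_injD[of \<alpha> x j y z] show ?thesis by blast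
    next
      case 3
      then have "y \<le> x - 1" using that by simp
      with 3 B that used[of i y "x - 1"] show ?thesis by (auto simp: splits_def)
    next
      case 4
      with B that used[of x z j] show ?thesis by (auto simp: splits_def)
    next
      case 5
      with B that used[of i y "x - 1"] used[of x z j] show ?thesis by (auto simp: splits_def)
    qed
  qed
  show ?A
    unfolding nonzero_inj_def
  proof (rule inj_onI)
    fix y z assume "y \<in> {x \<in> {i<..j}. \<alpha> x \<noteq> 0}" "z \<in> {x \<in> {i<..j}. \<alpha> x \<noteq> 0}" "\<alpha> y = \<alpha> z"
    with ne[of y z] ne[of z y] show "y = z"
      by (cases y z rule: linorder_cases) auto
  qed
qed

lemma addresses_used_cong:
  "(\<And>x. i < x \<Longrightarrow> x \<le> j \<Longrightarrow> \<alpha> x = \<beta> x) \<Longrightarrow> addresses_used \<alpha> i j = addresses_used \<beta> i j"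
  unfolding addresses_used_def by (auto simp: image_iff)

lemma nonzero_inj_cong:
  "(\<And>x. i < x \<Longrightarrow> x \<le> j \<Longrightarrow> \<alpha> x = \<beta> x) \<Longrightarrow> nonzero_inj \<alpha> i j = nonzero_inj \<beta> i j"
  unfolding nonzero_inj_def inj_on_def by auto

text \<open>An image of the program's arrays, detached from the store, so that the recursion can be
  justified apart from the program. In \<open>val t i j s\<close>, the pair \<open>i, j\<close> is
  an interval and \<open>s\<close> the code of an address set.\<close>

record tables =
  len :: nat
  ls :: "nat \<Rightarrow> nat"
  ll :: "nat \<Rightarrow> nat"
  lr :: "nat \<Rightarrow> nat"
  la :: "nat \<Rightarrow> nat"
  val :: "nat \<Rightarrow> nat \<Rightarrow> nat \<Rightarrow> real"
  rt :: "nat \<Rightarrow> nat \<Rightarrow> nat \<Rightarrow> nat"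
  ch :: "nat \<Rightarrow> nat \<Rightarrow> nat \<Rightarrow> nat"

definition lists_splits :: "nat \<Rightarrow> tables \<Rightarrow> bool" where
  "lists_splits k t \<longleftrightarrow> (\<lambda>e. (ls t e, ll t e, lr t e, la t e)) ` {..<len t} = split_codes k"

text \<open>A choice \<open>(r, e)\<close> takes key \<open>Suc r\<close> as root, so that the left
  interval ends at gap \<open>r\<close>, and list entry \<open>e\<close> for the addresses.\<close>

definition feasible :: "tables \<Rightarrow> nat \<Rightarrow> nat \<Rightarrow> nat \<times> nat \<Rightarrow> bool" where
  "feasible t i j = (\<lambda>(r, e). 0 < val t i r (ll t e) \<and> 0 < val t (Suc r) j (lr t e))"

locale hmm_instance =
  fixes n h :: nat and m c :: "nat \<Rightarrow> nat" and p q :: "nat \<Rightarrow> real"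
  assumes inst: "hmm_bst_instance n h m c p q" and h2: "2 \<le> h"
begin

definition k :: nat where "k = n - m h"

text \<open>Codes have \<open>k + 1\<close> bits, because bit 0 stays clear. \<open>K\<close> bounds
  them and is the stride of the tables.\<close>

definition K :: nat where "K = 2 ^ (k + 1)"

definition address_cost :: "nat \<Rightarrow> nat" where
  "address_cost a = (if a = 0 then c h else mem_cost h m c a)"

definition candidate :: "tables \<Rightarrow> nat \<Rightarrow> nat \<Rightarrow> nat \<times> nat \<Rightarrow> real" where
  "candidate t i j = (\<lambda>(r, e). val t i r (ll t e) + val t (Suc r) j (lr t e) +
     (interval_weight p q i r + p (Suc r) + interval_weight p q (Suc r) j) * real (address_cost (la t e)))"

text \<open>
  The stored value of an interval exceeds the cost of its best tree by the number of external
  nodes, so that it is positive exactly for feasible address sets.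
\<close>

definition solved :: "tables \<Rightarrow> nat \<Rightarrow> nat \<Rightarrow> bool" where
  "solved t i j \<longleftrightarrow>
     (if i = j then val t i j 0 = 1 \<and> (\<forall>s<K. (s \<noteq> 0 \<longrightarrow> val t i j s = 0) \<and> rt t i j s = 0)
      else best_of K (ls t) ({i..<j} \<times> {..<len t}) (feasible t i j) (candidate t i j)
        (val t i j) (rt t i j) (ch t i j))"

lemma list_entry:
  assumes "lists_splits k t" "e < len t"
  obtains S L R where "S \<subseteq> {1..k}" "splits S L R (la t e)"
    "ls t e = set_encode S" "ll t e = set_encode L" "lr t e = set_encode R"
    "finite S" "finite L" "finite R" "ls t e < K" "ll t e < K" "lr t e < K"
proof -
  have "(ls t e, ll t e, lr t e, la t e) \<in> split_codes k"
    using assms by (auto simp: lists_splits_def)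
  from split_codes_sound[OF this] obtain S L R where *: "S \<subseteq> {1..k}" "splits S L R (la t e)"
    "ls t e = set_encode S" "ll t e = set_encode L" "lr t e = set_encode R" by blast
  then have "L \<subseteq> {1..k}" "R \<subseteq> {1..k}" by (auto simp: splits_def)
  then show thesis
    using that[OF *] * set_encode_less[of _ k] finite_subset[of _ "{1..k}"] by (simp add: K_def)
qed

text \<open>The optimality half. The root of a given tree and the way \<open>\<alpha>\<close>
  distributes the addresses form a listed choice by \<open>split_codes_complete\<close>; it is
  feasible by induction, and the table value is at most its candidate.\<close>

lemma solved_le_tree_cost:
  assumes solved: "\<And>i j. i \<le> j \<Longrightarrow> j \<le> n \<Longrightarrow> solved t i j" and lists: "lists_splits k t"
  shows "bst i j T \<Longrightarrow> j \<le> n \<Longrightarrow> nonzero_inj \<alpha> i j \<Longrightarrow> addresses_used \<alpha> i j \<subseteq> {1..k} \<Longrightarrow>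
    0 < val t i j (set_encode (addresses_used \<alpha> i j)) \<and>
    val t i j (set_encode (addresses_used \<alpha> i j)) \<le>
      tree_cost p q (\<lambda>x. real (address_cost (\<alpha> x))) T + real (j - i + 1)"
proof (induction T arbitrary: i j)
  case (External g)
  then have "solved t i i" using solved[of i i] by auto
  moreover have "addresses_used \<alpha> i i = {}" by (simp add: addresses_used_def)
  ultimately show ?case using External by (simp add: solved_def)
next
  case (Internal l x r)
  then have x: "i < x" "x \<le> j" "bst i (x - 1) l" "bst x j r" by auto
  let ?S = "addresses_used \<alpha> i j" and ?L = "addresses_used \<alpha> i (x - 1)" and ?R = "addresses_used \<alpha> x j"
  have spl: "splits ?S ?L ?R (\<alpha> x)" "nonzero_inj \<alpha> i (x - 1)" "nonzero_inj \<alpha> x j"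
    using nonzero_inj_iff[OF x(1,2)] Internal.prems(3) by auto
  have sub: "?L \<subseteq> {1..k}" "?R \<subseteq> {1..k}"
    using addresses_used_split[OF x(1,2), of \<alpha>] Internal.prems(4) by auto
  have "(set_encode ?S, set_encode ?L, set_encode ?R, \<alpha> x) \<in> split_codes k"
    using split_codes_complete[OF Internal.prems(4) spl(1)] .
  then have "(set_encode ?S, set_encode ?L, set_encode ?R, \<alpha> x) \<in>
      (\<lambda>e. (ls t e, ll t e, lr t e, la t e)) ` {..<len t}"
    using lists unfolding lists_splits_def by (simp only:)
  then obtain e where e: "e < len t" "ls t e = set_encode ?S" "ll t e = set_encode ?L"
    "lr t e = set_encode ?R" "la t e = \<alpha> x"
    by (elim imageE) simp
  have IHl: "0 < val t i (x - 1) (set_encode ?L)" "val t i (x - 1) (set_encode ?L) \<le>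
      tree_cost p q (\<lambda>x. real (address_cost (\<alpha> x))) l + real (x - 1 - i + 1)"
    using Internal.IH(1)[OF x(3) _ spl(2) sub(1)] x(2) Internal.prems(2) by auto
  have IHr: "0 < val t x j (set_encode ?R)" "val t x j (set_encode ?R) \<le>
      tree_cost p q (\<lambda>x. real (address_cost (\<alpha> x))) r + real (j - x + 1)"
    using Internal.IH(2)[OF x(4) Internal.prems(2) spl(3) sub(2)] by auto
  have "feasible t i j (x - 1, e)"
    using IHl(1) IHr(1) e x(1) by (simp add: feasible_def)
  moreover have "best_of K (ls t) ({i..<j} \<times> {..<len t}) (feasible t i j) (candidate t i j)
      (val t i j) (rt t i j) (ch t i j)"
    using solved[of i j] x(1,2) Internal.prems(2) by (simp add: solved_def)
  moreover have "(x - 1, e) \<in> {i..<j} \<times> {..<len t}"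
    using x(1,2) e(1) by auto
  ultimately have *: "0 < val t i j (set_encode ?S)" "val t i j (set_encode ?S) \<le> candidate t i j (x - 1, e)"
    unfolding best_of_def using e(2) by force+
  have "candidate t i j (x - 1, e) = val t i (x - 1) (set_encode ?L) + val t x j (set_encode ?R) +
    (child_weight p q l + p x + child_weight p q r) * real (address_cost (\<alpha> x))"
    using x e child_weight_eq[OF x(3), of p q] child_weight_eq[OF x(4), of p q] by (simp add: candidate_def)
  \<comment> \<open>The surcharge is additive: the external nodes of a tree are those of its two
    subtrees.\<close>
  moreover have "real (x - 1 - i + 1) + real (j - x + 1) = real (j - i + 1)"
    using x(1,2) by (simp add: of_nat_diff)
  ultimately show ?case
    using * IHl(2) IHr(2) unfolding tree_cost.simps by linarith
qed

text \<open>The tree read off top-down from the recorded roots and choices. The output routine walks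
  down this very tree, so the predicate ties the abstract solution to the memory contents.\<close>

fun follows :: "tables \<Rightarrow> (nat \<Rightarrow> nat) \<Rightarrow> nat \<Rightarrow> nat \<Rightarrow> nat \<Rightarrow> bintree \<Rightarrow> bool" where
  "follows t \<alpha> i j s (External g) \<longleftrightarrow> s < K"
| "follows t \<alpha> i j s (Internal l x r) \<longleftrightarrow> s < K \<and> rt t i j s = x \<and> ch t i j s < len t \<and>
     \<alpha> x = la t (ch t i j s) \<and> follows t \<alpha> i (x - 1) (ll t (ch t i j s)) l \<and>
     follows t \<alpha> x j (lr t (ch t i j s)) r"

lemma follows_cong:
  "bst i j T \<Longrightarrow> follows t \<alpha> i j s T \<Longrightarrow> (\<And>x. i < x \<Longrightarrow> x \<le> j \<Longrightarrow> \<alpha> x = \<beta> x) \<Longrightarrow> follows t \<beta> i j s T"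
proof (induction T arbitrary: i j s)
  case (Internal l x r)
  then have "follows t \<beta> i (x - 1) (ll t (ch t i j s)) l"
    by (intro Internal.IH(1)) auto
  moreover have "follows t \<beta> x j (lr t (ch t i j s)) r"
    using Internal.prems by (intro Internal.IH(2)) auto
  ultimately show ?case using Internal.prems by auto
qed simp

text \<open>An interval without keys has root entry 0, which is also the null pointer, so the root
  table yields child pointers without a case distinction.\<close>

lemma follows_pointer:
  assumes "bst i j T" "follows t \<alpha> i j s T" "solved t i j"
  shows "pointer T = real (rt t i j s)"
proof (cases T)
  case (External g)
  then have "i = j" "s < K" using assms(1,2) by auto
  then show ?thesis using assms(3) External by (simp add: solved_def)
next
  case (Internal l x r)
  then show ?thesis using assms(2) by simp
qed

text \<open>The attainment half. A nonzero value stems from a feasible choice whose two parts are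
  again nonzero, hence realised by trees, by induction on the interval length.\<close>

lemma solved_build:
  assumes solved: "\<And>i j. i \<le> j \<Longrightarrow> j \<le> n \<Longrightarrow> solved t i j" and lists: "lists_splits k t"
  shows "i \<le> j \<Longrightarrow> j \<le> n \<Longrightarrow> s < K \<Longrightarrow> val t i j s \<noteq> 0 \<Longrightarrow>
    \<exists>T \<alpha>. bst i j T \<and> nonzero_inj \<alpha> i j \<and> set_encode (addresses_used \<alpha> i j) = s \<and>
      val t i j s = tree_cost p q (\<lambda>x. real (address_cost (\<alpha> x))) T + real (j - i + 1) \<and>
      follows t \<alpha> i j s T"
proof (induction "j - i" arbitrary: i j s rule: less_induct)
  case less
  show ?case
  proof (cases "i = j")
    case True
    then have "val t i j 0 = 1" "s \<noteq> 0 \<Longrightarrow> val t i j s = 0"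
      using solved[of i j] less.prems(1-3) by (simp_all add: solved_def)
    with less.prems(4) have "s = 0" "val t i j s = 1" by auto
    then show ?thesis
      using True less.prems(3)
      by (intro exI[of _ "External i"] exI[of _ "\<lambda>_. 0"])
        (auto simp: nonzero_inj_def addresses_used_def)
  next
    case False
    then have "best_of K (ls t) ({i..<j} \<times> {..<len t}) (feasible t i j) (candidate t i j)
      (val t i j) (rt t i j) (ch t i j)"
      using solved[of i j] less.prems by (simp add: solved_def)
    then obtain r e where re: "i \<le> r" "r < j" "e < len t" "feasible t i j (r, e)" "ls t e = s"
      "val t i j s = candidate t i j (r, e)" "rt t i j s = Suc r" "ch t i j s = e"
      using less.prems(3,4) unfolding best_of_def by force
    obtain S L R where e: "S \<subseteq> {1..k}" "splits S L R (la t e)"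
      "ls t e = set_encode S" "ll t e = set_encode L" "lr t e = set_encode R"
      "finite S" "finite L" "finite R" "ls t e < K" "ll t e < K" "lr t e < K"
      using list_entry[OF lists re(3)] .
    have pos: "val t i r (ll t e) \<noteq> 0" "val t (Suc r) j (lr t e) \<noteq> 0"
      using re(4) by (auto simp: feasible_def)
    have less': "r - i < j - i" "r \<le> n" "j - Suc r < j - i" "Suc r \<le> j"
      using re(1,2) less.prems(2) by auto
    from less.hyps[OF less'(1) re(1) less'(2) e(10) pos(1)] obtain T1 \<alpha>1 where 1: "bst i r T1" "nonzero_inj \<alpha>1 i r" "set_encode (addresses_used \<alpha>1 i r) = ll t e"
      "val t i r (ll t e) = tree_cost p q (\<lambda>x. real (address_cost (\<alpha>1 x))) T1 + real (r - i + 1)"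
      "follows t \<alpha>1 i r (ll t e) T1"
      by blast
    from less.hyps[OF less'(3,4) less.prems(2) e(11) pos(2)] obtain T2 \<alpha>2 where 2: "bst (Suc r) j T2" "nonzero_inj \<alpha>2 (Suc r) j"
      "set_encode (addresses_used \<alpha>2 (Suc r) j) = lr t e"
      "val t (Suc r) j (lr t e) = tree_cost p q (\<lambda>x. real (address_cost (\<alpha>2 x))) T2 + real (j - Suc r + 1)"
      "follows t \<alpha>2 (Suc r) j (lr t e) T2"
      by blast
    \<comment> \<open>The two assignments live on disjoint key ranges and are glued at the root
      \<open>Suc r\<close>, whose address comes from the list.\<close>
    define \<alpha> where "\<alpha> x = (if x \<le> r then \<alpha>1 x else if x = Suc r then la t e else \<alpha>2 x)" for x
    have eq: "\<And>x. i < x \<Longrightarrow> x \<le> r \<Longrightarrow> \<alpha>1 x = \<alpha> x" "\<And>x. Suc r < x \<Longrightarrow> x \<le> j \<Longrightarrow> \<alpha>2 x = \<alpha> x"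
      "\<alpha> (Suc r) = la t e"
      by (auto simp: \<alpha>_def)
    have cong: "addresses_used \<alpha>1 i r = addresses_used \<alpha> i r" "nonzero_inj \<alpha>1 i r = nonzero_inj \<alpha> i r"
      "addresses_used \<alpha>2 (Suc r) j = addresses_used \<alpha> (Suc r) j"
      "nonzero_inj \<alpha>2 (Suc r) j = nonzero_inj \<alpha> (Suc r) j"
      by (rule addresses_used_cong nonzero_inj_cong, simp add: eq)+
    have "set_encode (addresses_used \<alpha> i r) = set_encode L"
      "set_encode (addresses_used \<alpha> (Suc r) j) = set_encode R"
      using 1(3) 2(3) e(4,5) cong by simp_all
    \<comment> \<open>Codes determine finite sets, so equal codes mean that the subtrees use exactly
      \<open>L\<close> and \<open>R\<close>.\<close>
    then have "addresses_used \<alpha> i r = L" "addresses_used \<alpha> (Suc r) j = R"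
      using set_encode_eq[OF finite_addresses_used e(7)] set_encode_eq[OF finite_addresses_used e(8)]
      by blast+
    moreover from this have S: "addresses_used \<alpha> i j = S"
      using e(2) addresses_used_split[of i "Suc r" j \<alpha>] re(1,2) eq(3) by (simp add: splits_def)
    ultimately have "nonzero_inj \<alpha> i j"
      using nonzero_inj_iff[of i "Suc r" j \<alpha>] re(1,2) e(2) eq(3) 1(2) 2(2) cong(2,4) by simp
    moreover have "bst i j (Internal T1 (Suc r) T2)"
      using 1(1) 2(1) re(1,2) by simp
    moreover have "set_encode (addresses_used \<alpha> i j) = s"
      using S e(3) re(5) by simp
    moreover have "val t i j s = tree_cost p q (\<lambda>x. real (address_cost (\<alpha> x))) (Internal T1 (Suc r) T2) + real (j - i + 1)"
    proof -
      have "tree_cost p q (\<lambda>x. real (address_cost (\<alpha> x))) T1 = tree_cost p q (\<lambda>x. real (address_cost (\<alpha>1 x))) T1"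
        "tree_cost p q (\<lambda>x. real (address_cost (\<alpha> x))) T2 = tree_cost p q (\<lambda>x. real (address_cost (\<alpha>2 x))) T2"
        by (rule tree_cost_cong[OF 1(1)], simp add: eq(1)) (rule tree_cost_cong[OF 2(1)], simp add: eq(2))
      moreover have "real (r - i + 1) + real (j - Suc r + 1) = real (j - i + 1)"
        using re(1,2) by (simp add: of_nat_diff)
      ultimately show ?thesis
        using re(6) 1(4) 2(4) child_weight_eq[OF 1(1), of p q] child_weight_eq[OF 2(1), of p q] eq(3)
        by (simp add: candidate_def)
    qed
    moreover have "follows t \<alpha> i j s (Internal T1 (Suc r) T2)"
    proof -
      have "follows t \<alpha> i r (ll t e) T1" "follows t \<alpha> (Suc r) j (lr t e) T2"
        by (rule follows_cong[OF 1(1,5)], simp add: eq(1)) (rule follows_cong[OF 2(1,5)], simp add: eq(2))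
      then show ?thesis
        using re(3) less.prems(3) unfolding follows.simps re(7,8) eq(3) by simp
    qed
    ultimately show ?thesis by blast
  qed
qed

section \<open>Memory levels, fast addresses and optimality\<close>

lemma n_pos: "1 \<le> n" and m_pos: "1 \<le> l \<Longrightarrow> l \<le> h \<Longrightarrow> 1 \<le> m l" and m_sum: "(\<Sum>l=1..h. m l) = n"
  and p_nonneg: "1 \<le> i \<Longrightarrow> i \<le> n \<Longrightarrow> 0 \<le> p i" and q_nonneg: "j \<le> n \<Longrightarrow> 0 \<le> q j"
  using inst by (auto simp: hmm_bst_instance_def)

lemma interval_weight_nonneg: "i \<le> j \<Longrightarrow> j \<le> n \<Longrightarrow> 0 \<le> interval_weight p q i j"
  unfolding interval_weight_def by (auto intro!: add_nonneg_nonneg sum_nonneg p_nonneg q_nonneg)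

lemma mem_level_eq:
  assumes "1 \<le> l" "l \<le> h" "(\<Sum>i=1..<l. m i) < a" "a \<le> (\<Sum>i=1..l. m i)"
  shows "mem_level h m a = l"
  unfolding mem_level_def
proof (rule the_equality)
  fix l' assume l': "l' \<in> {1..h} \<and> (\<Sum>k=1..<l'. m k) < a \<and> a \<le> (\<Sum>k=1..l'. m k)"
  have le: "(\<Sum>i=1..x. m i) \<le> (\<Sum>i=1..<y. m i)" if "x < y" for x y
    using that by (intro sum_mono2) auto
  show "l' = l"
    using le[of l l'] le[of l' l] l' assms(3,4) by (cases l l' rule: linorder_cases) auto
qed (use assms in auto)

text \<open>The fast addresses are those of the first \<open>h - 1\<close> levels, and each of these
  levels contains at least one location.\<close>

lemma k_eq: "k = (\<Sum>l=1..<h. m l)" and k_less: "k < n" and h_le: "h \<le> k + 1"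
proof -
  have "{1..h} = insert h {1..<h}" using h2 by auto
  then have s: "n = m h + (\<Sum>l=1..<h. m l)" using m_sum by simp
  then show k: "k = (\<Sum>l=1..<h. m l)" unfolding k_def by linarith
  show "k < n" unfolding k_def using n_pos m_pos[of h] h2 by simp
  have "(\<Sum>l=1..<h. 1) \<le> (\<Sum>l=1..<h. m l)"
    using m_pos by (intro sum_mono) auto
  then show "h \<le> k + 1" using k by simp
qed

lemma mem_cost_slow: "k < a \<Longrightarrow> a \<le> n \<Longrightarrow> mem_cost h m c a = c h"
  using mem_level_eq[of h a] h2 k_eq m_sum by (simp add: mem_cost_def)

text \<open>Replacing the slow addresses of any solution by 0 gives, at equal cost, an assignment
  that uses all of \<open>{1..k}\<close>. Conversely, the tree read off from the tables is completed
  by numbering its slow keys from left to right with \<open>k + 1, ..., n\<close>.\<close>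

lemma solved_optimum:
  assumes solved: "\<And>i j. i \<le> j \<Longrightarrow> j \<le> n \<Longrightarrow> solved t i j" and lists: "lists_splits k t"
  obtains T \<alpha> where "bst 0 n T" "follows t \<alpha> 0 n (K - 2) T" "nonzero_inj \<alpha> 0 n"
    "addresses_used \<alpha> 0 n = {1..k}"
    "is_optimum n h m c p q T (\<lambda>x. if \<alpha> x = 0 then k + card {y \<in> {1..x}. \<alpha> y = 0} else \<alpha> x)"
proof -
  have K2: "set_encode {1..k} = K - 2" "K - 2 < K"
    unfolding K_def by (rule set_encode_interval) simp
  have lower: "0 < val t 0 n (K - 2) \<and> val t 0 n (K - 2) \<le> solution_cost n h m c p q T \<phi> + real (n + 1)"
    if sol: "is_solution n T \<phi>" for T \<phi>
  proof -
    have b: "bst 0 n T" and inj: "inj_on \<phi> {1..n}" and ran: "\<phi> ` {1..n} \<subseteq> {1..n}"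
      using sol by (auto simp: is_solution_def is_bst_iff)
    have surj: "\<phi> ` {1..n} = {1..n}"
      using endo_inj_surj[OF _ ran inj] by simp
    define \<alpha> where "\<alpha> x = (if \<phi> x \<le> k then \<phi> x else 0)" for x
    have "nonzero_inj \<alpha> 0 n"
      unfolding nonzero_inj_def
    proof (rule inj_onI)
      have \<phi>: "\<alpha> x = \<phi> x" if "\<alpha> x \<noteq> 0" for x
        using that by (cases "\<phi> x \<le> k") (simp_all add: \<alpha>_def)
      fix x y assume xy: "x \<in> {x \<in> {0<..n}. \<alpha> x \<noteq> 0}" "y \<in> {x \<in> {0<..n}. \<alpha> x \<noteq> 0}" "\<alpha> x = \<alpha> y"
      then have "x \<in> {1..n}" "y \<in> {1..n}" by simp_all
      moreover have "\<phi> x = \<phi> y" using xy \<phi>[of x] \<phi>[of y] by simp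
      ultimately show "x = y" using inj_onD[OF inj] by blast
    qed
    moreover have "addresses_used \<alpha> 0 n = {1..k}"
    proof
      show "addresses_used \<alpha> 0 n \<subseteq> {1..k}"
        by (auto simp: addresses_used_def \<alpha>_def)
      show "{1..k} \<subseteq> addresses_used \<alpha> 0 n"
      proof
        fix a assume a: "a \<in> {1..k}"
        then have "a \<in> \<phi> ` {1..n}" using surj k_less by auto
        then obtain x where "x \<in> {1..n}" "\<phi> x = a" by blast
        moreover from this have "\<alpha> x = a" using a by (simp add: \<alpha>_def)
        ultimately show "a \<in> addresses_used \<alpha> 0 n"
          using a imageI[of x "{0<..n}" \<alpha>] unfolding addresses_used_def by simp
      qed
    qed
    moreover have "tree_cost p q (\<lambda>x. real (address_cost (\<alpha> x))) T = solution_cost n h m c p q T \<phi>"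
      unfolding solution_cost_eq_tree_cost[OF b n_pos]
    proof (rule tree_cost_cong[OF b])
      fix x assume "0 < x" "x \<le> n"
      then have "\<phi> x \<in> \<phi> ` {1..n}" by (intro imageI) simp
      then have "\<phi> x \<in> {1..n}" using ran by blast
      then show "real (address_cost (\<alpha> x)) = real (mem_cost h m c (\<phi> x))"
        using mem_cost_slow[of "\<phi> x"] by (auto simp: address_cost_def \<alpha>_def)
    qed
    ultimately show ?thesis
      using solved_le_tree_cost[OF assms b, of \<alpha>] K2(1) by simp
  qed
  \<comment> \<open>Some search tree exists; through \<open>lower\<close> this makes the table entry
    of the full address set nonzero.\<close>
  have sol0: "\<exists>T. bst i j T" if "i \<le> j" for i j
    using that
  proof (induction j)
    case 0
    then show ?case by (intro exI[of _ "External 0"]) simp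
  next
    case (Suc j)
    show ?case
    proof (cases "i = Suc j")
      case False
      then obtain T where "bst i j T" using Suc by auto
      then have "bst i (Suc j) (Internal T (Suc j) (External (Suc j)))"
        using False Suc.prems by simp
      then show ?thesis by (rule exI)
    qed (intro exI[of _ "External i"], simp)
  qed
  from sol0[of 0 n] obtain T0 where "bst 0 n T0" by auto
  then have "is_solution n T0 id" by (simp add: is_solution_def is_bst_iff)
  from lower[OF this] have "val t 0 n (K - 2) \<noteq> 0" by simp
  from solved_build[OF assms _ _ K2(2) this] obtain T \<alpha> where T: "bst 0 n T" "nonzero_inj \<alpha> 0 n"
    "set_encode (addresses_used \<alpha> 0 n) = K - 2"
    "val t 0 n (K - 2) = tree_cost p q (\<lambda>x. real (address_cost (\<alpha> x))) T + real (n + 1)"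
    "follows t \<alpha> 0 n (K - 2) T" by auto
  have used: "addresses_used \<alpha> 0 n = {1..k}"
    using T(3) K2(1) set_encode_eq[of "addresses_used \<alpha> 0 n" "{1..k}"] by simp
  \<comment> \<open>The slow keys up to \<open>x\<close>; for a slow \<open>x\<close> their number
    is its rank among the slow keys.\<close>
  define Z where "Z x = {y \<in> {1..x}. \<alpha> y = 0}" for x
  define \<phi> where "\<phi> x = (if \<alpha> x = 0 then k + card (Z x) else \<alpha> x)" for x
  have finZ: "finite (Z x)" for x by (simp add: Z_def)
  have fast: "1 \<le> \<alpha> x \<and> \<alpha> x \<le> k" if "x \<in> {1..n}" "\<alpha> x \<noteq> 0" for x
  proof -
    have "\<alpha> x \<in> addresses_used \<alpha> 0 n"
      using imageI[of x "{0<..n}" \<alpha>] that unfolding addresses_used_def by simp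
    then show ?thesis unfolding used by simp
  qed
  \<comment> \<open>Every fast address occurs and none occurs twice, so exactly \<open>k\<close>
    keys are fast.\<close>
  have cardZ: "card (Z n) = n - k"
  proof -
    have "{1..n} = Z n \<union> {x \<in> {0<..n}. \<alpha> x \<noteq> 0}" "Z n \<inter> {x \<in> {0<..n}. \<alpha> x \<noteq> 0} = {}"
      by (auto simp: Z_def)
    then have "card {1..n} = card (Z n) + card {x \<in> {0<..n}. \<alpha> x \<noteq> 0}"
      using card_Un_disjoint[OF finZ[of n], of "{x \<in> {0<..n}. \<alpha> x \<noteq> 0}"]
      by (metis (no_types, lifting) finite_Un finite_atLeastAtMost)
    moreover have "\<alpha> ` {x \<in> {0<..n}. \<alpha> x \<noteq> 0} = {1..k}"
      unfolding used[symmetric] addresses_used_def by auto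
    then have "card {x \<in> {0<..n}. \<alpha> x \<noteq> 0} = k"
      using card_image[of \<alpha> "{x \<in> {0<..n}. \<alpha> x \<noteq> 0}"] T(2) by (simp add: nonzero_inj_def)
    ultimately show ?thesis by simp
  qed
  have slow: "k < \<phi> x \<and> \<phi> x \<le> n" if "x \<in> {1..n}" "\<alpha> x = 0" for x
  proof -
    have "x \<in> Z x" "Z x \<subseteq> Z n" using that by (auto simp: Z_def)
    then have "0 < card (Z x)" "card (Z x) \<le> n - k"
      using finZ cardZ card_mono[OF finZ[of n], of "Z x"] by (auto simp: card_gt_0_iff)
    then show ?thesis using that k_less by (simp add: \<phi>_def)
  qed
  have mono: "card (Z x) < card (Z y)" if "x < y" "1 \<le> y" "\<alpha> y = 0" for x y
  proof (rule psubset_card_mono[OF finZ psubsetI])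
    show "Z x \<subseteq> Z y" using that by (auto simp: Z_def)
    have "y \<in> Z y" "y \<notin> Z x" using that by (simp_all add: Z_def)
    then show "Z x \<noteq> Z y" by blast
  qed
  have sol: "is_solution n T \<phi>"
    unfolding is_solution_def
  proof (intro conjI)
    show "is_bst n T" using T(1) by (simp add: is_bst_iff)
    show "inj_on \<phi> {1..n}"
    proof (rule inj_onI)
      fix x y assume xy: "x \<in> {1..n}" "y \<in> {1..n}" "\<phi> x = \<phi> y"
      consider "\<alpha> x = 0" "\<alpha> y = 0" | "\<alpha> x = 0" "\<alpha> y \<noteq> 0" | "\<alpha> x \<noteq> 0" "\<alpha> y = 0" | "\<alpha> x \<noteq> 0" "\<alpha> y \<noteq> 0"
        by blast
      then show "x = y"
      proof cases
        case 1
        then show ?thesis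
          using xy mono[of x y] mono[of y x] by (cases x y rule: linorder_cases) (auto simp: \<phi>_def)
      next
        case 2
        then show ?thesis using slow[OF xy(1) 2(1)] fast[OF xy(2) 2(2)] xy(3) by (simp add: \<phi>_def)
      next
        case 3
        then show ?thesis using slow[OF xy(2) 3(2)] fast[OF xy(1) 3(1)] xy(3) by (simp add: \<phi>_def)
      next
        case 4
        then show ?thesis
          using xy T(2) by (auto simp: \<phi>_def nonzero_inj_def inj_on_def)
      qed
    qed
    show "\<phi> ` {1..n} \<subseteq> {1..n}"
    proof
      fix a assume "a \<in> \<phi> ` {1..n}"
      then obtain x where x: "x \<in> {1..n}" "a = \<phi> x" by blast
      show "a \<in> {1..n}"
        using slow[OF x(1)] fast[OF x(1)] x(2) k_less by (cases "\<alpha> x = 0") (auto simp: \<phi>_def)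
    qed
  qed
  have "solution_cost n h m c p q T \<phi> = tree_cost p q (\<lambda>x. real (address_cost (\<alpha> x))) T"
    unfolding solution_cost_eq_tree_cost[OF T(1) n_pos]
  proof (rule tree_cost_cong[OF T(1)])
    fix x assume "0 < x" "x \<le> n"
    then show "real (mem_cost h m c (\<phi> x)) = real (address_cost (\<alpha> x))"
      using slow[of x] mem_cost_slow[of "\<phi> x"] by (cases "\<alpha> x = 0") (auto simp: address_cost_def \<phi>_def)
  qed
  then have "is_optimum n h m c p q T \<phi>"
    unfolding is_optimum_def using sol lower T(4) by fastforce
  moreover have "\<phi> = (\<lambda>x. if \<alpha> x = 0 then k + card {y \<in> {1..x}. \<alpha> y = 0} else \<alpha> x)"
    unfolding \<phi>_def Z_def ..
  ultimately show thesis
    using that[OF T(1,5,2) used] by simp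
qed

end

subsection \<open>Bounding the time of loops\<close>

text \<open>Times of nested loops are kept in the form constant times \<open>M\<close>, so that only
  \<open>M\<close> grows from level to level. The factor 2 covers the test after the last round,
  since \<open>1 \<le> N'\<close>.\<close>

lemma runs_for_bound:
  assumes "I i0 s" "i0 \<le> N" "N - i0 \<le> N'" "1 \<le> N'" "1 \<le> M"
    and inv: "\<And>i s. I i s \<Longrightarrow> nv s v = i \<and> nsafe Z s b \<and> nval s b = N"
    and body: "\<And>i s. I i s \<Longrightarrow> i0 \<le> i \<Longrightarrow> i < N \<Longrightarrow> runs Z c s (t * M) (I (Suc i))"
  shows "runs Z (WhileNe (NV v) b c) s (2 * (nsize b + t + 3) * (N' * M)) (I N)"
proof -
  have "runs Z (WhileNe (NV v) b c) s ((N - i0 + 1) * (nsize b + t * M + 3)) (I N)"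
    by (rule runs_for[OF assms(1,2) inv body])
  moreover have "(N - i0 + 1) * (nsize b + t * M + 3) \<le> 2 * (nsize b + t + 3) * (N' * M)"
  proof -
    have "nsize b + t * M + 3 \<le> (nsize b + t + 3) * M"
      using mult_le_mono2[OF assms(5), of "nsize b + 3"] by (simp add: algebra_simps)
    moreover have "N - i0 + 1 \<le> 2 * N'" using assms(3,4) by linarith
    ultimately have "(N - i0 + 1) * (nsize b + t * M + 3) \<le> (2 * N') * ((nsize b + t + 3) * M)"
      by (rule mult_le_mono[rotated])
    then show ?thesis by (simp only: mult_ac)
  qed
  ultimately show ?thesis by (rule runs_conseq)
qed

text \<open>The constant time of loop-free code is absorbed into the multiple of \<open>M\<close>,
  as \<open>1 \<le> M\<close>.\<close>

lemma runs_wp_Seq: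
  assumes "wp Z c1 (\<lambda>s'. runs Z c2 s' (t * M) Q) s" "1 \<le> M"
  shows "runs Z (c1 ;; c2) s ((time c1 + t) * M) Q"
  by (rule runs_conseq[OF runs_Seq[OF runs_wp[OF assms(1)]]])
    (use assms(2) in \<open>auto simp: add_mult_distrib\<close>)

lemma wp_mono: "wp Z c Q s \<Longrightarrow> (\<And>s. Q s \<Longrightarrow> Q' s) \<Longrightarrow> wp Z c Q' s"
proof (induction c arbitrary: s Q Q')
  case (Seq c1 c2)
  have "wp Z c1 (wp Z c2 Q) s" using Seq.prems(1) by simp
  then have "wp Z c1 (wp Z c2 Q') s"
    by (rule Seq.IH(1)) (rule Seq.IH(2)[OF _ Seq.prems(2)])
  then show ?case by simp
qed (auto split: if_splits)

lemma runs_Seq_wp: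
  assumes "runs Z c1 s (t * M) (wp Z c2 Q)" "1 \<le> M"
  shows "runs Z (c1 ;; c2) s ((t + time c2) * M) Q"
proof -
  have "runs Z c1 s (t * M) (\<lambda>s'. runs Z c2 s' (time c2) Q)"
    by (rule runs_conseq[OF assms(1) order_refl runs_wp])
  from runs_Seq[OF this] show ?thesis
    by (rule runs_conseq) (use assms(2) in \<open>auto simp: add_mult_distrib\<close>)
qed


section \<open>The program\<close>

abbreviation (input) "n_v \<equiv> 2 :: nat"
abbreviation (input) "h_v \<equiv> 3 :: nat"
abbreviation (input) "k_v \<equiv> 4 :: nat"
abbreviation (input) "n1_v \<equiv> 5 :: nat"
abbreviation (input) "P_v \<equiv> 6 :: nat"
abbreviation (input) "len_v \<equiv> 7 :: nat"
abbreviation (input) "t_v \<equiv> 8 :: nat"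
abbreviation (input) "l_v \<equiv> 9 :: nat"
abbreviation (input) "s_v \<equiv> 10 :: nat"
abbreviation (input) "ct_v \<equiv> 11 :: nat"
abbreviation (input) "e_v \<equiv> 12 :: nat"
abbreviation (input) "N_v \<equiv> 13 :: nat"
abbreviation (input) "d_v \<equiv> 14 :: nat"
abbreviation (input) "i_v \<equiv> 15 :: nat"
abbreviation (input) "j_v \<equiv> 16 :: nat"
abbreviation (input) "r_v \<equiv> 17 :: nat"
abbreviation (input) "ix_v \<equiv> 18 :: nat"
abbreviation (input) "S_v \<equiv> 19 :: nat"
abbreviation (input) "rt_v \<equiv> 20 :: nat"
abbreviation (input) "cnt_v \<equiv> 21 :: nat"

abbreviation (input) "w_v \<equiv> 2 :: nat"
abbreviation (input) "W_v \<equiv> 3 :: nat"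
abbreviation (input) "vl_v \<equiv> 4 :: nat"
abbreviation (input) "vr_v \<equiv> 5 :: nat"
abbreviation (input) "cand_v \<equiv> 6 :: nat"

abbreviation (input) "LS \<equiv> 0 :: nat"
abbreviation (input) "LL \<equiv> 2 :: nat"
abbreviation (input) "LR \<equiv> 3 :: nat"
abbreviation (input) "LA \<equiv> 4 :: nat"
abbreviation (input) "LC \<equiv> 5 :: nat"
abbreviation (input) "RT \<equiv> 6 :: nat"
abbreviation (input) "CH \<equiv> 7 :: nat"

abbreviation (input) "VA \<equiv> 0 :: nat"
abbreviation (input) "XW \<equiv> 2 :: nat"

text \<open>
  Entry \<open>e\<close> of the list of splits is stored in \<open>LS\<close>, \<open>LL\<close>, \<open>LR\<close> (codes of the three address
  sets), \<open>LA\<close> (address of the root) and \<open>LC\<close> (cost of that address). The tables \<open>VA\<close> (value),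
  \<open>RT\<close> (root) and \<open>CH\<close> (list entry) are indexed by interval and address set, \<open>XW\<close> by interval.
\<close>

definition push :: "nexp \<Rightarrow> nexp \<Rightarrow> nexp \<Rightarrow> nexp \<Rightarrow> nexp \<Rightarrow> com" where
  "push s l r a c =
     NSto LS (NV len_v) s ;; NSto LL (NV len_v) l ;; NSto LR (NV len_v) r ;;
     NSto LA (NV len_v) a ;; NSto LC (NV len_v) c ;; NAsg len_v (NAdd (NV len_v) (NC 1))"

text \<open>\<open>P_v\<close> is the bit of the current address, so adding it inserts that address
  into a code. The root is still slow exactly when its stored address is below 1.\<close>

definition extend_entry :: com where
  "extend_entry =
     push (NAdd (NArr LS (NV e_v)) (NV P_v)) (NAdd (NArr LL (NV e_v)) (NV P_v)) (NArr LR (NV e_v))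
       (NArr LA (NV e_v)) (NArr LC (NV e_v)) ;;
     push (NAdd (NArr LS (NV e_v)) (NV P_v)) (NArr LL (NV e_v)) (NAdd (NArr LR (NV e_v)) (NV P_v))
       (NArr LA (NV e_v)) (NArr LC (NV e_v)) ;;
     IfN (NArr LA (NV e_v)) (NC 1)
       (push (NAdd (NArr LS (NV e_v)) (NV P_v)) (NArr LL (NV e_v)) (NArr LR (NV e_v)) (NV t_v) (NV ct_v))
       Skip ;;
     NAsg e_v (NAdd (NV e_v) (NC 1))"

text \<open>\<open>s_v\<close> counts the locations of the levels up to \<open>l_v\<close>. Levels
  are nonempty, so one new address crosses at most one level boundary and a single test suffices.
  \<open>N_v\<close> freezes the list length, because entries added in this stage must not be
  extended again.\<close>

definition next_address :: com where
  "next_address =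
     NAsg t_v (NAdd (NV t_v) (NC 1)) ;;
     IfN (NV s_v) (NV t_v)
       (NAsg l_v (NAdd (NV l_v) (NC 1)) ;;
        NAsg s_v (NAdd (NV s_v) (NLow (NAdd (NC 1) (NV l_v)))))
       Skip ;;
     NAsg ct_v (NLow (NAdd (NC 1) (NAdd (NV h_v) (NV l_v)))) ;;
     NAsg e_v (NC 0) ;; NAsg N_v (NV len_v)"

text \<open>List entry 0 is the empty split with a slow root: zero memory already holds its codes
  and address, and only its cost, that of level \<open>h\<close>, has to be stored.
  \<open>P_v\<close> starts as the bit of address 1.\<close>

definition setup_vars :: com where
  "setup_vars =
     NAsg n_v (NLow (NC 0)) ;; NAsg h_v (NLow (NC 1)) ;; NAsg n1_v (NAdd (NV n_v) (NC 1)) ;;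
     NAsg k_v (NSub (NV n_v) (NLow (NAdd (NC 1) (NV h_v)))) ;;
     NSto LC (NC 0) (NLow (NAdd (NC 1) (NAdd (NV h_v) (NV h_v)))) ;;
     NAsg len_v (NC 1) ;; NAsg P_v (NC 2) ;; NAsg t_v (NC 0) ;; NAsg l_v (NC 0) ;; NAsg s_v (NC 0)"

definition double_P :: com where
  "double_P = NAsg P_v (NAdd (NV P_v) (NV P_v))"

definition list_loop :: com where
  "list_loop =
     WhileNe (NV t_v) (NV k_v)
       (next_address ;;
        WhileNe (NV e_v) (NV N_v) extend_entry ;;
        double_P)"

text \<open>A row-major index with strides \<open>n + 1\<close> and \<open>P_v\<close>; the latter
  has become \<open>K\<close> once the list is complete.\<close>

definition cell_exp :: "nexp \<Rightarrow> nexp \<Rightarrow> nexp \<Rightarrow> nexp" where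
  "cell_exp i j x = NAdd (NMul (NAdd (NMul i (NV n1_v)) j) (NV P_v)) x"

definition pair_exp :: "nexp \<Rightarrow> nexp \<Rightarrow> nexp" where
  "pair_exp i j = NAdd (NMul i (NV n1_v)) j"

abbreviation (input) "suc e \<equiv> NAdd e (NC 1)"

definition record_choice :: com where
  "record_choice =
     RSto VA (NV ix_v) (RV cand_v) ;; NSto RT (NV ix_v) (suc (NV r_v)) ;; NSto CH (NV ix_v) (NV e_v)"

text \<open>The comparisons with 0 ask whether both subintervals have a tree for their address sets
  and whether the target cell is already filled; costs are compared only if it is.\<close>

definition try_entry :: com where
  "try_entry =
     RAsg vl_v (RArr VA (cell_exp (NV i_v) (NV r_v) (NArr LL (NV e_v)))) ;;
     RAsg vr_v (RArr VA (cell_exp (suc (NV r_v)) (NV j_v) (NArr LR (NV e_v)))) ;;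
     IfR (RN (NC 0)) (RV vl_v)
       (IfR (RN (NC 0)) (RV vr_v)
         (RAsg cand_v (RAdd (RAdd (RV vl_v) (RV vr_v)) (RMul (RV W_v) (RN (NArr LC (NV e_v))))) ;;
          NAsg ix_v (cell_exp (NV i_v) (NV j_v) (NArr LS (NV e_v))) ;;
          IfR (RN (NC 0)) (RArr VA (NV ix_v))
            (IfR (RV cand_v) (RArr VA (NV ix_v)) record_choice Skip)
            record_choice)
         Skip)
       Skip ;;
     NAsg e_v (suc (NV e_v))"

definition root_init :: com where
  "root_init =
     RAsg W_v (RAdd (RAdd (RArr XW (pair_exp (NV i_v) (NV r_v)))
       (RLow (NAdd (NAdd (NC 2) (NAdd (NV h_v) (NV h_v))) (NV r_v))))
       (RArr XW (pair_exp (suc (NV r_v)) (NV j_v)))) ;;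
     NAsg e_v (NC 0)"

definition try_root :: com where
  "try_root =
     root_init ;;
     WhileNe (NV e_v) (NV len_v) try_entry ;;
     NAsg r_v (suc (NV r_v))"

text \<open>The weight of an interval is obtained in constant time from that of its predecessor. In
  the input, \<open>p j\<close> stands at \<open>1 + 2 * h + j\<close> and \<open>q j\<close> at
  \<open>2 + 2 * h + n + j\<close>.\<close>

definition interval_init :: com where
  "interval_init =
     NAsg j_v (suc (NV j_v)) ;;
     RAsg w_v (RAdd (RV w_v)
       (RAdd (RLow (NAdd (NAdd (NC 1) (NAdd (NV h_v) (NV h_v))) (NV j_v)))
             (RLow (NAdd (NAdd (NC 2) (NAdd (NV h_v) (NV h_v))) (NAdd (NV n_v) (NV j_v)))))) ;;
     RSto XW (pair_exp (NV i_v) (NV j_v)) (RV w_v) ;;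
     NAsg r_v (NV i_v)"

definition solve_interval :: com where
  "solve_interval =
     interval_init ;;
     WhileNe (NV r_v) (NV j_v) try_root"

text \<open>A single gap counts twice towards the charge of its parent. Its value is 1 at the empty
  address set: cost 0 plus the unit for its one external node.\<close>

definition row_init :: com where
  "row_init =
     NAsg i_v (NSub (NV n_v) (NV d_v)) ;;
     RAsg w_v (RLow (NAdd (NAdd (NC 2) (NAdd (NV h_v) (NV h_v))) (NAdd (NV n_v) (NV i_v)))) ;;
     RSto XW (pair_exp (NV i_v) (NV i_v)) (RAdd (RV w_v) (RV w_v)) ;;
     RSto VA (cell_exp (NV i_v) (NV i_v) (NC 0)) (RN (NC 1)) ;;
     NAsg j_v (NV i_v)"

definition solve_row :: com where
  "solve_row =
     row_init ;;
     WhileNe (NV j_v) (NV n_v) solve_interval ;;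
     NAsg d_v (suc (NV d_v))"

definition solve_all :: com where
  "solve_all = NAsg d_v (NC 0) ;; WhileNe (NV d_v) (NV n1_v) solve_row"

definition look_up :: com where
  "look_up =
     NAsg ix_v (cell_exp (NV i_v) (NV j_v) (NV S_v)) ;;
     NAsg rt_v (NArr RT (NV ix_v)) ;; NAsg e_v (NArr CH (NV ix_v))"

definition descend :: com where
  "descend =
     IfN (NV r_v) (NV rt_v)
       (NAsg j_v (NSub (NV rt_v) (NC 1)) ;; NAsg S_v (NArr LL (NV e_v)))
       (NAsg i_v (NV rt_v) ;; NAsg S_v (NArr LR (NV e_v))) ;;
     look_up"

text \<open>Keys are emitted in increasing order and the counter starts at \<open>k\<close>, so the
  slow keys are numbered from left to right.\<close>

definition emit_key :: com where
  "emit_key =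
     Out (NV r_v) (NArr RT (cell_exp (NV i_v) (NSub (NV rt_v) (NC 1)) (NArr LL (NV e_v)))) ;;
     Out (NAdd (NV n_v) (NV r_v)) (NArr RT (cell_exp (NV rt_v) (NV j_v) (NArr LR (NV e_v)))) ;;
     IfN (NArr LA (NV e_v)) (NC 1)
       (NAsg cnt_v (suc (NV cnt_v)) ;;
        Out (NAdd (NAdd (NV n_v) (NV n_v)) (NV r_v)) (NV cnt_v))
       (Out (NAdd (NAdd (NV n_v) (NV n_v)) (NV r_v)) (NArr LA (NV e_v)))"

text \<open>The walk starts at the full interval; \<open>P_v - 2\<close> is the code of all fast
  addresses.\<close>

definition key_init :: com where
  "key_init =
     NAsg r_v (suc (NV r_v)) ;; NAsg i_v (NC 0) ;; NAsg j_v (NV n_v) ;;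
     NAsg S_v (NSub (NV P_v) (NC 2)) ;; look_up"

definition output_key :: com where
  "output_key =
     key_init ;;
     WhileNe (NV r_v) (NV rt_v) descend ;;
     emit_key"

definition output_root :: com where
  "output_root =
     Out (NC 0) (NArr RT (cell_exp (NC 0) (NV n_v) (NSub (NV P_v) (NC 2))))"

definition output_all :: com where
  "output_all =
     (NAsg r_v (NC 0) ;; NAsg cnt_v (NV k_v)) ;;
     WhileNe (NV r_v) (NV n_v) output_key ;;
     output_root"

definition main_com :: com where
  "main_com = setup_vars ;; list_loop ;; solve_all ;; output_all"


section \<open>Listing the splits\<close>

definition entry :: "store \<Rightarrow> nat \<Rightarrow> split_code" where
  "entry s e = (na s LS e, na s LL e, na s LR e, na s LA e)"

definition pushed :: "store \<Rightarrow> split_code \<Rightarrow> nat \<Rightarrow> store" where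
  "pushed s x c = (case x of (a, l, r, b) \<Rightarrow> s\<lparr>
     na := (na s)(LS := (na s LS)(nv s len_v := a), LL := (na s LL)(nv s len_v := l),
       LR := (na s LR)(nv s len_v := r), LA := (na s LA)(nv s len_v := b),
       LC := (na s LC)(nv s len_v := c)),
     nv := (nv s)(len_v := nv s len_v + 1)\<rparr>)"

lemma wp_push:
  "wp Z (push (NAdd (NArr LS (NV e_v)) (NV P_v)) (NAdd (NArr LL (NV e_v)) (NV P_v)) (NArr LR (NV e_v))
       (NArr LA (NV e_v)) (NArr LC (NV e_v))) Q s =
    Q (pushed s (na s LS (nv s e_v) + nv s P_v, na s LL (nv s e_v) + nv s P_v, na s LR (nv s e_v),
      na s LA (nv s e_v)) (na s LC (nv s e_v)))"
  "wp Z (push (NAdd (NArr LS (NV e_v)) (NV P_v)) (NArr LL (NV e_v)) (NAdd (NArr LR (NV e_v)) (NV P_v))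
       (NArr LA (NV e_v)) (NArr LC (NV e_v))) Q s =
    Q (pushed s (na s LS (nv s e_v) + nv s P_v, na s LL (nv s e_v), na s LR (nv s e_v) + nv s P_v,
      na s LA (nv s e_v)) (na s LC (nv s e_v)))"
  "wp Z (push (NAdd (NArr LS (NV e_v)) (NV P_v)) (NArr LL (NV e_v)) (NArr LR (NV e_v))
       (NV t_v) (NV ct_v)) Q s =
    Q (pushed s (na s LS (nv s e_v) + nv s P_v, na s LL (nv s e_v), na s LR (nv s e_v), nv s t_v)
      (nv s ct_v))"
  by (simp_all add: push_def pushed_def fun_upd_twist)

lemma entry_pushed:
  "entry (pushed s x c) e = (if e = nv s len_v then x else entry s e)"
  "na (pushed s x c) LC e = (if e = nv s len_v then c else na s LC e)"
  "nv (pushed s x c) v = (if v = len_v then nv s len_v + 1 else nv s v)"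
  "low (pushed s x c) = low s" "ra (pushed s x c) = ra s"
  "na (pushed s x c) RT = na s RT" "na (pushed s x c) CH = na s CH"
  by (cases x; simp add: pushed_def entry_def)+

lemma entry_components:
  "na s LS e = fst (entry s e)" "na s LL e = fst (snd (entry s e))"
  "na s LR e = fst (snd (snd (entry s e)))" "na s LA e = snd (snd (snd (entry s e)))"
  by (simp_all add: entry_def)

lemma image_entry_pushed: "entry (pushed s x c) ` {..<Suc (nv s len_v)} = insert x (entry s ` {..<nv s len_v})"
  by (auto simp: entry_pushed lessThan_Suc)

text \<open>The coefficients produced by \<open>runs_for_bound\<close> and the sequencing rules;
  they depend on the program text only. The summand 1 is the size of a loop bound.\<close>

definition list_time :: nat where
  "list_time = 2 * (1 + (time next_address + 2 * (1 + time extend_entry + 3) +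
     time double_P) + 3)"

context hmm_instance
begin

definition listed :: "nat \<Rightarrow> store \<Rightarrow> split_code set \<Rightarrow> bool" where
  "listed N s E \<longleftrightarrow> entry s ` {..<nv s len_v} = E \<and> nv s len_v \<le> N \<and>
     (\<forall>e<nv s len_v. na s LC e = address_cost (na s LA e))"

lemma listed_pushed:
  assumes "listed N s E" "f = address_cost (snd (snd (snd x)))"
  shows "listed (Suc N) (pushed s x f) (insert x E)"
  unfolding listed_def
proof (intro conjI allI impI)
  have len: "nv (pushed s x f) len_v = Suc (nv s len_v)" by (simp add: entry_pushed)
  show "entry (pushed s x f) ` {..<nv (pushed s x f) len_v} = insert x E"
    using assms(1) unfolding len image_entry_pushed by (simp add: listed_def)
  show "nv (pushed s x f) len_v \<le> Suc N"
    using assms(1) unfolding len by (simp add: listed_def)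
  fix e assume "e < nv (pushed s x f) len_v"
  then have "e < nv s len_v \<or> e = nv s len_v" unfolding len by linarith
  moreover have "na s LC e = address_cost (snd (snd (snd (entry s e))))" if "e < nv s len_v"
    using assms(1) that unfolding listed_def entry_components by blast
  ultimately show "na (pushed s x f) LC e = address_cost (na (pushed s x f) LA e)"
    using assms(2) unfolding entry_components entry_pushed by auto
qed

definition input :: "nat \<Rightarrow> real" where
  "input = (\<lambda>a. let xs = encode_instance n h m c p q in if a < length xs then xs ! a else 0)"

lemma input_eqs:
  "input 0 = real n" "input (Suc 0) = real h"
  "1 \<le> l \<Longrightarrow> l \<le> h \<Longrightarrow> input (Suc l) = real (m l)"
  "1 \<le> l \<Longrightarrow> l \<le> h \<Longrightarrow> input (Suc (h + l)) = real (c l)"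
  "1 \<le> i \<Longrightarrow> i \<le> n \<Longrightarrow> input (Suc (h + h) + i) = p i"
  "j \<le> n \<Longrightarrow> input (2 + (h + h) + (n + j)) = q j"
  unfolding input_def encode_instance_def Let_def
  by (auto simp: nth_append nth_Cons' simp del: upt_Suc)

text \<open>From \<open>2 \<le> h \<le> n\<close>: the input and the output block both fit below the
  base \<open>8 * n\<close> of the array area.\<close>

lemma memory_bounds: "2 * h + 2 * n + 3 \<le> 8 * n" "3 * n < 8 * n"
  using h_le k_less h2 by linarith+

text \<open>\<open>nv s l_v\<close> is the level of address \<open>t\<close>, and 0 before the first
  address. It stays below \<open>h\<close> because only fast addresses are listed.\<close>

definition level_inv :: "nat \<Rightarrow> store \<Rightarrow> bool" where
  "level_inv t s \<longleftrightarrow> nv s s_v = (\<Sum>i=1..nv s l_v. m i) \<and> nv s l_v < h \<and> t \<le> nv s s_v \<and>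
     (0 < t \<longrightarrow> 0 < nv s l_v) \<and> (0 < nv s l_v \<longrightarrow> (\<Sum>i=1..<nv s l_v. m i) < t)"

definition vars_inv :: "nat \<Rightarrow> store \<Rightarrow> bool" where
  "vars_inv t s \<longleftrightarrow> nv s n_v = n \<and> nv s h_v = h \<and> nv s n1_v = n + 1 \<and> nv s k_v = k \<and> nv s t_v = t \<and>
     low s = input \<and> ra s = (\<lambda>_ _. 0) \<and> na s RT = (\<lambda>_. 0) \<and> na s CH = (\<lambda>_. 0) \<and> level_inv t s"

definition list_inv :: "nat \<Rightarrow> store \<Rightarrow> bool" where
  "list_inv t s \<longleftrightarrow> vars_inv t s \<and> nv s P_v = 2 ^ (t + 1) \<and> listed (4 ^ t) s (split_codes t)"

text \<open>\<open>s0\<close> is the store at the start of the stage, whose old entries are the ones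
  to be extended. The length bound \<open>4 ^ t + 3 * e\<close> reaches at most
  \<open>4 ^ Suc t\<close>, as there are at most \<open>4 ^ t\<close> of them.\<close>

definition extend_inv :: "nat \<Rightarrow> store \<Rightarrow> nat \<Rightarrow> store \<Rightarrow> bool" where
  "extend_inv t s0 e s \<longleftrightarrow> vars_inv (Suc t) s \<and> nv s P_v = 2 ^ Suc t \<and> nv s ct_v = address_cost (Suc t) \<and>
     nv s e_v = e \<and> nv s N_v = nv s0 len_v \<and> nv s0 len_v \<le> nv s len_v \<and>
     (\<forall>x<nv s0 len_v. entry s x = entry s0 x) \<and>
     listed (4 ^ t + 3 * e) s (split_codes t \<union> (\<Union>x<e. extensions (Suc t) (entry s0 x)))"

lemma vars_inv_cong:
  assumes "vars_inv t s" "\<And>v. v \<in> {n_v, h_v, n1_v, k_v, t_v, s_v, l_v} \<Longrightarrow> nv s' v = nv s v"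
    "low s' = low s" "ra s' = ra s" "na s' RT = na s RT" "na s' CH = na s CH"
  shows "vars_inv t s'"
  using assms unfolding vars_inv_def level_inv_def by simp

lemma listed_cong:
  "listed N s E \<Longrightarrow> nv s' len_v = nv s len_v \<Longrightarrow> na s' = na s \<Longrightarrow> listed N s' E"
  unfolding listed_def entry_def by simp

lemma listed_mono: "listed N s E \<Longrightarrow> N \<le> N' \<Longrightarrow> listed N' s E"
  unfolding listed_def by simp

lemma extend_entry_correct:
  assumes "extend_inv t s0 e s" "e < nv s0 len_v"
  shows "wp Z extend_entry (extend_inv t s0 (Suc e)) s"
proof -
  note inv = assms(1)[unfolded extend_inv_def]
  have lt: "e < nv s len_v" using inv assms(2) by linarith
  obtain a l r b where ent: "entry s e = (a, l, r, b)" by (metis prod_cases4)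
  then have ent0: "entry s0 e = (a, l, r, b)" using inv assms(2) by simp
  have cost: "na s LC e = address_cost b"
    using inv lt ent unfolding listed_def entry_def by auto
  define P where "P = nv s P_v"
  define s1 where "s1 = pushed s (a + P, l + P, r, b) (address_cost b)"
  define s2 where "s2 = pushed s1 (a + P, l, r + P, b) (address_cost b)"
  define s3 where "s3 = (if b = 0 then pushed s2 (a + P, l, r, Suc t) (address_cost (Suc t)) else s2)"
  have P: "P = 2 ^ Suc t" using inv by (simp add: P_def)
  have comp: "na s LS e = a" "na s LL e = l" "na s LR e = r" "na s LA e = b"
    using ent by (auto simp: entry_def)
  have ent1: "entry s1 e = (a, l, r, b)" "entry s2 e = (a, l, r, b)"
    using lt ent by (auto simp: s1_def s2_def entry_pushed)
  have comp1: "na s1 LS e = a" "na s1 LL e = l" "na s1 LR e = r" "na s1 LA e = b" "na s1 LC e = address_cost b"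
    "na s2 LS e = a" "na s2 LL e = l" "na s2 LR e = r" "na s2 LA e = b"
    using ent1 lt cost by (auto simp: entry_def s1_def entry_pushed)
  have nv: "nv s e_v = e" "nv s1 e_v = e" "nv s1 P_v = P" "nv s2 e_v = e" "nv s2 P_v = P" "nv s2 t_v = Suc t"
    "nv s2 ct_v = address_cost (Suc t)" "nv s3 e_v = e" "nv s3 P_v = P"
    using inv by (auto simp: s1_def s2_def s3_def entry_pushed P_def vars_inv_def)
  \<comment> \<open>The code is executed symbolically once for an arbitrary postcondition; the
    invariant is then checked on the resulting store.\<close>
  have "wp Z extend_entry Q s \<longleftrightarrow> Q (s3\<lparr>nv := (nv s3)(e_v := Suc e)\<rparr>)" for Q
  proof -
    have "pushed s (a + P, l + P, r, b) (address_cost b) = s1" "pushed s1 (a + P, l, r + P, b) (address_cost b) = s2"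
      by (simp_all add: s1_def s2_def)
    then show ?thesis
      by (simp add: extend_entry_def wp_push comp comp1 cost nv P_def[symmetric] s3_def)
        (simp add: entry_pushed nv)
  qed
  moreover have "extend_inv t s0 (Suc e) (s3\<lparr>nv := (nv s3)(e_v := Suc e)\<rparr>)" (is "extend_inv _ _ _ ?s")
    unfolding extend_inv_def
  proof (intro conjI allI impI)
    have nvs: "nv ?s v = nv s v" if "v \<noteq> e_v" "v \<noteq> len_v" for v
      using that by (simp add: s3_def s2_def s1_def entry_pushed)
    have len: "nv s len_v \<le> nv ?s len_v"
      by (simp add: s3_def s2_def s1_def entry_pushed)
    show "vars_inv (Suc t) ?s"
    proof (rule vars_inv_cong[of _ s])
      show "vars_inv (Suc t) s" using inv by blast
    qed (use nvs in \<open>auto simp: s3_def s2_def s1_def entry_pushed\<close>)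
    show "nv ?s P_v = 2 ^ Suc t" "nv ?s ct_v = address_cost (Suc t)" "nv ?s N_v = nv s0 len_v"
      using nvs inv by simp_all
    show "nv ?s e_v = Suc e" by simp
    show "nv s0 len_v \<le> nv ?s len_v" using len inv by linarith
    show "entry ?s x = entry s0 x" if "x < nv s0 len_v" for x
    proof -
      have "x < nv s len_v" using that inv by linarith
      then have "entry s3 x = entry s x" by (simp add: s3_def s2_def s1_def entry_pushed)
      moreover have "entry ?s x = entry s3 x" by (simp add: entry_def)
      ultimately show ?thesis using inv that by simp
    qed
    let ?E = "split_codes t \<union> (\<Union>x<e. extensions (Suc t) (entry s0 x))"
    have "listed (4 ^ t + 3 * e) s ?E" using inv by blast
    from listed_pushed[OF this, of _ "(a + P, l + P, r, b)"]
    have "listed (Suc (4 ^ t + 3 * e)) s1 (insert (a + P, l + P, r, b) ?E)" by (simp add: s1_def)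
    from listed_pushed[OF this, of _ "(a + P, l, r + P, b)"]
    have 2: "listed (Suc (Suc (4 ^ t + 3 * e))) s2 (insert (a + P, l, r + P, b) (insert (a + P, l + P, r, b) ?E))"
      by (simp add: s2_def)
    have "listed (4 ^ t + 3 * Suc e) s3 (?E \<union> extensions (Suc t) (a, l, r, b))"
    proof (cases "b = 0")
      case True
      have N: "4 ^ t + 3 * Suc e = Suc (Suc (Suc (4 ^ t + 3 * e)))" by simp
      from True have E: "?E \<union> extensions (Suc t) (a, l, r, b) = insert (a + P, l, r, Suc t)
          (insert (a + P, l, r + P, b) (insert (a + P, l + P, r, b) ?E))"
        unfolding extensions_def P by auto
      show ?thesis
        unfolding E N using listed_pushed[OF 2, of "address_cost (Suc t)" "(a + P, l, r, Suc t)"] True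
        by (simp add: s3_def)
    next
      case False
      then have E: "?E \<union> extensions (Suc t) (a, l, r, b) =
          insert (a + P, l, r + P, b) (insert (a + P, l + P, r, b) ?E)"
        unfolding extensions_def P by auto
      show ?thesis
        unfolding E using listed_mono[OF 2, of "4 ^ t + 3 * Suc e"] False by (simp add: s3_def)
    qed
    moreover have "?E \<union> extensions (Suc t) (a, l, r, b) =
        split_codes t \<union> (\<Union>x<Suc e. extensions (Suc t) (entry s0 x))"
      using ent0 by (auto simp: lessThan_Suc)
    ultimately show "listed (4 ^ t + 3 * Suc e) ?s (split_codes t \<union> (\<Union>x<Suc e. extensions (Suc t) (entry s0 x)))"
      by (simp add: listed_cong[of _ s3])
  qed
  ultimately show ?thesis by simp
qed

lemma next_address_correct:
  assumes "list_inv t s" "t < k"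
  shows "wp (8 * n) next_address (\<lambda>s'. extend_inv t s' 0 s' \<and> nv s' len_v \<le> 4 ^ t \<and>
    entry s' ` {..<nv s' len_v} = split_codes t) s"
proof -
  note inv = assms(1)[unfolded list_inv_def vars_inv_def level_inv_def]
  define l where "l = nv s l_v"
  define l' where "l' = (if nv s s_v < Suc t then Suc l else l)"
  have S: "nv s s_v = (\<Sum>i=1..l. m i)" "l < h" "t \<le> nv s s_v" "0 < l \<Longrightarrow> (\<Sum>i=1..<l. m i) < t"
    using inv by (simp_all add: l_def)
  have l': "1 \<le> l'" "l' < h" "(\<Sum>i=1..<l'. m i) < Suc t" "Suc t \<le> (\<Sum>i=1..l'. m i)"
  proof -
    have *: "1 \<le> l' \<and> l' < h \<and> (\<Sum>i=1..<l'. m i) < Suc t \<and> Suc t \<le> (\<Sum>i=1..l'. m i)"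
    proof (cases "nv s s_v < Suc t")
      case True
      \<comment> \<open>At \<open>l = h - 1\<close> the sum would already be \<open>k\<close>,
        contradicting \<open>t < k\<close>; so the level entered next is still fast.\<close>
      have "{1..<h} = {1..h - 1}" using h2 by auto
      then have "l \<noteq> h - 1" using True k_eq assms(2) S(1) by auto
      then have "Suc l < h" using S(2) by linarith
      moreover have "{1..<Suc l} = {1..l}" by auto
      moreover have "1 \<le> m (Suc l)" using m_pos[of "Suc l"] \<open>Suc l < h\<close> by simp
      ultimately show ?thesis using True S(1,3) by (simp add: l'_def)
    next
      case False
      then have "0 < l" using S(1) by (cases l) auto
      then show ?thesis using False S by (auto simp: l'_def)
    qed
    then show "1 \<le> l'" "l' < h" "(\<Sum>i=1..<l'. m i) < Suc t" "Suc t \<le> (\<Sum>i=1..l'. m i)" by auto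
  qed
  have cost: "address_cost (Suc t) = c l'"
    using mem_level_eq[of l' "Suc t"] l' by (simp add: address_cost_def mem_cost_def)
  have sum': "(\<Sum>i=1..l'. m i) = (if nv s s_v < Suc t then nv s s_v + m (Suc l) else nv s s_v)"
    using S(1) by (simp add: l'_def)
  have inp: "input (Suc (Suc l)) = real (m (Suc l))" if "nv s s_v < Suc t"
    using input_eqs(3)[of "Suc l"] l' that by (simp add: l'_def)
  have inp': "input (Suc (h + l')) = real (c l')"
    using input_eqs(4)[of l'] l' by simp
  have listed: "listed (4 ^ t) s (split_codes t)" using inv by blast
  have bound: "Suc (h + l') < 8 * n" "Suc l' < 8 * n"
    using l' memory_bounds(1) by linarith+
  let ?s = "s\<lparr>nv := (nv s)(t_v := Suc t, l_v := l', s_v := (\<Sum>i=1..l'. m i), ct_v := c l', e_v := 0,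
    N_v := nv s len_v)\<rparr>"
  have "extend_inv t ?s 0 ?s"
    unfolding extend_inv_def vars_inv_def level_inv_def
    using inv l' cost listed_cong[OF listed, of ?s] by (simp add: entry_def)
  moreover have "nv ?s len_v \<le> 4 ^ t" "entry ?s ` {..<nv ?s len_v} = split_codes t"
    using listed by (simp_all add: listed_def entry_def)
  moreover have "wp (8 * n) next_address Q s = Q ?s" for Q
  proof (cases "nv s s_v < Suc t")
    case True
    have "(\<Sum>i=1..l'. m i) = nv s s_v + m (Suc l)" "l' = Suc l" using sum' True by (simp_all add: l'_def)
    then show ?thesis
      using True inv inp inp' bound
      by (simp add: next_address_def l_def[symmetric] add.commute fun_upd_twist)
  next
    case False
    then have "(\<Sum>i=1..l'. m i) = nv s s_v" "l' = l" using sum' by (simp_all add: l'_def)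
    moreover from this have "(nv s)(t_v := Suc t) = (nv s)(t_v := Suc t, l_v := l', s_v := (\<Sum>i=1..l'. m i))"
      by (auto simp: l_def)
    ultimately show ?thesis
      using False inv inp' bound
      by (simp add: next_address_def l_def[symmetric] add.commute)
  qed
  ultimately show ?thesis by simp
qed

text \<open>Each of the at most \<open>n\<close> stages extends at most \<open>4 ^ k\<close>
  entries; this crude product is below the time bound for the tables.\<close>

lemma list_loop_correct:
  assumes "list_inv 0 s"
  shows "runs (8 * n) list_loop s (list_time * (n * 4 ^ k)) (list_inv k)"
proof -
  have "runs (8 * n) (next_address ;; WhileNe (NV e_v) (NV N_v) extend_entry ;;
      double_P) s
      ((time next_address + (2 * (nsize (NV N_v) + time extend_entry + 3) +
        time double_P)) * 4 ^ k) (list_inv (Suc t))"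
    if t: "list_inv t s" "t < k" for t s
  proof (rule runs_wp_Seq)
    let ?Q = "wp (8 * n) double_P (list_inv (Suc t))"
    have loop: "runs (8 * n) (WhileNe (NV e_v) (NV N_v) extend_entry) s'
        (2 * (nsize (NV N_v) + time extend_entry + 3) * 4 ^ k) ?Q"
      if s': "extend_inv t s' 0 s'" "nv s' len_v \<le> 4 ^ t" "entry s' ` {..<nv s' len_v} = split_codes t" for s'
    proof -
      have le: "nv s' len_v \<le> 4 ^ k"
        using s'(2) order.trans[OF _ power_increasing[of t k "4::nat"]] t(2) by simp
      have "runs (8 * n) (WhileNe (NV e_v) (NV N_v) extend_entry) s'
        (2 * (nsize (NV N_v) + time extend_entry + 3) * (4 ^ k * 1)) (extend_inv t s' (nv s' len_v))"
      proof (rule runs_for_bound[where ?i0.0 = 0])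
        show "runs (8 * n) extend_entry s1 (time extend_entry * 1) (extend_inv t s' (Suc e))"
          if "extend_inv t s' e s1" "e < nv s' len_v" for e s1
          using runs_wp[OF extend_entry_correct[OF that]] by simp
      qed (use s'(1) le in \<open>auto simp: extend_inv_def\<close>)
      then show ?thesis
      proof (rule runs_conseq)
        fix s1 assume inv: "extend_inv t s' (nv s' len_v) s1"
        let ?s = "s1\<lparr>nv := (nv s1)(P_v := nv s1 P_v + nv s1 P_v)\<rparr>"
        have "(\<Union>x<nv s' len_v. extensions (Suc t) (entry s' x)) = (\<Union>x\<in>split_codes t. extensions (Suc t) x)"
          unfolding s'(3)[symmetric] by simp
        then have "listed (4 ^ t + 3 * nv s' len_v) s1 (split_codes (Suc t))"
          using inv by (simp add: extend_inv_def)
        then have "listed (4 ^ Suc t) s1 (split_codes (Suc t))"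
          using s'(2) by (auto elim: listed_mono)
        then have "listed (4 ^ Suc t) ?s (split_codes (Suc t))"
          by (rule listed_cong) auto
        moreover have "vars_inv (Suc t) ?s"
          by (rule vars_inv_cong[of _ s1]) (use inv in \<open>auto simp: extend_inv_def\<close>)
        ultimately show "?Q s1"
          using inv by (simp add: double_P_def list_inv_def extend_inv_def)
      qed simp
    qed
    show "wp (8 * n) next_address (\<lambda>s'. runs (8 * n) (WhileNe (NV e_v) (NV N_v) extend_entry ;;
      double_P) s' ((2 * (nsize (NV N_v) + time extend_entry + 3) +
        time double_P) * 4 ^ k) (list_inv (Suc t))) s"
      by (rule wp_mono[OF next_address_correct[OF t]]) (rule runs_Seq_wp, use loop in auto)
  qed simp
  note body = this
  have "runs (8 * n) list_loop s (2 * (nsize (NV k_v) + (time next_address +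
      (2 * (nsize (NV N_v) + time extend_entry + 3) + time double_P)) + 3) *
      (n * 4 ^ k)) (list_inv k)"
    unfolding list_loop_def
    by (rule runs_for_bound[where ?i0.0 = 0 and I = list_inv, OF assms])
      (use body n_pos k_less in \<open>auto simp: list_inv_def vars_inv_def\<close>)
  then show ?thesis by (simp add: list_time_def add_ac)
qed

lemma setup_vars_correct:
  "wp (8 * n) setup_vars (list_inv 0)
     \<lparr>nv = \<lambda>_. 0, rv = \<lambda>_. 0, na = \<lambda>_ _. 0, ra = \<lambda>_ _. 0, low = input\<rparr>"
proof -
  have i: "input (Suc h) = real (m h)" "input (Suc (h + h)) = real (c h)"
    using input_eqs(3,4)[of h] h2 by simp_all
  have b: "Suc (h + h) < 8 * n" "Suc 0 < 8 * n" "Suc h < 8 * n" using memory_bounds by linarith+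
  have "m h \<le> n" using m_sum member_le_sum[of h "{1..h}" m] h2 by simp
  then show ?thesis
    using h2 b unfolding setup_vars_def
    by (simp add: lessThan_Suc input_eqs i list_inv_def vars_inv_def level_inv_def listed_def entry_def k_def address_cost_def)
qed

end

section \<open>Filling the tables\<close>

lemma best_of_cong:
  fixes ls rt rt' ch ch' :: "nat \<Rightarrow> nat"
  assumes "best_of K ls D feas cand v rt ch"
    and "\<And>x. x \<in> D \<Longrightarrow> feas' x = feas x" "\<And>x. x \<in> D \<Longrightarrow> cand' x = cand x"
    and "\<And>s. s < K \<Longrightarrow> v' s = v s" "\<And>s. s < K \<Longrightarrow> rt' s = rt s" "\<And>s. s < K \<Longrightarrow> ch' s = ch s"
    and "\<And>x. x \<in> D \<Longrightarrow> ls (snd x) < K"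
  shows "best_of K ls D feas' cand' v' rt' ch'"
  unfolding best_of_def
proof (intro conjI ballI impI allI)
  fix x assume x: "x \<in> D" "feas' x"
  then have "0 < v (ls (snd x)) \<and> v (ls (snd x)) \<le> cand x"
    using assms(1) assms(2)[OF x(1)] by (simp add: best_of_def)
  then show "0 < v' (ls (snd x))" "v' (ls (snd x)) \<le> cand' x"
    using assms(3)[OF x(1)] assms(4)[OF assms(7)[OF x(1)]] by simp_all
next
  fix s assume s: "s < K" "v' s \<noteq> 0"
  then have "v s \<noteq> 0" using assms(4) by simp
  then obtain x where x: "x \<in> D" "feas x" "ls (snd x) = s" "v s = cand x" "rt s = Suc (fst x)" "ch s = snd x"
    using assms(1) s(1) unfolding best_of_def by blast
  show "\<exists>x\<in>D. feas' x \<and> ls (snd x) = s \<and> v' s = cand' x \<and> rt' s = Suc (fst x) \<and> ch' s = snd x"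
    by (rule bexI[OF _ x(1)]) (use x assms(2,3)[OF x(1)] assms(4-6)[OF s(1)] in simp)
qed

definition root_time :: nat where
  "root_time = time root_init +
    (2 * (1 + time try_entry + 3) + time (NAsg r_v (suc (NV r_v))))"

definition interval_time :: nat where
  "interval_time = time interval_init + 2 * (1 + root_time + 3)"

text \<open>\<open>b\<close> is the store after the list has been built. The list arrays stay
  constant from then on and can always be read from \<open>b\<close>.\<close>

locale hmm_listed = hmm_instance +
  fixes b :: store
  assumes b: "list_inv k b"
begin

definition E :: nat where "E = nv b len_v"

definition n1 :: nat where "n1 = n + 1"

definition cell :: "nat \<Rightarrow> nat \<Rightarrow> nat \<Rightarrow> nat" where
  "cell i j x = (i * n1 + j) * K + x"

definition pair :: "nat \<Rightarrow> nat \<Rightarrow> nat" where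
  "pair i j = i * n1 + j"

definition tab :: "store \<Rightarrow> tables" where
  "tab s = \<lparr>tables.len = E, ls = na b LS, ll = na b LL, lr = na b LR, la = na b LA,
     val = \<lambda>i j x. ra s VA (cell i j x), rt = \<lambda>i j x. na s RT (cell i j x),
     ch = \<lambda>i j x. na s CH (cell i j x)\<rparr>"

definition ctx :: "store \<Rightarrow> bool" where
  "ctx s \<longleftrightarrow> nv s n_v = n \<and> nv s h_v = h \<and> nv s k_v = k \<and> nv s n1_v = n1 \<and> nv s P_v = K \<and> nv s len_v = E \<and>
     na s LS = na b LS \<and> na s LL = na b LL \<and> na s LR = na b LR \<and> na s LA = na b LA \<and> na s LC = na b LC"

lemma nval_cell_exp:
  "nv s n1_v = n1 \<Longrightarrow> nv s P_v = K \<Longrightarrow> nval s (cell_exp x y z) = cell (nval s x) (nval s y) (nval s z)"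
  by (simp add: cell_exp_def cell_def)

lemma nsafe_cell_exp: "nsafe Z s (cell_exp x y z) \<longleftrightarrow> nsafe Z s x \<and> nsafe Z s y \<and> nsafe Z s z"
  by (auto simp: cell_exp_def)

lemma nval_pair_exp: "nv s n1_v = n1 \<Longrightarrow> nval s (pair_exp x y) = pair (nval s x) (nval s y)"
  by (simp add: pair_exp_def pair_def)

lemma nsafe_pair_exp: "nsafe Z s (pair_exp x y) \<longleftrightarrow> nsafe Z s x \<and> nsafe Z s y"
  by (auto simp: pair_exp_def)

lemmas exp_simps = nval_cell_exp nsafe_cell_exp nval_pair_exp nsafe_pair_exp

lemma tab_simps [simp]:
  "tables.len (tab s) = E" "ls (tab s) = na b LS" "ll (tab s) = na b LL" "lr (tab s) = na b LR"
  "la (tab s) = na b LA" "val (tab s) i j x = ra s VA (cell i j x)"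
  "rt (tab s) i j x = na s RT (cell i j x)" "ch (tab s) i j x = na s CH (cell i j x)"
  by (simp_all add: tab_def)

lemma listed_b: "entry b ` {..<E} = split_codes k" "E \<le> 4 ^ k"
  "e < E \<Longrightarrow> na b LC e = address_cost (na b LA e)"
  using b by (auto simp: list_inv_def listed_def E_def)

lemma lists_splits_tab: "lists_splits k (tab s)"
  using listed_b(1) by (simp add: lists_splits_def entry_def)

lemma codes_less:
  assumes "e < E"
  shows "na b LS e < K" "na b LL e < K" "na b LR e < K"
proof -
  have e: "e < tables.len (tab b)" using assms by simp
  show "na b LS e < K" by (rule list_entry[OF lists_splits_tab e]) simp
  show "na b LL e < K" by (rule list_entry[OF lists_splits_tab e]) simp
  show "na b LR e < K" by (rule list_entry[OF lists_splits_tab e]) simp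
qed

lemma pair_eq_iff:
  assumes "j \<le> n" "j' \<le> n"
  shows "pair i j = pair i' j' \<longleftrightarrow> i = i' \<and> j = j'"
proof
  assume *: "pair i j = pair i' j'"
  have "pair i j div n1 = i" "pair i j mod n1 = j" if "j \<le> n" for i j
  proof -
    have "j < n1" using that by (simp add: n1_def)
    then show "pair i j div n1 = i" "pair i j mod n1 = j" by (simp_all add: pair_def)
  qed
  from this[OF assms(1), of i] this[OF assms(2), of i'] * show "i = i' \<and> j = j'" by simp
qed simp

lemma cell_eq_iff:
  assumes "j \<le> n" "j' \<le> n" "x < K" "x' < K"
  shows "cell i j x = cell i' j' x' \<longleftrightarrow> i = i' \<and> j = j' \<and> x = x'"
proof
  assume *: "cell i j x = cell i' j' x'"
  have "cell i j x div K = pair i j" "cell i j x mod K = x" if "x < K" for i j x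
    using that by (simp_all add: cell_def pair_def)
  from this[OF assms(3), of i j] this[OF assms(4), of i' j'] * have "pair i j = pair i' j'" "x = x'" by simp_all
  then show "i = i' \<and> j = j' \<and> x = x'" using pair_eq_iff[OF assms(1,2)] by simp
qed simp

lemma cell_same_iff: "cell i j x = cell i j y \<longleftrightarrow> x = y"
  by (simp add: cell_def)

section \<open>Invariants for filling the cells of one interval\<close>

definition agree_off :: "nat \<Rightarrow> nat \<Rightarrow> store \<Rightarrow> store \<Rightarrow> bool" where
  "agree_off i j s0 s \<longleftrightarrow> (\<forall>i' j' x. (i', j') \<noteq> (i, j) \<longrightarrow> j' \<le> n \<longrightarrow> x < K \<longrightarrow>
     ra s VA (cell i' j' x) = ra s0 VA (cell i' j' x) \<and> na s RT (cell i' j' x) = na s0 RT (cell i' j' x) \<and>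
     na s CH (cell i' j' x) = na s0 CH (cell i' j' x))"

definition tried :: "nat \<Rightarrow> nat \<Rightarrow> nat \<Rightarrow> (nat \<times> nat) set" where
  "tried i r e = {i..<r} \<times> {..<E} \<union> {r} \<times> {..<e}"

lemma tried_simps:
  "tried i r (Suc e) = insert (r, e) (tried i r e)" "tried i i 0 = {}"
  "i \<le> r \<Longrightarrow> tried i r E = tried i (Suc r) 0" "tried i r 0 = {i..<r} \<times> {..<E}"
  by (auto simp: tried_def less_Suc_eq)

text \<open>Feasibility and candidates are measured in the store \<open>s0\<close> from the start of
  the interval, values in the current \<open>s\<close>: the standard of comparison stays fixed while
  cells of \<open>i, j\<close> are written.\<close>

definition best_so_far :: "store \<Rightarrow> nat \<Rightarrow> nat \<Rightarrow> (nat \<times> nat) set \<Rightarrow> store \<Rightarrow> bool" where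
  "best_so_far s0 i j D s \<longleftrightarrow> best_of K (na b LS) D (feasible (tab s0) i j) (candidate (tab s0) i j)
     (val (tab s) i j) (rt (tab s) i j) (ch (tab s) i j)"

definition interval_inv :: "store \<Rightarrow> nat \<Rightarrow> nat \<Rightarrow> nat \<Rightarrow> nat \<Rightarrow> store \<Rightarrow> bool" where
  "interval_inv s0 i j r e s \<longleftrightarrow> ctx s \<and> low s = input \<and> nv s d_v = nv s0 d_v \<and> nv s i_v = i \<and> nv s j_v = j \<and>
     nv s r_v = r \<and> rv s w_v = rv s0 w_v \<and> ra s XW = ra s0 XW \<and> agree_off i j s0 s \<and>
     best_so_far s0 i j (tried i r e) s"

definition try_inv :: "store \<Rightarrow> nat \<Rightarrow> nat \<Rightarrow> nat \<Rightarrow> nat \<Rightarrow> store \<Rightarrow> bool" where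
  "try_inv s0 i j r e s \<longleftrightarrow> interval_inv s0 i j r e s \<and> nv s e_v = e \<and>
     rv s W_v = interval_weight p q i r + p (Suc r) + interval_weight p q (Suc r) j"

lemma try_inv_skip:
  assumes "try_inv s0 i j r e s"
    and "feasible (tab s0) i j (r, e) \<Longrightarrow> 0 < ra s VA (cell i j (na b LS e)) \<and>
      ra s VA (cell i j (na b LS e)) \<le> candidate (tab s0) i j (r, e)"
    and nv: "\<And>v. v \<noteq> e_v \<Longrightarrow> v \<noteq> ix_v \<Longrightarrow> nv s' v = nv s v" "nv s' e_v = Suc e"
    and same: "rv s' w_v = rv s w_v" "rv s' W_v = rv s W_v" "na s' = na s" "ra s' = ra s" "low s' = low s"
  shows "try_inv s0 i j r (Suc e) s'"
proof -
  note inv = assms(1)[unfolded try_inv_def interval_inv_def]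
  have "ctx s'"
    using inv unfolding ctx_def by (simp add: nv same)
  moreover have "best_so_far s0 i j (tried i r (Suc e)) s'"
    using best_of_skip[of K "na b LS" "tried i r e" _ _ "val (tab s) i j" _ _ "(r, e)"] inv assms(2)
    unfolding best_so_far_def tried_simps(1) by (simp add: tab_def same)
  moreover have "agree_off i j s0 s'"
    using inv by (simp add: agree_off_def same)
  ultimately show ?thesis
    using inv unfolding try_inv_def interval_inv_def by (simp add: nv same)
qed

lemma try_inv_record:
  assumes "try_inv s0 i j r e s" "j \<le> n" "e < E"
    and "feasible (tab s0) i j (r, e)" "0 < candidate (tab s0) i j (r, e)"
      "\<not> 0 < ra s VA (cell i j (na b LS e)) \<or> candidate (tab s0) i j (r, e) < ra s VA (cell i j (na b LS e))"
    and nv: "\<And>v. v \<noteq> e_v \<Longrightarrow> v \<noteq> ix_v \<Longrightarrow> nv s' v = nv s v" "nv s' e_v = Suc e"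
    and same: "rv s' w_v = rv s w_v" "rv s' W_v = rv s W_v" "low s' = low s"
    and ra: "ra s' = (ra s)(VA := (ra s VA)(cell i j (na b LS e) := candidate (tab s0) i j (r, e)))"
    and na: "na s' = (na s)(RT := (na s RT)(cell i j (na b LS e) := Suc r), CH := (na s CH)(cell i j (na b LS e) := e))"
  shows "try_inv s0 i j r (Suc e) s'"
proof -
  note inv = assms(1)[unfolded try_inv_def interval_inv_def]
  have "ctx s'"
    using inv unfolding ctx_def by (simp add: nv na)
  moreover have "best_so_far s0 i j (tried i r (Suc e)) s'"
  proof -
    have eq: "val (tab s') i j = (val (tab s) i j)(na b LS e := candidate (tab s0) i j (r, e))"
      "rt (tab s') i j = (rt (tab s) i j)(na b LS e := Suc r)"
      "ch (tab s') i j = (ch (tab s) i j)(na b LS e := e)"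
      by (auto simp: fun_eq_iff ra na cell_same_iff)
    have "best_of K (na b LS) (tried i r e) (feasible (tab s0) i j) (candidate (tab s0) i j)
     (val (tab s) i j) (rt (tab s) i j) (ch (tab s) i j)"
      using inv by (simp add: best_so_far_def)
    from best_of_update[OF this, of "(r, e)"] show ?thesis
      using assms(4-6) unfolding best_so_far_def tried_simps(1) eq by simp
  qed
  moreover have "agree_off i j s0 s'"
  proof -
    have "cell i' j' x \<noteq> cell i j (na b LS e)" if "(i', j') \<noteq> (i, j)" "j' \<le> n" "x < K" for i' j' x
      using cell_eq_iff[OF that(2) assms(2) that(3) codes_less(1)[OF assms(3)], of i' i] that(1) by auto
    then show ?thesis
      using inv by (simp add: agree_off_def ra na)
  qed
  ultimately show ?thesis
    using inv unfolding try_inv_def interval_inv_def by (simp add: nv same ra)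
qed

lemma try_entry_correct:
  assumes "try_inv s0 i j r e s" "i \<le> r" "r < j" "j \<le> n" "e < E"
  shows "wp Z try_entry (try_inv s0 i j r (Suc e)) s"
proof -
  note inv = assms(1)[unfolded try_inv_def interval_inv_def ctx_def]
  let ?x = "cell i j (na b LS e)"
  define vl where "vl = ra s VA (cell i r (na b LL e))"
  define vr where "vr = ra s VA (cell (Suc r) j (na b LR e))"
  define cand where "cand = candidate (tab s0) i j (r, e)"
  \<comment> \<open>Both subintervals differ from \<open>i, j\<close>, so their cells are still
    those of \<open>s0\<close>.\<close>
  have sub: "vl = ra s0 VA (cell i r (na b LL e))" "vr = ra s0 VA (cell (Suc r) j (na b LR e))"
    using inv assms(2-4) codes_less[OF assms(5)] by (simp_all add: agree_off_def vl_def vr_def)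
  have feas: "feasible (tab s0) i j (r, e) \<longleftrightarrow> 0 < vl \<and> 0 < vr"
    by (simp add: feasible_def sub)
  have cand: "vl + vr + rv s W_v * real (na b LC e) = cand"
    using inv listed_b(3)[OF assms(5)] by (simp add: cand_def candidate_def sub)
  \<comment> \<open>The surcharge makes both parts positive and the charge of the root is
    nonnegative, so a candidate is never mistaken for an empty cell.\<close>
  have cand_pos: "0 < cand" if "0 < vl" "0 < vr"
  proof -
    have "0 \<le> rv s W_v"
      using inv interval_weight_nonneg[of i r] interval_weight_nonneg[of "Suc r" j] p_nonneg[of "Suc r"] assms(2-4)
      by simp
    then have "0 \<le> rv s W_v * real (na b LC e)" by simp
    then show ?thesis using that unfolding cand[symmetric] by linarith
  qed
  define s1 where "s1 = s\<lparr>rv := (rv s)(vl_v := vl, vr_v := vr), nv := (nv s)(e_v := Suc e)\<rparr>"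
  define s2 where "s2 = s\<lparr>rv := (rv s)(vl_v := vl, vr_v := vr, cand_v := cand),
    nv := (nv s)(ix_v := ?x, e_v := Suc e)\<rparr>"
  define s3 where "s3 = s\<lparr>rv := (rv s)(vl_v := vl, vr_v := vr, cand_v := cand),
    ra := (ra s)(VA := (ra s VA)(?x := cand)),
    na := (na s)(RT := (na s RT)(?x := Suc r), CH := (na s CH)(?x := e)),
    nv := (nv s)(ix_v := ?x, e_v := Suc e)\<rparr>"
  have nvs: "nv s n1_v = n1" "nv s P_v = K" "nv s i_v = i" "nv s j_v = j" "nv s r_v = r" "nv s e_v = e"
    "na s LS = na b LS" "na s LL = na b LL" "na s LR = na b LR" "na s LC = na b LC"
    using inv by simp_all
  have "wp Z try_entry Q s \<longleftrightarrow>
    Q (if 0 < vl \<and> 0 < vr then if 0 < ra s VA ?x \<and> \<not> cand < ra s VA ?x then s2 else s3 else s1)" for Q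
    unfolding try_entry_def record_choice_def s1_def s2_def s3_def
    by (simp add: nvs exp_simps vl_def[symmetric] vr_def[symmetric] cand)
  moreover have "try_inv s0 i j r (Suc e) s1" if "\<not> (0 < vl \<and> 0 < vr)"
    by (rule try_inv_skip[OF assms(1)]) (use that feas in \<open>auto simp: s1_def\<close>)
  moreover have "try_inv s0 i j r (Suc e) s2" if "0 < ra s VA ?x" "\<not> cand < ra s VA ?x"
    by (rule try_inv_skip[OF assms(1)]) (use that in \<open>auto simp: s2_def cand_def\<close>)
  moreover have "try_inv s0 i j r (Suc e) s3" if "0 < vl" "0 < vr" "\<not> (0 < ra s VA ?x \<and> \<not> cand < ra s VA ?x)"
    by (rule try_inv_record[OF assms(1,4,5)])
      (use that feas cand_pos[OF that(1,2)] in \<open>auto simp: s3_def cand_def\<close>)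
  ultimately show ?thesis by simp
qed

lemma try_root_correct:
  assumes "interval_inv s0 i j r 0 s" "i \<le> r" "r < j" "j \<le> n"
    and XW: "\<And>i' j'. i' \<le> j' \<Longrightarrow> j' \<le> n \<Longrightarrow> i' = i \<and> j' < j \<or> i < i' \<Longrightarrow>
      ra s0 XW (pair i' j') = interval_weight p q i' j'"
  shows "runs (8 * n) try_root s (root_time * 4 ^ k) (interval_inv s0 i j (Suc r) 0)"
  unfolding try_root_def root_time_def
proof (rule runs_wp_Seq)
  note inv = assms(1)[unfolded interval_inv_def ctx_def]
  let ?Q = "wp (8 * n) (NAsg r_v (suc (NV r_v))) (interval_inv s0 i j (Suc r) 0)"
  define W where "W = interval_weight p q i r + p (Suc r) + interval_weight p q (Suc r) j"
  let ?s = "s\<lparr>rv := (rv s)(W_v := W), nv := (nv s)(e_v := 0)\<rparr>"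
  have "try_inv s0 i j r 0 ?s"
    using assms(1) unfolding try_inv_def interval_inv_def
    by (simp add: W_def ctx_def agree_off_def best_so_far_def tab_def)
  then have "runs (8 * n) (WhileNe (NV e_v) (NV len_v) try_entry) ?s
    (2 * (nsize (NV len_v) + time try_entry + 3) * (4 ^ k * 1)) (try_inv s0 i j r E)"
  proof (rule runs_for_bound[where I = "try_inv s0 i j r" and ?i0.0 = 0])
    show "runs (8 * n) try_entry s' (time try_entry * 1) (try_inv s0 i j r (Suc e))"
      if "try_inv s0 i j r e s'" "e < E" for e s'
      using runs_wp[OF try_entry_correct[OF that(1) assms(2-4) that(2)]] by simp
  qed (use listed_b in \<open>auto simp: try_inv_def interval_inv_def ctx_def\<close>)
  then have "runs (8 * n) (WhileNe (NV e_v) (NV len_v) try_entry) ?s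
    (2 * (1 + time try_entry + 3) * 4 ^ k) ?Q"
  proof (rule runs_conseq)
    fix s' assume "try_inv s0 i j r E s'"
    then show "?Q s'"
      using assms(2) unfolding try_inv_def interval_inv_def
      by (simp add: ctx_def agree_off_def best_so_far_def tab_def tried_simps)
  qed simp
  then have "runs (8 * n) (WhileNe (NV e_v) (NV len_v) try_entry ;; NAsg r_v (suc (NV r_v))) ?s
      ((2 * (1 + time try_entry + 3) + time (NAsg r_v (suc (NV r_v)))) * 4 ^ k) (interval_inv s0 i j (Suc r) 0)"
    by (rule runs_Seq_wp) simp
  moreover have "input (Suc (Suc (h + h)) + r) = p (Suc r)" "Suc (Suc (h + h)) + r < 8 * n"
    using input_eqs(5)[of "Suc r"] assms(3,4) memory_bounds(1) by simp_all
  moreover have "ra s XW (pair i r) + p (Suc r) + ra s XW (pair (Suc r) j) = W"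
    using XW[of i r] XW[of "Suc r" j] assms(2-4) inv by (simp add: W_def)
  ultimately show "wp (8 * n) root_init
     (\<lambda>s'. runs (8 * n) (WhileNe (NV e_v) (NV len_v) try_entry ;; NAsg r_v (suc (NV r_v))) s'
      ((2 * (1 + time try_entry + 3) + time (NAsg r_v (suc (NV r_v)))) * 4 ^ k) (interval_inv s0 i j (Suc r) 0)) s"
    using inv by (simp add: root_init_def exp_simps)
qed simp

text \<open>Being solved depends only on the cells of subintervals, so it survives writes
  elsewhere.\<close>

lemma solved_agree:
  assumes "solved (tab s) i j" "i \<le> j" "j \<le> n"
    and "\<And>i' j' x. i \<le> i' \<Longrightarrow> i' \<le> j' \<Longrightarrow> j' \<le> j \<Longrightarrow> x < K \<Longrightarrow>
      ra s' VA (cell i' j' x) = ra s VA (cell i' j' x) \<and> na s' RT (cell i' j' x) = na s RT (cell i' j' x) \<and>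
      na s' CH (cell i' j' x) = na s CH (cell i' j' x)"
  shows "solved (tab s') i j"
proof (cases "i = j")
  case True
  have "0 < K" by (simp add: K_def)
  then show ?thesis using True assms(1) assms(4)[of i j] by (simp add: solved_def)
next
  case False
  then have best: "best_of K (na b LS) ({i..<j} \<times> {..<E}) (feasible (tab s) i j) (candidate (tab s) i j)
        (val (tab s) i j) (rt (tab s) i j) (ch (tab s) i j)"
    using assms(1) by (simp add: solved_def)
  have "best_of K (na b LS) ({i..<j} \<times> {..<E}) (feasible (tab s') i j) (candidate (tab s') i j)
        (val (tab s') i j) (rt (tab s') i j) (ch (tab s') i j)"
  proof (rule best_of_cong[OF best])
    fix x assume "x \<in> {i..<j} \<times> {..<E}"
    then obtain r e where x: "x = (r, e)" "i \<le> r" "r < j" "e < E" by auto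
    show "feasible (tab s') i j x = feasible (tab s) i j x" "candidate (tab s') i j x = candidate (tab s) i j x"
      using assms(4)[of i r "na b LL e"] assms(4)[of "Suc r" j "na b LR e"] x codes_less[OF x(4)]
      by (simp_all add: feasible_def candidate_def)
    show "na b LS (snd x) < K" using codes_less(1)[OF x(4)] x(1) by simp
  qed (use assms(2,4) in simp_all)
  then show ?thesis using False by (simp add: solved_def)
qed

text \<open>Intervals are processed by decreasing left end, then by increasing right end.\<close>

definition filled :: "nat \<Rightarrow> nat \<Rightarrow> store \<Rightarrow> bool" where
  "filled i j s \<longleftrightarrow>
     (\<forall>i' j'. i' \<le> j' \<longrightarrow> j' \<le> n \<longrightarrow> i < i' \<or> i' = i \<and> j' < j \<longrightarrow>
        solved (tab s) i' j' \<and> ra s XW (pair i' j') = interval_weight p q i' j') \<and>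
     (\<forall>i' j' x. j' \<le> n \<longrightarrow> (i' < i \<or> i' = i \<and> j \<le> j') \<longrightarrow> x < K \<longrightarrow>
        ra s VA (cell i' j' x) = 0 \<and> na s RT (cell i' j' x) = 0)"

lemma filledD:
  assumes "filled i j s" "i' \<le> j'" "j' \<le> n" "i < i' \<or> i' = i \<and> j' < j"
  shows "solved (tab s) i' j'" "ra s XW (pair i' j') = interval_weight p q i' j'"
  using assms unfolding filled_def by blast+

lemma filled_zero:
  assumes "filled i j s" "j' \<le> n" "i' < i \<or> i' = i \<and> j \<le> j'" "x < K"
  shows "ra s VA (cell i' j' x) = 0" "na s RT (cell i' j' x) = 0"
  using assms(1)[unfolded filled_def, THEN conjunct2, rule_format, OF assms(2-4)] by simp_all

text \<open>No interval processed earlier contains \<open>i, j\<close>, so writing the cells of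
  \<open>i, j\<close> leaves it solved.\<close>

lemma filled_step:
  assumes "filled i j s0" "i \<le> j" "j \<le> n" "agree_off i j s0 s" "solved (tab s) i j"
    "ra s XW = (ra s0 XW)(pair i j := interval_weight p q i j)"
  shows "filled i (Suc j) s"
  unfolding filled_def
proof (intro conjI allI impI)
  fix i' j' assume ij: "i' \<le> j'" "j' \<le> n" "i < i' \<or> i' = i \<and> j' < Suc j"
  show "solved (tab s) i' j'"
  proof (cases "i' = i \<and> j' = j")
    case False
    then have d: "i < i' \<or> i' = i \<and> j' < j" using ij(3) by auto
    from filledD(1)[OF assms(1) ij(1,2) d] show ?thesis
    proof (rule solved_agree[OF _ ij(1,2)])
      fix i'' j'' x assume "i' \<le> i''" "i'' \<le> j''" "j'' \<le> j'" "x < K"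
      moreover from this have "(i'', j'') \<noteq> (i, j)" using d by auto
      ultimately show "ra s VA (cell i'' j'' x) = ra s0 VA (cell i'' j'' x) \<and>
        na s RT (cell i'' j'' x) = na s0 RT (cell i'' j'' x) \<and> na s CH (cell i'' j'' x) = na s0 CH (cell i'' j'' x)"
        using assms(4) ij(2) unfolding agree_off_def by simp
    qed
  qed (use assms(5) in simp)
  show "ra s XW (pair i' j') = interval_weight p q i' j'"
  proof (cases "i' = i \<and> j' = j")
    case False
    then have "i < i' \<or> i' = i \<and> j' < j" using ij(3) by auto
    from filledD(2)[OF assms(1) ij(1,2) this]
    have "ra s0 XW (pair i' j') = interval_weight p q i' j'" .
    moreover have "pair i' j' \<noteq> pair i j" using False pair_eq_iff[OF ij(2) assms(3)] by simp
    ultimately show ?thesis by (simp add: assms(6))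
  qed (simp add: assms(6))
next
  fix i' j' x assume ij: "j' \<le> n" "i' < i \<or> i' = i \<and> Suc j \<le> j'" "x < K"
  then have "(i', j') \<noteq> (i, j)" "i' < i \<or> i' = i \<and> j \<le> j'" by auto
  then show "ra s VA (cell i' j' x) = 0" "na s RT (cell i' j' x) = 0"
    using assms(4) filled_zero[OF assms(1) ij(1) _ ij(3)] ij unfolding agree_off_def by simp_all
qed

text \<open>\<open>w_v\<close> is the plain weight even for \<open>i = j\<close>, where
  \<open>interval_weight\<close> counts the gap twice; so it can be extended to the next right
  end.\<close>

definition row_inv :: "nat \<Rightarrow> nat \<Rightarrow> store \<Rightarrow> bool" where
  "row_inv i j s \<longleftrightarrow> ctx s \<and> low s = input \<and> nv s d_v = n - i \<and> nv s i_v = i \<and> nv s j_v = j \<and>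
     rv s w_v = (\<Sum>x\<in>{i<..j}. p x) + (\<Sum>g\<in>{i..j}. q g) \<and> filled i (Suc j) s"

lemma solve_interval_correct:
  assumes "row_inv i j s" "i \<le> j" "j < n"
  shows "runs (8 * n) solve_interval s (interval_time * (n * 4 ^ k)) (row_inv i (Suc j))"
  unfolding solve_interval_def interval_time_def
proof (rule runs_wp_Seq)
  note inv = assms(1)[unfolded row_inv_def ctx_def]
  let ?j = "Suc j"
  define w where "w = (\<Sum>x\<in>{i<..?j}. p x) + (\<Sum>g\<in>{i..?j}. q g)"
  have "{i<..?j} = insert ?j {i<..j}" "{i..?j} = insert ?j {i..j}" using assms(2) by auto
  then have w: "rv s w_v + (p ?j + q ?j) = w" using inv by (simp add: w_def)
  have w': "interval_weight p q i ?j = w" using assms(2) by (simp add: interval_weight_def w_def)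
  define s0 where "s0 = s\<lparr>rv := (rv s)(w_v := w), ra := (ra s)(XW := (ra s XW)(pair i ?j := w)),
    nv := (nv s)(j_v := ?j, r_v := i)\<rparr>"
  have filled: "filled i ?j s" using inv by blast
  have XW: "ra s0 XW (pair i' j') = interval_weight p q i' j'"
    if "i' \<le> j'" "j' \<le> n" "i' = i \<and> j' < ?j \<or> i < i'" for i' j'
  proof -
    have "pair i' j' \<noteq> pair i ?j" using that pair_eq_iff[of j' ?j] assms(3) by auto
    moreover have "ra s XW (pair i' j') = interval_weight p q i' j'"
      using filledD(2)[OF filled that(1,2)] that(3) by blast
    ultimately show ?thesis by (simp add: s0_def)
  qed
  have zero: "ra s0 VA (cell i ?j x) = 0" if "x < K" for x
    using filled_zero(1)[OF filled _ _ that, of ?j i] assms(3) by (simp add: s0_def)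
  have ctx0: "ctx s0" "low s0 = input"
    using inv by (simp_all add: s0_def ctx_def)
  have "best_so_far s0 i ?j {} s0"
    unfolding best_so_far_def by (rule best_of_empty) (simp add: zero)
  then have "interval_inv s0 i ?j i 0 s0"
    using inv ctx0 unfolding interval_inv_def by (simp add: s0_def agree_off_def tried_simps)
  then have "runs (8 * n) (WhileNe (NV r_v) (NV j_v) try_root) s0
    (2 * (nsize (NV j_v) + root_time + 3) * (n * 4 ^ k)) (\<lambda>s'. interval_inv s0 i ?j ?j 0 s')"
  proof (rule runs_for_bound[where I = "\<lambda>r. interval_inv s0 i ?j r 0" and ?i0.0 = i])
    show "runs (8 * n) try_root s' (root_time * 4 ^ k) (interval_inv s0 i ?j (Suc r) 0)"
      if "interval_inv s0 i ?j r 0 s'" "i \<le> r" "r < ?j" for r s'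
      using try_root_correct[OF that _ XW] assms(3) by simp
  qed (use assms(2,3) n_pos in \<open>auto simp: interval_inv_def\<close>)
  then have "runs (8 * n) (WhileNe (NV r_v) (NV j_v) try_root) s0
    (2 * (1 + root_time + 3) * (n * 4 ^ k)) (row_inv i ?j)"
  proof (rule runs_conseq)
    fix s' assume inv': "interval_inv s0 i ?j ?j 0 s'"
    note inv' = inv'[unfolded interval_inv_def]
    have off: "agree_off i ?j s0 s'" using inv' by blast
    then have off': "agree_off i ?j s s'" by (simp add: agree_off_def s0_def)
    \<comment> \<open>The reference store \<open>s0\<close> is exchanged for the final store, which
      has the same cells on all proper subintervals.\<close>
    have "best_of K (na b LS) ({i..<?j} \<times> {..<E}) (feasible (tab s') i ?j) (candidate (tab s') i ?j)
        (val (tab s') i ?j) (rt (tab s') i ?j) (ch (tab s') i ?j)"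
    proof (rule best_of_cong)
      show "best_of K (na b LS) ({i..<?j} \<times> {..<E}) (feasible (tab s0) i ?j) (candidate (tab s0) i ?j)
        (val (tab s') i ?j) (rt (tab s') i ?j) (ch (tab s') i ?j)"
        using inv' assms(2) unfolding best_so_far_def tried_simps(4) by simp
      fix x assume "x \<in> {i..<?j} \<times> {..<E}"
      then obtain r e where x: "x = (r, e)" "i \<le> r" "r < ?j" "e < E" by auto
      have "ra s' VA (cell i r (na b LL e)) = ra s0 VA (cell i r (na b LL e))"
        "ra s' VA (cell (Suc r) ?j (na b LR e)) = ra s0 VA (cell (Suc r) ?j (na b LR e))"
        using off x codes_less[OF x(4)] assms(3) unfolding agree_off_def by auto
      then show "feasible (tab s') i ?j x = feasible (tab s0) i ?j x"
        "candidate (tab s') i ?j x = candidate (tab s0) i ?j x"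
        using x(1) by (simp_all add: feasible_def candidate_def)
      show "na b LS (snd x) < K" using codes_less(1)[OF x(4)] x(1) by simp
    qed simp_all
    then have "solved (tab s') i ?j" using assms(2) by (simp add: solved_def)
    moreover have "ra s' XW = (ra s XW)(pair i ?j := interval_weight p q i ?j)"
      using inv' by (simp add: s0_def w')
    ultimately have "filled i (Suc ?j) s'"
      using filled_step[OF filled _ _ off'] assms(2,3) by simp
    then show "row_inv i ?j s'"
      using inv' inv unfolding row_inv_def by (simp add: s0_def w_def)
  qed simp
  moreover have "input (Suc (h + h) + ?j) = p ?j" "input (Suc (Suc (h + h)) + (n + ?j)) = q ?j"
    using input_eqs(5,6)[of ?j] assms(3) by simp_all
  moreover have "Suc (h + h) + ?j < 8 * n" "Suc (Suc (h + h)) + (n + ?j) < 8 * n"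
    using memory_bounds(1) assms(3) by linarith+
  ultimately show "wp (8 * n) interval_init
     (\<lambda>s'. runs (8 * n) (WhileNe (NV r_v) (NV j_v) try_root) s'
        (2 * (1 + root_time + 3) * (n * 4 ^ k)) (row_inv i ?j)) s"
    using inv w[symmetric] unfolding s0_def by (simp add: interval_init_def exp_simps)
qed (use n_pos in simp)

end

definition row_time :: nat where
  "row_time = time row_init +
    (2 * (1 + interval_time + 3) + time (NAsg d_v (suc (NV d_v))))"

definition solve_time :: nat where
  "solve_time = time (NAsg d_v (NC 0)) + 4 * (1 + row_time + 3)"

definition search_time :: nat where
  "search_time = 2 * (time descend + 5)"

definition key_time :: nat where
  "key_time = time key_init + (search_time + time emit_key)"

definition output_time :: nat where
  "output_time = time (NAsg r_v (NC 0) ;; NAsg cnt_v (NV k_v)) +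
     (2 * (1 + key_time + 3) +
      time output_root)"

text \<open>A key labels only one subtree, so its child pointers are determined by the tree.\<close>

lemma subtree_at_eq:
  "bst i j T \<Longrightarrow> S \<in> subtrees T \<Longrightarrow> root_node S = Key y \<Longrightarrow> subtree_at T (Key y) = S"
proof (induction T arbitrary: i j)
  case (Internal l x r)
  then have x: "bst i (x - 1) l" "bst x j r" "0 < x" by auto
  from Internal.prems(2,3) consider "S = Internal l x r" "x = y" | "S \<in> subtrees l" | "S \<in> subtrees r"
    by auto
  then show ?case
  proof cases
    case 1
    then show ?thesis using subtree_at_Key[OF Internal.prems(1), of y] by simp
  next
    case 2
    then have "y < x" using bst_subtree_Key[OF x(1) 2 Internal.prems(3)] x(3) by linarith
    then show ?thesis
      using subtree_at_Key[OF Internal.prems(1), of y] Internal.IH(1)[OF x(1) 2 Internal.prems(3)] by simp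
  next
    case 3
    then have "x < y" using bst_subtree_Key[OF x(2) 3 Internal.prems(3)] by simp
    then show ?thesis
      using subtree_at_Key[OF Internal.prems(1), of y] Internal.IH(2)[OF x(2) 3 Internal.prems(3)] by simp
  qed
qed simp

context hmm_listed
begin

text \<open>Rows are counted from the right: after \<open>d\<close> rows, all intervals with left
  end at least \<open>n + 1 - d\<close> are done.\<close>

definition rows_inv :: "nat \<Rightarrow> store \<Rightarrow> bool" where
  "rows_inv d s \<longleftrightarrow> ctx s \<and> low s = input \<and> nv s d_v = d \<and> filled (n + 1 - d) (Suc n) s"

lemma solve_row_correct:
  assumes "rows_inv d s" "d < n + 1"
  shows "runs (8 * n) solve_row s (row_time * (n * (n * 4 ^ k))) (rows_inv (Suc d))"
  unfolding solve_row_def row_time_def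
proof (rule runs_wp_Seq)
  note inv = assms(1)[unfolded rows_inv_def ctx_def]
  let ?Q = "wp (8 * n) (NAsg d_v (suc (NV d_v))) (rows_inv (Suc d))"
  define i where "i = n - d"
  have i: "i \<le> n" "n + 1 - d = Suc i" "n - i = d" using assms(2) by (simp_all add: i_def)
  define s0 where "s0 = s\<lparr>rv := (rv s)(w_v := q i),
    ra := (ra s)(XW := (ra s XW)(pair i i := q i + q i), VA := (ra s VA)(cell i i 0 := 1)),
    nv := (nv s)(i_v := i, j_v := i)\<rparr>"
  have filled: "filled (Suc i) (Suc n) s" using inv i(2) by simp
  \<comment> \<open>Having finished row \<open>i + 1\<close> is the same as starting row
    \<open>i\<close>: no interval lies between the two in the processing order.\<close>
  have filled_i: "filled i i s"
    unfolding filled_def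
  proof (intro conjI allI impI)
    fix i' j' assume ij: "i' \<le> j'" "j' \<le> n" "i < i' \<or> i' = i \<and> j' < i"
    then have "Suc i < i' \<or> i' = Suc i \<and> j' < Suc n" by auto
    from filledD[OF filled ij(1,2) this]
    show "solved (tab s) i' j'" "ra s XW (pair i' j') = interval_weight p q i' j'" .
  next
    fix i' j' x assume ij: "j' \<le> n" "i' < i \<or> i' = i \<and> i \<le> j'" "x < K"
    then have "i' < Suc i \<or> i' = Suc i \<and> Suc n \<le> j'" by auto
    from filled_zero[OF filled ij(1) this ij(3)]
    show "ra s VA (cell i' j' x) = 0" "na s RT (cell i' j' x) = 0" .
  qed
  have K0: "0 < K" by (simp add: K_def)
  have off: "agree_off i i s s0"
  proof -
    have "cell i' j' x \<noteq> cell i i 0" if "(i', j') \<noteq> (i, i)" "j' \<le> n" "x < K" for i' j' x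
      using cell_eq_iff[OF that(2) i(1) that(3) K0, of i' i] that(1) by auto
    then show ?thesis by (simp add: agree_off_def s0_def)
  qed
  have "solved (tab s0) i i"
    using filled_zero[OF filled_i i(1), of i] by (simp add: solved_def s0_def cell_same_iff)
  moreover have "ra s0 XW = (ra s XW)(pair i i := interval_weight p q i i)"
    by (simp add: s0_def interval_weight_def)
  ultimately have "filled i (Suc i) s0"
    using filled_step[OF filled_i _ i(1) off] by simp
  then have "row_inv i i s0"
    using inv i(3) unfolding row_inv_def by (simp add: s0_def ctx_def)
  then have "runs (8 * n) (WhileNe (NV j_v) (NV n_v) solve_interval) s0
    (2 * (nsize (NV n_v) + interval_time + 3) * (n * (n * 4 ^ k))) (row_inv i n)"
  proof (rule runs_for_bound[where I = "row_inv i" and ?i0.0 = i])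
    show "runs (8 * n) solve_interval s' (interval_time * (n * 4 ^ k)) (row_inv i (Suc j))"
      if "row_inv i j s'" "i \<le> j" "j < n" for j s'
      by (rule solve_interval_correct[OF that])
  qed (use i(1) n_pos in \<open>auto simp: row_inv_def ctx_def\<close>)
  then have "runs (8 * n) (WhileNe (NV j_v) (NV n_v) solve_interval) s0
    (2 * (1 + interval_time + 3) * (n * (n * 4 ^ k))) ?Q"
  proof (rule runs_conseq)
    fix s' assume inv': "row_inv i n s'"
    have "filled i (Suc n) (s'\<lparr>nv := (nv s')(d_v := Suc d)\<rparr>)"
      using inv' by (simp add: row_inv_def filled_def tab_def)
    then show "?Q s'"
      using inv' i unfolding row_inv_def rows_inv_def by (simp add: ctx_def i_def[symmetric])
  qed simp
  then have "runs (8 * n) (WhileNe (NV j_v) (NV n_v) solve_interval ;; NAsg d_v (suc (NV d_v))) s0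
    ((2 * (1 + interval_time + 3) + time (NAsg d_v (suc (NV d_v)))) * (n * (n * 4 ^ k))) (rows_inv (Suc d))"
    by (rule runs_Seq_wp) (use n_pos in simp)
  moreover have "input (Suc (Suc (h + h + (n + i)))) = q i" "Suc (Suc (h + h + (n + i))) < 8 * n"
    using input_eqs(6)[OF i(1)] memory_bounds(1) i(1) by simp_all
  moreover have "n - d = i" "d \<le> n" using assms(2) by (simp_all add: i_def)
  ultimately show "wp (8 * n) row_init
    (\<lambda>s'. runs (8 * n) (WhileNe (NV j_v) (NV n_v) solve_interval ;; NAsg d_v (suc (NV d_v))) s'
      ((2 * (1 + interval_time + 3) + time (NAsg d_v (suc (NV d_v)))) * (n * (n * 4 ^ k))) (rows_inv (Suc d))) s"
    using inv unfolding s0_def by (simp add: row_init_def exp_simps add.assoc)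
qed (use n_pos in simp)

lemma ctx_b: "ctx b"
  using b by (simp add: list_inv_def vars_inv_def ctx_def n1_def E_def K_def)

lemma solve_all_correct:
  "runs (8 * n) solve_all b (solve_time * (n ^ 3 * 4 ^ k)) (\<lambda>s. ctx s \<and> filled 0 (Suc n) s)"
proof -
  let ?s = "b\<lparr>nv := (nv b)(d_v := 0)\<rparr>"
  have "ra b = (\<lambda>_ _. 0)" "na b RT = (\<lambda>_. 0)" "low b = input"
    using b by (simp_all add: list_inv_def vars_inv_def)
  then have "rows_inv 0 ?s"
    using ctx_b by (simp add: rows_inv_def filled_def ctx_def)
  \<comment> \<open>There are \<open>n + 1\<close> rows, at most \<open>2 * n\<close>; this is where
    the factor 4 in \<open>solve_time\<close> comes from.\<close>
  then have "runs (8 * n) (WhileNe (NV d_v) (NV n1_v) solve_row) ?s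
    (2 * (nsize (NV n1_v) + row_time + 3) * ((2 * n) * (n * (n * 4 ^ k)))) (rows_inv n1)"
  proof (rule runs_for_bound[where I = rows_inv and ?i0.0 = 0])
    show "runs (8 * n) solve_row s' (row_time * (n * (n * 4 ^ k))) (rows_inv (Suc d))"
      if "rows_inv d s'" "d < n1" for d s'
      using solve_row_correct[OF that(1)] that(2) by (simp add: n1_def)
  qed (use n_pos in \<open>auto simp: rows_inv_def ctx_def n1_def\<close>)
  then have "runs (8 * n) (WhileNe (NV d_v) (NV n1_v) solve_row) ?s
    (4 * (1 + row_time + 3) * (n ^ 3 * 4 ^ k)) (\<lambda>s. ctx s \<and> filled 0 (Suc n) s)"
    by (rule runs_conseq) (simp_all add: rows_inv_def n1_def power3_eq_cube algebra_simps)
  then show ?thesis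
    unfolding solve_all_def solve_time_def by (intro runs_wp_Seq) (use n_pos in simp_all)
qed

lemma wp_descend:
  assumes nvs: "nv s n1_v = n1" "nv s P_v = K" "nv s r_v = r" "nv s rt_v = y" "nv s e_v = e"
    "nv s i_v = i" "nv s j_v = j" "na s = na s0" "na s0 LL = na b LL" "na s0 LR = na b LR"
  shows "r < y \<Longrightarrow> wp Z descend Q s =
      Q (s\<lparr>nv := (nv s)(j_v := y - 1, S_v := na b LL e, ix_v := cell i (y - 1) (na b LL e),
        rt_v := na s0 RT (cell i (y - 1) (na b LL e)), e_v := na s0 CH (cell i (y - 1) (na b LL e)))\<rparr>)"
      (is "_ \<Longrightarrow> ?L")
    and "\<not> r < y \<Longrightarrow> wp Z descend Q s =
      Q (s\<lparr>nv := (nv s)(i_v := y, S_v := na b LR e, ix_v := cell y j (na b LR e),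
        rt_v := na s0 RT (cell y j (na b LR e)), e_v := na s0 CH (cell y j (na b LR e)))\<rparr>)"
      (is "_ \<Longrightarrow> ?R")
proof -
  assume T: "r < y"
  then have "1 \<le> y" by simp
  then show ?L
    unfolding descend_def look_up_def by (simp add: nvs exp_simps T)
next
  assume "\<not> r < y"
  then show ?R
    unfolding descend_def look_up_def by (simp add: nvs exp_simps)
qed

end

section \<open>Walking down the recorded tree and writing the output\<close>

locale hmm_solved = hmm_listed +
  fixes s0 :: store and T :: bintree and \<alpha> :: "nat \<Rightarrow> nat"
  assumes s0: "ctx s0" "filled 0 (Suc n) s0"
    and T: "bst 0 n T" "follows (tab s0) \<alpha> 0 n (K - 2) T"
begin

definition address :: "nat \<Rightarrow> nat" where
  "address x = (if \<alpha> x = 0 then k + card {y \<in> {1..x}. \<alpha> y = 0} else \<alpha> x)"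

lemma solved_s0: "i \<le> j \<Longrightarrow> j \<le> n \<Longrightarrow> solved (tab s0) i j"
  using filledD(1)[OF s0(2), of i j] by (cases "i = 0") auto

lemma na_s0: "na s0 LS = na b LS" "na s0 LL = na b LL" "na s0 LR = na b LR" "na s0 LA = na b LA"
  "na s0 LC = na b LC"
  using s0(1) by (simp_all add: ctx_def)

definition frame :: "store \<Rightarrow> bool" where
  "frame s \<longleftrightarrow> ctx s \<and> na s = na s0"

text \<open>The walk stands at a subtree \<open>S\<close> on an interval that contains key
  \<open>r\<close>, and \<open>x\<close> is the code of its address set. The length \<open>d\<close>
  is the measure; \<open>cnt\<close> and \<open>lo\<close> state that the counter and low memory are
  untouched.\<close>

definition search_inv :: "nat \<Rightarrow> nat \<Rightarrow> (nat \<Rightarrow> real) \<Rightarrow> nat \<Rightarrow> store \<Rightarrow> bool" where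
  "search_inv r cnt lo d s \<longleftrightarrow> frame s \<and> nv s r_v = r \<and> nv s cnt_v = cnt \<and> low s = lo \<and>
     (\<exists>i j x S. S \<in> subtrees T \<and> bst i j S \<and> follows (tab s0) \<alpha> i j x S \<and> i < r \<and> r \<le> j \<and> j \<le> n \<and>
        d = j - i \<and> nv s i_v = i \<and> nv s j_v = j \<and>
        nv s rt_v = na s0 RT (cell i j x) \<and> nv s e_v = na s0 CH (cell i j x))"

lemma descend_correct:
  assumes "search_inv r cnt lo d s" "nv s r_v \<noteq> nv s rt_v"
  shows "wp Z descend (\<lambda>s'. \<exists>d'<d. search_inv r cnt lo d' s') s"
proof -
  note inv = assms(1)[unfolded search_inv_def frame_def ctx_def]
  obtain i j x S where S: "S \<in> subtrees T" "bst i j S" "follows (tab s0) \<alpha> i j x S" "i < r" "r \<le> j" "j \<le> n"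
    "d = j - i" "nv s i_v = i" "nv s j_v = j" "nv s rt_v = na s0 RT (cell i j x)" "nv s e_v = na s0 CH (cell i j x)"
    using inv by blast
  then obtain l y rr where node: "S = Internal l y rr" by (cases S) auto
  define e where "e = na s0 CH (cell i j x)"
  have y: "i < y" "y \<le> j" "bst i (y - 1) l" "bst y j rr" "na s0 RT (cell i j x) = y"
    "follows (tab s0) \<alpha> i (y - 1) (na b LL e) l" "follows (tab s0) \<alpha> y j (na b LR e) rr"
    using S(2,3) by (simp_all add: node e_def)
  have sub: "l \<in> subtrees T" "rr \<in> subtrees T"
    using subtrees_trans[OF S(1)] subtrees_refl by (auto simp: node)
  have ne: "r \<noteq> y" using assms(2) inv S(10) y(5) by simp
  have nvs: "nv s n1_v = n1" "nv s P_v = K" "nv s r_v = r" "nv s rt_v = y" "nv s e_v = e"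
    "nv s i_v = i" "nv s j_v = j" "na s = na s0" "na s0 LL = na b LL" "na s0 LR = na b LR"
    using inv S y(5) by (simp_all add: e_def na_s0)
  define i' j' x' where "i' = (if r < y then i else y)" and "j' = (if r < y then y - 1 else j)"
    and "x' = (if r < y then na b LL e else na b LR e)"
  define s' where "s' = s\<lparr>nv := (nv s)(i_v := i', j_v := j', S_v := x', ix_v := cell i' j' x',
    rt_v := na s0 RT (cell i' j' x'), e_v := na s0 CH (cell i' j' x'))\<rparr>"
  have ctx': "frame s'" using inv by (simp add: frame_def ctx_def s'_def na_s0)
  have "search_inv r cnt lo (j' - i') s'"
    unfolding search_inv_def
  proof (intro conjI exI)
    show "(if r < y then l else rr) \<in> subtrees T" using sub by simp
    show "bst i' j' (if r < y then l else rr)" using y by (simp add: i'_def j'_def)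
    show "follows (tab s0) \<alpha> i' j' x' (if r < y then l else rr)"
      using y by (simp add: i'_def j'_def x'_def)
    show "i' < r" "r \<le> j'" "j' \<le> n" using S ne y(1,2) by (auto simp: i'_def j'_def)
  qed (use inv ctx' in \<open>simp_all add: s'_def\<close>)
  moreover have "j' - i' < d" using S y(1,2) ne by (auto simp: i'_def j'_def)
  ultimately have "\<exists>d'<d. search_inv r cnt lo d' s'" by blast
  moreover have "wp Z descend Q s = Q s'" for Q
  proof (cases "r < y")
    case True
    \<comment> \<open>Going left keeps the left end, so the update of \<open>i_v\<close> in
      \<open>s'\<close> is void.\<close>
    then have upd: "(nv s)(j_v := j') = (nv s)(i_v := i', j_v := j')"
      by (auto simp: i'_def nvs fun_eq_iff)
    have "wp Z descend Q s = Q (s\<lparr>nv := (nv s)(j_v := j', S_v := x', ix_v := cell i' j' x',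
      rt_v := na s0 RT (cell i' j' x'), e_v := na s0 CH (cell i' j' x'))\<rparr>)"
    proof -
      have vals: "i' = i" "j' = y - 1" "x' = na b LL e" using True by (simp_all add: i'_def j'_def x'_def)
      show ?thesis
        using wp_descend(1)[where Q = Q and Z = Z, OF nvs True] unfolding vals .
    qed
    then show ?thesis unfolding s'_def upd[symmetric] .
  next
    case False
    then have upd: "(nv s)(i_v := i') = (nv s)(i_v := i', j_v := j')"
      by (auto simp: j'_def nvs fun_eq_iff)
    have "wp Z descend Q s = Q (s\<lparr>nv := (nv s)(i_v := i', S_v := x', ix_v := cell i' j' x',
      rt_v := na s0 RT (cell i' j' x'), e_v := na s0 CH (cell i' j' x'))\<rparr>)"
    proof -
      have vals: "i' = y" "j' = j" "x' = na b LR e" using False by (simp_all add: i'_def j'_def x'_def)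
      show ?thesis
        using wp_descend(2)[where Q = Q and Z = Z, OF nvs False] unfolding vals .
    qed
    then show ?thesis unfolding s'_def upd[symmetric] .
  qed
  ultimately show ?thesis by (simp only:)
qed

definition written :: "store \<Rightarrow> nat \<Rightarrow> bool" where
  "written s y \<longleftrightarrow> (\<exists>l r. Internal l y r \<in> subtrees T \<and> low s y = pointer l \<and> low s (n + y) = pointer r \<and>
     low s (n + n + y) = real (address y))"

definition output_inv :: "nat \<Rightarrow> store \<Rightarrow> bool" where
  "output_inv r s \<longleftrightarrow> frame s \<and> nv s r_v = r \<and> nv s cnt_v = k + card {y \<in> {1..r}. \<alpha> y = 0} \<and>
     (\<forall>y\<in>{1..r}. written s y)"

text \<open>\<open>s1\<close> is the store before the search. Its output for smaller keys is still
  in place, and since \<open>Suc r \<le> n\<close> the three new cells do not overlap it.\<close>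

lemma emit_key_correct:
  assumes "search_inv (Suc r) (k + card {y \<in> {1..r}. \<alpha> y = 0}) lo d s" "nv s r_v = nv s rt_v"
    and "output_inv r s1" "low s1 = lo"
  shows "wp (8 * n) emit_key (output_inv (Suc r)) s"
proof -
  note inv = assms(1)[unfolded search_inv_def frame_def ctx_def]
  obtain i j x S where S: "S \<in> subtrees T" "bst i j S" "follows (tab s0) \<alpha> i j x S" "i < Suc r" "Suc r \<le> j" "j \<le> n"
    "nv s i_v = i" "nv s j_v = j" "nv s rt_v = na s0 RT (cell i j x)" "nv s e_v = na s0 CH (cell i j x)"
    using inv by blast
  then obtain l y rr where node: "S = Internal l y rr" by (cases S) auto
  define e where "e = na s0 CH (cell i j x)"
  have y: "i < y" "y \<le> j" "bst i (y - 1) l" "bst y j rr" "na s0 RT (cell i j x) = y"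
    "follows (tab s0) \<alpha> i (y - 1) (na b LL e) l" "follows (tab s0) \<alpha> y j (na b LR e) rr" "\<alpha> y = na b LA e"
    using S(2,3) by (simp_all add: node e_def)
  have "y = Suc r" using assms(2) inv S(9) y(5) by simp
  note y = y[unfolded this] and node = node[unfolded this]
  have nvs: "nv s n_v = n" "nv s n1_v = n1" "nv s P_v = K" "nv s r_v = Suc r" "nv s rt_v = Suc r" "nv s e_v = e"
    "nv s i_v = i" "nv s j_v = j" "na s = na s0" "na s0 LL = na b LL" "na s0 LR = na b LR" "na s0 LA = na b LA"
    "nv s cnt_v = k + card {y \<in> {1..r}. \<alpha> y = 0}" "low s = lo"
    using inv S y(5) by (simp_all add: e_def na_s0)
  \<comment> \<open>The root entries of both child intervals are the child pointers, also for an
    external child.\<close>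
  have ptr: "pointer l = real (na s0 RT (cell i r (na b LL e)))"
    "pointer rr = real (na s0 RT (cell (Suc r) j (na b LR e)))"
    using follows_pointer[OF y(3,6)] follows_pointer[OF y(4,7)] solved_s0[of i r] solved_s0[of "Suc r" j]
      S(4-6) by simp_all
  have set: "{y \<in> {1..Suc r}. \<alpha> y = 0} =
      (if \<alpha> (Suc r) = 0 then insert (Suc r) {y \<in> {1..r}. \<alpha> y = 0} else {y \<in> {1..r}. \<alpha> y = 0})"
    by (auto simp: le_Suc_eq)
  define cnt where "cnt = k + card {y \<in> {1..Suc r}. \<alpha> y = 0}"
  have cnt: "cnt = (if \<alpha> (Suc r) = 0 then Suc (nv s cnt_v) else nv s cnt_v)"
    unfolding cnt_def set by (simp add: nvs)
  have addr: "address (Suc r) = (if \<alpha> (Suc r) = 0 then cnt else \<alpha> (Suc r))"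
    by (simp add: address_def cnt_def)
  define s' where "s' = s\<lparr>nv := (nv s)(cnt_v := cnt), low := lo(Suc r := pointer l,
      n + Suc r := pointer rr, n + n + Suc r := real (address (Suc r)))\<rparr>"
  have r: "Suc r \<le> n" using S(5,6) by simp
  have bounds: "Suc r < 8 * n" "n + Suc r < 8 * n" "n + n + Suc r < 8 * n" using r by linarith+
  have "wp (8 * n) emit_key Q s = Q s'" for Q
  proof (cases "\<alpha> (Suc r) = 0")
    case True
    then show ?thesis
      using bounds y(8) unfolding s'_def addr cnt
      by (simp add: emit_key_def nvs exp_simps ptr)
  next
    case False
    have "(nv s)(cnt_v := cnt) = nv s" using False cnt by auto
    then show ?thesis
      using False bounds y(8) unfolding s'_def addr
      by (simp add: emit_key_def nvs exp_simps ptr)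
  qed
  moreover have "output_inv (Suc r) s'"
    unfolding output_inv_def
  proof (intro conjI ballI)
    show "frame s'" using inv by (simp add: frame_def ctx_def s'_def na_s0)
    show "nv s' r_v = Suc r" "nv s' cnt_v = k + card {y \<in> {1..Suc r}. \<alpha> y = 0}"
      using nvs by (simp_all add: s'_def cnt_def)
    fix z assume z: "z \<in> {1..Suc r}"
    show "written s' z"
    proof (cases "z = Suc r")
      case True
      have "Internal l (Suc r) rr \<in> subtrees T" using S(1) node by simp
      moreover have "low s' (Suc r) = pointer l" "low s' (n + Suc r) = pointer rr"
        "low s' (n + n + Suc r) = real (address (Suc r))"
        using r by (simp_all add: s'_def)
      ultimately show ?thesis unfolding written_def True by blast
    next
      case False
      then have "written s1 z" using z assms(3) by (simp add: output_inv_def)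
      moreover have "low s' z = low s1 z" "low s' (n + z) = low s1 (n + z)" "low s' (n + n + z) = low s1 (n + n + z)"
        using False z r assms(4) by (auto simp: s'_def)
      ultimately show ?thesis unfolding written_def by simp
    qed
  qed
  ultimately show ?thesis by simp
qed

text \<open>The walk starts with an interval of length \<open>n\<close> that shrinks at every
  descent, so it takes at most \<open>n\<close> of them.\<close>

lemma output_key_correct:
  assumes "output_inv r s" "r < n"
  shows "runs (8 * n) output_key s (key_time * n) (output_inv (Suc r))"
  unfolding output_key_def key_time_def
proof (rule runs_wp_Seq)
  note inv = assms(1)[unfolded output_inv_def frame_def ctx_def]
  let ?c = "cell 0 n (K - 2)"
  let ?cnt = "k + card {y \<in> {1..r}. \<alpha> y = 0}"
  define s1 where "s1 = s\<lparr>nv := (nv s)(r_v := Suc r, i_v := 0, j_v := n, S_v := K - 2, ix_v := ?c,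
    rt_v := na s0 RT ?c, e_v := na s0 CH ?c)\<rparr>"
  have "search_inv (Suc r) ?cnt (low s) n s1"
    unfolding search_inv_def
  proof (intro conjI exI)
    show "T \<in> subtrees T" by (rule subtrees_refl)
    show "bst 0 n T" "follows (tab s0) \<alpha> 0 n (K - 2) T" by (rule T)+
  qed (use inv assms(2) in \<open>simp_all add: s1_def frame_def ctx_def na_s0\<close>)
  then have "runs (8 * n) (WhileNe (NV r_v) (NV rt_v) descend) s1
    (n * (nsize (NV r_v) + nsize (NV rt_v) + time descend + 2) + (nsize (NV r_v) + nsize (NV rt_v) + 1))
    (\<lambda>s'. (\<exists>d. search_inv (Suc r) ?cnt (low s) d s') \<and> nval s' (NV r_v) = nval s' (NV rt_v))"
  proof (rule runs_WhileNe)
    show "runs (8 * n) descend s' (time descend) (\<lambda>s''. \<exists>d'<d. search_inv (Suc r) ?cnt (low s) d' s'')"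
      if "search_inv (Suc r) ?cnt (low s) d s'" "nval s' (NV r_v) \<noteq> nval s' (NV rt_v)" for d s'
      using runs_wp[OF descend_correct[OF that(1)]] that(2) by simp
  qed simp
  then have "runs (8 * n) (WhileNe (NV r_v) (NV rt_v) descend) s1 (search_time * n)
      (wp (8 * n) emit_key (output_inv (Suc r)))"
  proof (rule runs_conseq)
    show "n * (nsize (NV r_v) + nsize (NV rt_v) + time descend + 2) + (nsize (NV r_v) + nsize (NV rt_v) + 1)
      \<le> search_time * n"
      using n_pos by (simp add: search_time_def algebra_simps)
    fix s' assume "(\<exists>d. search_inv (Suc r) ?cnt (low s) d s') \<and> nval s' (NV r_v) = nval s' (NV rt_v)"
    then show "wp (8 * n) emit_key (output_inv (Suc r)) s'"
      using emit_key_correct[OF _ _ assms(1) refl] by auto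
  qed
  then have "runs (8 * n) (WhileNe (NV r_v) (NV rt_v) descend ;; emit_key) s1
      ((search_time + time emit_key) * n) (output_inv (Suc r))"
    by (rule runs_Seq_wp[OF _ n_pos])
  moreover have "2 \<le> K" by (simp add: K_def)
  moreover have "nv s n_v = n" "nv s n1_v = n1" "nv s P_v = K" "nv s r_v = r" "na s = na s0"
    using inv by simp_all
  ultimately show "wp (8 * n) key_init
    (\<lambda>s'. runs (8 * n) (WhileNe (NV r_v) (NV rt_v) descend ;; emit_key) s'
      ((search_time + time emit_key) * n) (output_inv (Suc r))) s"
    unfolding s1_def by (simp add: key_init_def look_up_def exp_simps)
qed (rule n_pos)

text \<open>Overwriting the input is harmless here: the output phase reads only variables and
  arrays.\<close>

lemma output_all_correct:
  "runs (8 * n) output_all s0 (output_time * (n * n))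
     (\<lambda>s. low s 0 = pointer T \<and> (\<forall>y\<in>{1..n}. written s y))"
  unfolding output_all_def output_time_def
proof (rule runs_wp_Seq)
  let ?post = "output_root"
  let ?Q = "\<lambda>s. low s 0 = pointer T \<and> (\<forall>y\<in>{1..n}. written s y)"
  let ?s = "s0\<lparr>nv := (nv s0)(r_v := 0, cnt_v := k)\<rparr>"
  have "output_inv 0 ?s"
    using s0(1) by (simp add: output_inv_def frame_def ctx_def)
  then have "runs (8 * n) (WhileNe (NV r_v) (NV n_v) output_key) ?s
    (2 * (nsize (NV n_v) + key_time + 3) * (n * n)) (output_inv n)"
  proof (rule runs_for_bound[where I = output_inv and ?i0.0 = 0])
    show "runs (8 * n) output_key s (key_time * n) (output_inv (Suc r))"
      if "output_inv r s" "r < n" for r s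
      by (rule output_key_correct[OF that])
  qed (use n_pos in \<open>auto simp: output_inv_def frame_def ctx_def\<close>)
  then have "runs (8 * n) (WhileNe (NV r_v) (NV n_v) output_key) ?s
    (2 * (1 + key_time + 3) * (n * n)) (wp (8 * n) ?post ?Q)"
  proof (rule runs_conseq)
    fix s assume inv: "output_inv n s"
    have nvs: "nv s n_v = n" "nv s n1_v = n1" "nv s P_v = K" "na s = na s0"
      using inv by (simp_all add: output_inv_def frame_def ctx_def)
    have "pointer T = real (na s0 RT (cell 0 n (K - 2)))"
      using follows_pointer[OF T] solved_s0[of 0 n] by simp
    moreover have "written (s\<lparr>low := (low s)(0 := a)\<rparr>) y" if "y \<in> {1..n}" for a y
    proof -
      have "written s y" using inv that by (simp add: output_inv_def)
      then show ?thesis using that by (simp add: written_def)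
    qed
    moreover have "2 \<le> K" by (simp add: K_def)
    ultimately show "wp (8 * n) ?post ?Q s"
      using n_pos by (simp add: output_root_def nvs exp_simps)
  qed simp
  then have "runs (8 * n) (WhileNe (NV r_v) (NV n_v) output_key ;; ?post) ?s
    ((2 * (1 + key_time + 3) + time ?post) * (n * n)) ?Q"
    by (rule runs_Seq_wp) (use n_pos in simp)
  then show "wp (8 * n) (NAsg r_v (NC 0) ;; NAsg cnt_v (NV k_v))
    (\<lambda>s. runs (8 * n) (WhileNe (NV r_v) (NV n_v) output_key ;; ?post) s
      ((2 * (1 + key_time + 3) + time ?post) * (n * n)) ?Q) s0"
    using s0(1) by (simp add: ctx_def)
qed (use n_pos in simp)

end

section \<open>The time bound and the complete program\<close>

lemma fact_mult_power_le:
  fixes h k :: nat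
  assumes "2 \<le> h" "h \<le> k + 1"
  shows "fact (h - 2) * 2 ^ k \<le> (k + h) ^ k"
proof -
  have "fact (h - 2) \<le> (h - 2) ^ (h - 2)"
    using fact_le_power[of "h - 2", where 'a = nat] by simp
  also have "\<dots> \<le> (h - 1) ^ (h - 2)" by (intro power_mono) auto
  also have "\<dots> \<le> (h - 1) ^ k" using assms by (intro power_increasing) auto
  finally have "fact (h - 2) * 2 ^ k \<le> (h - 1) ^ k * 2 ^ k" by (rule mult_right_mono) simp
  also have "\<dots> = ((h - 1) * 2) ^ k" by (simp add: power_mult_distrib)
  also have "\<dots> \<le> (k + h) ^ k" using assms by (intro power_mono) auto
  finally show ?thesis .
qed

definition program_time :: nat where
  "program_time = time setup_vars + list_time + solve_time + output_time + 3"

text \<open>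
  The array area starts at \<open>8 n\<close>, beyond the input and beyond the output block, which is written
  over the input at address 0.
\<close>

definition main_program :: program where
  "main_program = [Load 1 0, Const 2 8, Mul 1 1 2] @ comp 3 main_com @ [Halt]"

context hmm_instance
begin

lemma main_com_correct:
  "runs (8 * n) main_com \<lparr>nv = \<lambda>_. 0, rv = \<lambda>_. 0, na = \<lambda>_ _. 0, ra = \<lambda>_ _. 0, low = input\<rparr>
     (time setup_vars + (list_time + (solve_time + output_time)) * (n ^ 3 * 4 ^ k))
     (\<lambda>s. \<exists>T \<phi>. is_optimum n h m c p q T \<phi> \<and> bst 0 n T \<and> low s 0 = pointer T \<and>
        (\<forall>y\<in>{1..n}. \<exists>l r. Internal l y r \<in> subtrees T \<and> low s y = pointer l \<and>
          low s (n + y) = pointer r \<and> low s (n + n + y) = real (\<phi> y)))"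
    (is "runs _ _ ?s0 _ ?Q")
proof -
  let ?N = "n ^ 3 * 4 ^ k"
  \<comment> \<open>The stores \<open>b\<close> and \<open>s\<close> arise only during the run, so
    the locales are interpreted for them inside the proof.\<close>
  have out: "runs (8 * n) output_all s (output_time * ?N) ?Q"
    if listed: "hmm_listed n h m c p q b" and ctx: "hmm_listed.ctx n h m b s"
      and filled: "hmm_listed.filled n h m c p q b 0 (Suc n) s" for b s
  proof -
    interpret hmm_listed n h m c p q b by (rule listed)
    have solved: "solved (tab s) i j" if "i \<le> j" "j \<le> n" for i j
    proof (rule filledD(1)[OF filled that])
      show "0 < i \<or> i = 0 \<and> j < Suc n" using that(2) by linarith
    qed
    obtain T \<alpha> where tree: "bst 0 n T" "follows (tab s) \<alpha> 0 n (K - 2) T" "nonzero_inj \<alpha> 0 n"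
      "addresses_used \<alpha> 0 n = {1..k}"
      "is_optimum n h m c p q T (\<lambda>x. if \<alpha> x = 0 then k + card {y \<in> {1..x}. \<alpha> y = 0} else \<alpha> x)"
      by (rule solved_optimum[OF solved lists_splits_tab])
    interpret hmm_solved n h m c p q b s T \<alpha>
      by unfold_locales (rule ctx filled tree)+
    have opt: "is_optimum n h m c p q T address"
      using tree(5) unfolding address_def[abs_def] .
    have "n * n \<le> ?N"
    proof -
      have "n * n * 1 \<le> n * n * (n * 4 ^ k)" using n_pos by (intro mult_le_mono2) simp
      then show ?thesis by (simp add: power3_eq_cube mult_ac)
    qed
    then have time: "output_time * (n * n) \<le> output_time * ?N" by (rule mult_le_mono2)
    show ?thesis
    proof (rule runs_conseq[OF output_all_correct time])
      fix s' assume *: "low s' 0 = pointer T \<and> (\<forall>y\<in>{1..n}. written s' y)"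
      show "?Q s'"
        by (rule exI[of _ T], rule exI[of _ address], intro conjI, rule opt, rule tree(1), rule *[THEN conjunct1],
          rule *[THEN conjunct2, unfolded written_def])
    qed
  qed
  have solve: "runs (8 * n) (solve_all ;; output_all) b ((solve_time + output_time) * ?N) ?Q"
    if "list_inv k b" for b
  proof -
    interpret hmm_listed n h m c p q b by unfold_locales (rule that)
    have "runs (8 * n) solve_all b (solve_time * ?N) (\<lambda>s. runs (8 * n) output_all s (output_time * ?N) ?Q)"
      by (rule runs_conseq[OF solve_all_correct order_refl])
        (rule out[OF hmm_listed_axioms], erule conjunct1, erule conjunct2)
    from runs_Seq[OF this] show ?thesis by (simp only: add_mult_distrib)
  qed
  have list: "runs (8 * n) (list_loop ;; solve_all ;; output_all) s
      ((list_time + (solve_time + output_time)) * ?N) ?Q"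
    if "list_inv 0 s" for s
  proof -
    have "n * 4 ^ k \<le> ?N" using n_pos by (simp add: power3_eq_cube)
    then have "list_time * (n * 4 ^ k) \<le> list_time * ?N" by (rule mult_le_mono2)
    with list_loop_correct[OF that] have
      "runs (8 * n) list_loop s (list_time * ?N) (\<lambda>s'. runs (8 * n) (solve_all ;; output_all) s'
        ((solve_time + output_time) * ?N) ?Q)"
      by (rule runs_conseq) (rule solve)
    from runs_Seq[OF this] show ?thesis by (simp only: add_mult_distrib)
  qed
  have "runs (8 * n) setup_vars ?s0 (time setup_vars) (\<lambda>s. runs (8 * n) (list_loop ;; solve_all ;; output_all) s
      ((list_time + (solve_time + output_time)) * ?N) ?Q)"
    by (rule runs_conseq[OF runs_wp[OF setup_vars_correct] order_refl]) (rule list)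
  from runs_Seq[OF this] show ?thesis by (simp only: main_com_def)
qed

lemma length_encode: "length (encode_instance n h m c p q) = 2 * h + 2 * n + 3"
  by (simp add: encode_instance_def)

lemma main_program_correct:
  "\<exists>t T \<phi>. outputs_solution main_program (encode_instance n h m c p q) t n T \<phi> \<and>
     is_optimum n h m c p q T \<phi> \<and> t \<le> program_time * (n ^ 3 * 4 ^ k)"
proof -
  let ?s0 = "\<lparr>nv = \<lambda>_. 0, rv = \<lambda>_. 0, na = \<lambda>_ _. 0, ra = \<lambda>_ _. 0, low = input\<rparr>"
  let ?C = "comp 3 main_com"
  let ?R = "\<lambda>r. if r = 1 then real (8 * n) else if r = 2 then 8 else (0::real)"
  have init: "initial_config (encode_instance n h m c p q) = (0, \<lambda>_. 0, input)"
    by (simp add: initial_config_def input_def Let_def)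
  have code: "code_at main_program 0 ([Load 1 0, Const 2 8, Mul 1 1 2] @ ?C @ [Halt])"
    unfolding code_at_def main_program_def by (intro exI[of _ "[]"]) simp
  then have c1: "code_at main_program 0 [Load 1 0, Const 2 8, Mul 1 1 2]"
    and c2: "code_at main_program 3 ?C" and c3: "code_at main_program (3 + length ?C) [Halt]"
    by (simp_all only: code_at_append) (simp_all add: add.commute numeral_3_eq_3)
  have "run [Load 1 0, Const 2 8, Mul 1 1 2] (\<lambda>_. 0, input) = Some (?R, input)"
    by (auto simp: input_eqs fun_eq_iff)
  from run_steps[OF this c1] have 1: "((0, \<lambda>_. 0, input), (3, ?R, input)) \<in> step main_program ^^ 3"
    by (simp add: numeral_3_eq_3)
  \<comment> \<open>Memory beyond the input is zero, so all arrays start with zeros.\<close>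
  have high: "input a = 0" if "8 * n \<le> a" for a
    using that memory_bounds(1) length_encode by (simp add: input_def Let_def)
  \<comment> \<open>Register 2 still holds 8 from the computation of the base; it is the temporary
    \<open>tmp 0\<close>, which \<open>store_rel\<close> leaves open.\<close>
  have regs: "nreg v \<noteq> 2" "rreg v \<noteq> 2" for v
    by (simp_all add: nreg_def rreg_def)
  have "store_rel (8 * n) ?s0 (?R, input)"
    unfolding store_rel_def using high regs by simp
  from main_com_correct[unfolded runs_def, rule_format, OF c2 this] obtain t R M s' T \<phi>
    where t: "t \<le> time setup_vars + (list_time + (solve_time + output_time)) * (n ^ 3 * 4 ^ k)"
    and 2: "((3, ?R, input), (3 + length ?C, R, M)) \<in> step main_program ^^ t"
    and rel: "store_rel (8 * n) s' (R, M)"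
    and opt: "is_optimum n h m c p q T \<phi>" and T: "bst 0 n T" and root: "low s' 0 = pointer T"
    and keys: "\<And>y. y \<in> {1..n} \<Longrightarrow> \<exists>l r. Internal l y r \<in> subtrees T \<and> low s' y = pointer l \<and>
          low s' (n + y) = pointer r \<and> low s' (n + n + y) = real (\<phi> y)"
    by fast
  have M: "M a = low s' a" if "a < 8 * n" for a
    using rel that by (simp add: store_rel_def)
  have "halts_in main_program (encode_instance n h m c p q) (3 + t) R M"
    unfolding halts_in_def init
  proof (intro exI conjI)
    show "((0, \<lambda>_. 0, input), (3 + length ?C, R, M)) \<in> step main_program ^^ (3 + t)"
      by (rule step_comp[OF 1 2])
    show "halted main_program (3 + length ?C, R, M)"
      using c3 by (simp add: halted_def code_at_Cons)
  qed
  moreover have "R 0 = real 0" using rel by (simp add: store_rel_def)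
  moreover have "encodes_solution n M 0 T \<phi>"
    unfolding encodes_solution_def
  proof (intro conjI allI impI ballI)
    show "M 0 = pointer T" using root M[of 0] n_pos by simp
    fix l i r assume node: "Internal l i r \<in> subtrees T"
    then have i: "0 < i" "i \<le> n" using bst_subtree_Key[OF T node, of i] by simp_all
    then obtain l' r' where n': "Internal l' i r' \<in> subtrees T" "low s' i = pointer l'" "low s' (n + i) = pointer r'"
      using keys[of i] by auto
    have bounds: "i < 8 * n" "n + i < 8 * n" using i n_pos by linarith+
    \<comment> \<open>\<open>keys\<close> supplies some node with key \<open>i\<close>; as a key
      labels only one node, it is the given one.\<close>
    have "Internal l i r = Internal l' i r'"
      using subtree_at_eq[OF T node, of i] subtree_at_eq[OF T n'(1), of i] by simp
    then show "M (0 + i) = pointer l" "M (0 + n + i) = pointer r"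
      using n' M[of i] M[of "n + i"] bounds by simp_all
  next
    fix i assume i: "i \<in> {1..n}"
    then have "n + n + i < 8 * n" by simp
    then show "M (0 + 2 * n + i) = real (\<phi> i)"
      using keys[OF i] M[of "n + n + i"] by (auto simp: mult_2)
  qed
  ultimately have "outputs_solution main_program (encode_instance n h m c p q) (3 + t) n T \<phi>"
    unfolding outputs_solution_def by blast
  moreover have "3 + t \<le> program_time * (n ^ 3 * 4 ^ k)"
  proof -
    have "1 \<le> n ^ 3 * 4 ^ k" using n_pos by simp
    from mult_le_mono2[OF this, of "time setup_vars + 3"] show ?thesis
      using t by (simp add: program_time_def add_mult_distrib)
  qed
  ultimately show ?thesis using opt by blast
qed

end

theorem mainTheorem2:
  shows "\<exists>(P :: program) (C :: real). \<forall>n h m c p q.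
    hmm_bst_instance n h m c p q \<and> h \<ge> 2 \<longrightarrow>
    (\<exists>t T \<phi>.
       outputs_solution P (encode_instance n h m c p q) t n T \<phi> \<and>
       is_optimum n h m c p q T \<phi> \<and>
       real t \<le> C * (2 ^ (n - m h) * real (n - m h + h) ^ (n - m h) * real n ^ 3 / fact (h - 2)))"
proof (intro exI[of _ main_program] exI[of _ "real program_time"] allI impI)
  fix n h :: nat and m c :: "nat \<Rightarrow> nat" and p q :: "nat \<Rightarrow> real"
  assume "hmm_bst_instance n h m c p q \<and> h \<ge> 2"
  then interpret hmm_instance n h m c p q by unfold_locales auto
  obtain t T \<phi> where t: "outputs_solution main_program (encode_instance n h m c p q) t n T \<phi>"
    "is_optimum n h m c p q T \<phi>" "t \<le> program_time * (n ^ 3 * 4 ^ k)"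
    using main_program_correct by blast
  \<comment> \<open>One factor \<open>2 ^ k\<close> stays in the bound, the other is traded against
    the factorial.\<close>
  have "(4::nat) ^ k = 2 ^ k * 2 ^ k" by (simp flip: power_mult_distrib)
  then have "4 ^ k * fact (h - 2) \<le> 2 ^ k * (k + h) ^ k"
    using mult_le_mono2[OF fact_mult_power_le[OF h2 h_le], of "2 ^ k"] by (simp add: mult_ac)
  then have "real (4 ^ k * fact (h - 2)) \<le> real (2 ^ k * (k + h) ^ k)" by (simp only: of_nat_le_iff)
  then have "(4::real) ^ k \<le> 2 ^ k * real (k + h) ^ k / fact (h - 2)"
    by (simp add: field_simps)
  then have "real n ^ 3 * 4 ^ k \<le> real n ^ 3 * (2 ^ k * real (k + h) ^ k / fact (h - 2))"
    by (rule mult_left_mono) simp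
  also have "\<dots> = 2 ^ k * real (k + h) ^ k * real n ^ 3 / fact (h - 2)" by simp
  finally have bound: "real program_time * (real n ^ 3 * 4 ^ k) \<le>
      real program_time * (2 ^ k * real (k + h) ^ k * real n ^ 3 / fact (h - 2))"
    by (rule mult_left_mono) simp
  have "real t \<le> real (program_time * (n ^ 3 * 4 ^ k))"
    using t(3) by (simp only: of_nat_le_iff)
  also have "\<dots> = real program_time * (real n ^ 3 * 4 ^ k)" by simp
  also note bound
  finally have "real t \<le> real program_time * (2 ^ k * real (k + h) ^ k * real n ^ 3 / fact (h - 2))" .
  then show "\<exists>t T \<phi>. outputs_solution main_program (encode_instance n h m c p q) t n T \<phi> \<and>
       is_optimum n h m c p q T \<phi> \<and>
       real t \<le> real program_time *
         (2 ^ (n - m h) * real (n - m h + h) ^ (n - m h) * real n ^ 3 / fact (h - 2))"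
    using t(1,2) unfolding k_def by blast
qed

end
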